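(* Let $p,q\ge 2$ be integers with $p\ne q$, let $n,m\ge 1$ with $m_1\ge 1$ and $n_1\ge 1$, and let $\mathcal F=\{f_i\}_{i\ge0}$ be a family as in the context. Assume: (a) $f_1$ is an odd function, $f_1\ge 0$ on $[0,T]$ and $f_1\not\equiv 0$ on $[0,T]$; (b) for every integer $r\ge 1$, the set $\{f_i^e\}_{i\in\mathcal N_r^{\text{non-odd}}}$, ordered by increasing index, is a CT-system on $(0,T)$. Let $M_1(\cdot\,;\mu)$ be the first-order Melnikov function of the perturbed equation $$\frac{dx}{dt}=\big(f_1(t)+\varepsilon P_1(t)+\varepsilon^2P_2(t)\big)x^p+\big(\varepsilon Q_1(t)+\varepsilon^2Q_2(t)\big)x^q ,$$ with parameter vector $\mu\in\mathbb R^{2(n+m+2)}$ as in the context. Suppose $M_1(\cdot\,;\mu)\not\equiv 0$ and let $Z(M_1)^+$ (resp. $Z(M_1)^-$) be the number of zeros of $M_1(\cdot\,;\mu)$ on $J\cap(0,+\infty)$ (resp. $J\cap(-\infty,0)$), counted with multiplicities. Then: (i) If $p$ and $q$ are both odd, then $Z(M_1)^{+}\le m_1+1$ and $Z(M_1)^-\le m_1+1$. Moreover, there exists $\mu_0\in\mathbb R^{2(n+m+2)}$ such that $M_1(\cdot\,;\mu_0)$ has $2(m_1+1)$ simple zeros in $J\setminus\{0\}$. (ii) If $p$ is odd and $q$ is even, then $Z(M_1)^{+}\le m_1+1$ and $Z(M_1)^-\le m_1+1$, and the two equalities cannot hold simultaneously. Moreover: (ii.1) when $p<q$, there exists $\mu_0$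 such that $M_1(\cdot\,;\mu_0)$ has $2m_1+1$ simple zeros in $J\setminus\{0\}$; (ii.2) when $p>q$, there exists $\mu_0$ such that $M_1(\cdot\,;\mu_0)$ has $2m_1$ simple zeros in $J\setminus\{0\}$. (iii) If $p$ is even, $q$ is odd and $p<q$, then $Z(M_1)^{+}+Z(M_1)^-\le m_1+1$. Moreover, there exists $\mu_0$ such that $M_1(\cdot\,;\mu_0)$ has $m_1+1$ simple zeros in $J\setminus\{0\}$. (iv) If $p$ is even and either $q$ is even or $p>q$, then $Z(M_1)^{+}+Z(M_1)^-\le m_1+2$. Moreover, there exists $\mu_0$ such that $M_1(\cdot\,;\mu_0)$ has $m_1+2$ simple zeros in $J\setminus\{0\}$.
   Context: Family. Fix $T>0$. $\mathcal F=\{f_i\}_{i=0}^\infty$ is a sequence of real-analytic functions on an open neighborhood of $[-T,T]$ with $f_0(t)>0$ on $[-T,T]$ and $\int_{-T}^Tf_k(t)\,dt=0$ for all $k\ge1$. Put $\mathcal F_k=\{f_0,\dots,f_k\}$. The even and odd parts of $f_i$ are $f_i^e(t)=\frac{f_i(t)+f_i(-t)}2$ and $f_i^o(t)=\frac{f_i(t)-f_i(-t)}2$. Index sets. $\mathcal N_k=\{0,1,\dots,k\}$ and $\mathcal N_k^{\text{non-odd}}=\{i\in\mathcal N_k: f_i^e\not\equiv0\text{ on }[-T,T]\}$. Set $m_1=\#\mathcal N_m^{\text{non-odd}}-1$ and $n_1=\#\mathcal N_n^{\text{non-odd}}-1$. CT-system. An ordered set $(g_0,\dots,g_n)$ of analytic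 functions on an open interval $I$ is a complete Chebyshev system (CT-system) on $I$ if for every $k\in\{0,\dots,n\}$ every linear combination $\alpha_0g_0+\dots+\alpha_kg_k$ with $(\alpha_0,\dots,\alpha_k)\ne 0$ has at most $k$ zeros on $I$ (in particular it is not identically zero). Perturbed equation. For $i=1,2$, $P_i=\sum_{j=0}^na_{ij}f_j$ and $Q_i=\sum_{j=0}^mb_{ij}f_j$ with real coefficients; $\mu\in\mathbb R^{2(n+m+2)}$ is the vector of all coefficients $a_{ij}$ ($i=1,2$, $0\le j\le n$) and $b_{ij}$ ($i=1,2$, $0\le j\le m$). Let $x_\varepsilon(t,\rho;\mu)$ be the solution with $x_\varepsilon(-T,\rho;\mu)=\rho$. With $F_1(t)=\int_{-T}^tf_1(s)\,ds$, for $\varepsilon=0$ it is $x_0(t,\rho)=\rho\,\big(1+(1-p)\rho^{p-1}F_1(t)\big)^{-1/(p-1)}$, defined on $[-T,T]$ for $\rho$ in $J=\{\rho\in\mathbb R: 1+(1-p)\rho^{p-1}F_1(t)>0\ \text{for all }t\in[-T,T]\}$, and $x_0(T,\rho)=\rho$ for $\rho\in J$. For $\rho\in J$ one has the expansion $x_\varepsilon(T,\rho;\mu)-\rho=\sum_{i\ge1}\varepsilon^iM_i(\rho;\mu)$ for small $\varepsilon$, with $M_i$ analytic on $J\times\mathbb R^{2(n+m+2)}$; $M_i$ is the $i$-th order Melnikov function. *)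

theory Defs
  imports "HOL-Analysis.Analysis" "HOL-Library.Extended_Nat"
begin

definition real_analytic_on :: "(real \<Rightarrow> real) \<Rightarrow> real set \<Rightarrow> bool"
  where "real_analytic_on g S \<longleftrightarrow>
    (\<forall>x\<in>S. \<exists>r>0. \<exists>c. \<forall>y. \<bar>y - x\<bar> < r \<longrightarrow> (\<lambda>k. c k * (y - x) ^ k) sums g y)"

definition admissible_family :: "real \<Rightarrow> (nat \<Rightarrow> real \<Rightarrow> real) \<Rightarrow> bool"
  where "admissible_family T f \<longleftrightarrow>
    (\<forall>i. \<exists>U. open U \<and> {-T..T} \<subseteq> U \<and> real_analytic_on (f i) U) \<and>
    (\<forall>t\<in>{-T..T}. f 0 t > 0) \<and>
    (\<forall>k\<ge>1. integral {-T..T} (f k) = 0)"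

definition even_part :: "(real \<Rightarrow> real) \<Rightarrow> real \<Rightarrow> real"
  where "even_part g t = (g t + g (- t)) / 2"

definition non_odd_indices :: "real \<Rightarrow> (nat \<Rightarrow> real \<Rightarrow> real) \<Rightarrow> nat \<Rightarrow> nat set"
  where "non_odd_indices T f k = {i. i \<le> k \<and> (\<exists>t\<in>{-T..T}. even_part (f i) t \<noteq> 0)}"

text \<open>The numbers \<open>m\<^sub>1\<close>, \<open>n\<^sub>1\<close>. For an admissible family \<open>0\<close> is always a
  non-odd index, so the subtraction does not truncate.\<close>

definition non_odd_number :: "real \<Rightarrow> (nat \<Rightarrow> real \<Rightarrow> real) \<Rightarrow> nat \<Rightarrow> nat"
  where "non_odd_number T f k = card (non_odd_indices T f k) - 1"

text \<open>Zeros are counted here without multiplicity.\<close>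

definition CT_system :: "(real \<Rightarrow> real) list \<Rightarrow> real set \<Rightarrow> bool"
  where "CT_system gs I \<longleftrightarrow>
    (\<forall>g\<in>set gs. real_analytic_on g I) \<and>
    (\<forall>k<length gs. \<forall>\<alpha>. (\<exists>i\<le>k. \<alpha> i \<noteq> 0) \<longrightarrow>
      finite {t\<in>I. (\<Sum>i\<le>k. \<alpha> i * (gs ! i) t) = 0} \<and>
      card {t\<in>I. (\<Sum>i\<le>k. \<alpha> i * (gs ! i) t) = 0} \<le> k)"

definition lin_comb :: "(nat \<Rightarrow> real \<Rightarrow> real) \<Rightarrow> nat \<Rightarrow> (nat \<Rightarrow> real) \<Rightarrow> real \<Rightarrow> real"
  where "lin_comb f k c t = (\<Sum>j\<le>k. c j * f j t)"

text \<open>The parameter vector \<open>\<mu>\<close> is the pair \<open>(a, b)\<close> of coefficient arrays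
  \<open>a i j\<close> and \<open>b i j\<close>. Only the \<open>2(n + m + 2)\<close> entries with
  \<open>i \<in> {1, 2}\<close> and \<open>j \<le> n\<close> resp. \<open>j \<le> m\<close> enter the equation.\<close>

type_synonym params = "(nat \<Rightarrow> nat \<Rightarrow> real) \<times> (nat \<Rightarrow> nat \<Rightarrow> real)"

definition perturbed_rhs ::
  "(nat \<Rightarrow> real \<Rightarrow> real) \<Rightarrow> nat \<Rightarrow> nat \<Rightarrow> nat \<Rightarrow> nat \<Rightarrow> params \<Rightarrow> real \<Rightarrow> real \<Rightarrow> real \<Rightarrow> real"
  where "perturbed_rhs f p q n m \<mu> \<epsilon> t x =
    (f 1 t + \<epsilon> * lin_comb f n (fst \<mu> 1) t + \<epsilon>\<^sup>2 * lin_comb f n (fst \<mu> 2) t) * x ^ p +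
    (\<epsilon> * lin_comb f m (snd \<mu> 1) t + \<epsilon>\<^sup>2 * lin_comb f m (snd \<mu> 2) t) * x ^ q"

definition solution ::
  "real \<Rightarrow> (nat \<Rightarrow> real \<Rightarrow> real) \<Rightarrow> nat \<Rightarrow> nat \<Rightarrow> nat \<Rightarrow> nat \<Rightarrow> params \<Rightarrow> real \<Rightarrow> real \<Rightarrow>
    (real \<Rightarrow> real) \<Rightarrow> bool"
  where "solution T f p q n m \<mu> \<epsilon> \<rho> x \<longleftrightarrow>
    x (- T) = \<rho> \<and>
    (\<forall>t\<in>{-T..T}.
      (x has_real_derivative perturbed_rhs f p q n m \<mu> \<epsilon> t (x t)) (at t within {-T..T}))"

text \<open>\<open>M i\<close> is the coefficient of \<open>\<epsilon>\<^sup>i\<close>; the expansion starts at \<open>i = 1\<close>, whence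
  \<open>M 0 = 0\<close>.\<close>

definition melnikov_expansion ::
  "real \<Rightarrow> (nat \<Rightarrow> real \<Rightarrow> real) \<Rightarrow> nat \<Rightarrow> nat \<Rightarrow> nat \<Rightarrow> nat \<Rightarrow> params \<Rightarrow> real \<Rightarrow>
    (nat \<Rightarrow> real) \<Rightarrow> bool"
  where "melnikov_expansion T f p q n m \<mu> \<rho> M \<longleftrightarrow>
    M 0 = 0 \<and>
    (\<forall>\<^sub>F \<epsilon> in nhds 0. \<exists>x. solution T f p q n m \<mu> \<epsilon> \<rho> x \<and>
      (\<lambda>i. \<epsilon> ^ i * M i) sums (x T - \<rho>))"

text \<open>The solution on \<open>[-T, T]\<close> is unique, hence so is the expansion, which exists for
  every \<open>\<rho>\<close> in \<open>unperturbed_domain\<close> below; elsewhere the value is not meaningful.\<close>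

definition melnikov ::
  "real \<Rightarrow> (nat \<Rightarrow> real \<Rightarrow> real) \<Rightarrow> nat \<Rightarrow> nat \<Rightarrow> nat \<Rightarrow> nat \<Rightarrow> nat \<Rightarrow> params \<Rightarrow> real \<Rightarrow> real"
  where "melnikov T f p q n m i \<mu> \<rho> = (THE M. melnikov_expansion T f p q n m \<mu> \<rho> M) i"

text \<open>The set \<open>J\<close>.\<close>

definition unperturbed_domain :: "real \<Rightarrow> (nat \<Rightarrow> real \<Rightarrow> real) \<Rightarrow> nat \<Rightarrow> real set"
  where "unperturbed_domain T f p =
    {\<rho>. \<forall>t\<in>{-T..T}. 1 + (1 - real p) * \<rho> ^ (p - 1) * integral {-T..t} (f 1) > 0}"

text \<open>Multiplicity is \<open>\<infinity>\<close> if all derivatives vanish (\<open>INF\<close> of the empty set).\<close>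

definition zero_mult :: "(real \<Rightarrow> real) \<Rightarrow> real \<Rightarrow> enat"
  where "zero_mult g x = (INF k\<in>{k. (deriv ^^ k) g x \<noteq> 0}. enat k)"

definition zero_count :: "(real \<Rightarrow> real) \<Rightarrow> real set \<Rightarrow> enat"
  where "zero_count g S =
    (if finite {x\<in>S. g x = 0} then \<Sum>x\<in>{x\<in>S. g x = 0}. zero_mult g x else \<infinity>)"

definition simple_zeros :: "(real \<Rightarrow> real) \<Rightarrow> real set \<Rightarrow> real set"
  where "simple_zeros g S = {x\<in>S. g x = 0 \<and> deriv g x \<noteq> 0}"

end

theory Submission
  imports Defs "HOL-Complex_Analysis.Complex_Analysis"
begin

text \<open>Solving the equation to first order in \<open>\<epsilon>\<close> gives \<open>M\<^sub>1 = A \<rho>\<^sup>p + \<rho>\<^sup>q \<Phi>(\<rho>)\<close> with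
  \<open>\<Phi>(\<rho>) = \<integral> h (1 + \<rho>\<^sup>p\<^sup>-\<^sup>1 G)\<^sup>\<kappa>\<close> over \<open>[0, T]\<close>, where \<open>G = - (p - 1) F\<^sub>1\<close> decreases, \<open>\<kappa> = (p - q) / (p - 1)\<close> is not a
  natural number and \<open>h\<close> is an arbitrary combination of the \<open>m\<^sub>1 + 1\<close> even parts, hence has at most \<open>m\<^sub>1\<close> sign
  changes. A sign change of \<open>h\<close> at \<open>\<tau>\<close> is removed by differentiating \<open>(1 + s c)\<^sup>-\<^sup>\<kappa> \<integral> h (1 + s G)\<^sup>\<kappa>\<close> with \<open>c = G(\<tau>)\<close>: the
  result is, up to a factor without zeros, the same integral with \<open>h (G - c)\<close> and \<open>\<kappa> - 1\<close>. By Rolle's theorem \<open>\<Phi>\<close>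
  has at most \<open>m\<^sub>1\<close> zeros in \<open>s = \<rho>\<^sup>p\<^sup>-\<^sup>1\<close>. The derivative of \<open>M\<^sub>1 / \<rho>\<^sup>p\<close> is again of this form, which gives all
  upper bounds. They are attained by prescribing zeros through linear algebra and, where these do not suffice, by
  perturbations creating zeros close to \<open>\<rho> = 0\<close>.\<close>

section \<open>Zeros counted with multiplicity\<close>

text \<open>With w = 1 + \<rho>^(p-1) G the unperturbed solution is x0 = \<rho> w^(-1/(p-1)), and
  its \<rho>-derivative v = w^(-p/(p-1)) solves the linearized equation. The first-order term is the
  integral of (P_1 x0^p + Q_1 x0^q) / v. Here x0^p / v is the constant \<rho>^p, so P_1 enters only
  through its mean, to which f_0 alone contributes; x0^q / v = \<rho>^q w^\<kappa> is the origin of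
  \<kappa>. From q \<ge> 2 and p \<noteq> q follow \<kappa> < 1 and \<kappa> \<noteq> 0, so none of
  \<kappa>, \<kappa> - 1, \<kappa> - 2, ... is 0 and no Rolle step meets a vanishing constant
  factor. The obstacle is the point \<rho> = 0. Rolle's theorem on the two half-lines costs one zero
  on each, which separates m_1 + 2 from m_1 + 1 for even p. Crossing 0 at the cost of a single zero
  works when q - p is odd and positive, because \<rho>^(q-p-1) then keeps its sign; but the
  substitution s = \<rho>^(p-1) may be singular at 0, so orders of zeros are not controlled there.
  Hence zeros are counted with an exceptional set.\<close>

definition vanish :: "(real \<Rightarrow> real) \<Rightarrow> real \<Rightarrow> nat \<Rightarrow> bool"
  where "vanish g x k \<longleftrightarrow> (\<forall>j<k. (deriv ^^ j) g x = 0)"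

text \<open>The derivatives are existential witnesses instead of iterates of \<open>deriv\<close>,
  so closure under sums, products and composition only needs candidates for them. No continuity of
  the last derivative is demanded: \<open>Ck 1\<close> is mere differentiability.\<close>

primrec Ck :: "nat \<Rightarrow> real set \<Rightarrow> (real \<Rightarrow> real) \<Rightarrow> bool" where
  "Ck 0 S g \<longleftrightarrow> True"
| "Ck (Suc k) S g \<longleftrightarrow> (\<exists>g'. (\<forall>x\<in>S. (g has_real_derivative g' x) (at x)) \<and> Ck k S g')"

lemma Ck_SucE:
  assumes "Ck (Suc k) S g"
  obtains g' where "\<forall>x\<in>S. (g has_real_derivative g' x) (at x)" "Ck k S g'"
  using assms by auto

lemma Ck_mono: "Ck (Suc k) S g \<Longrightarrow> Ck k S g"
  by (induction k arbitrary: g) auto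

lemma Ck_subset: "Ck k S g \<Longrightarrow> S' \<subseteq> S \<Longrightarrow> Ck k S' g"
  by (induction k arbitrary: g) (simp, fastforce)

lemma Ck_const: "Ck k S (\<lambda>x. c)"
proof (induction k arbitrary: c)
  case (Suc k)
  show ?case by (auto intro!: exI[of _ "\<lambda>x. 0"] Suc)
qed simp

lemma Ck_ident: "Ck k S (\<lambda>x. x)"
  by (cases k) (auto intro!: exI[of _ "\<lambda>x. 1"] Ck_const)

lemma Ck_add: "Ck k S f \<Longrightarrow> Ck k S g \<Longrightarrow> Ck k S (\<lambda>x. f x + g x)"
proof (induction k arbitrary: f g)
  case (Suc k)
  then obtain f' g' where "\<forall>x\<in>S. (f has_real_derivative f' x) (at x)" "Ck k S f'"
    "\<forall>x\<in>S. (g has_real_derivative g' x) (at x)" "Ck k S g'" by auto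
  then show ?case
    by (auto intro!: exI[of _ "\<lambda>x. f' x + g' x"] Suc.IH derivative_eq_intros)
qed simp

lemma Ck_mult: "Ck k S f \<Longrightarrow> Ck k S g \<Longrightarrow> Ck k S (\<lambda>x. f x * g x)"
proof (induction k arbitrary: f g)
  case (Suc k)
  then obtain f' g' where d: "\<forall>x\<in>S. (f has_real_derivative f' x) (at x)" "Ck k S f'"
    "\<forall>x\<in>S. (g has_real_derivative g' x) (at x)" "Ck k S g'" by auto
  have "Ck k S (\<lambda>x. f' x * g x + f x * g' x)"
    using Ck_add[OF Suc.IH[OF d(2) Ck_mono[OF Suc.prems(2)]] Suc.IH[OF Ck_mono[OF Suc.prems(1)] d(4)]] .
  with d show ?case
    by (auto intro!: exI[of _ "\<lambda>x. f' x * g x + f x * g' x"] derivative_eq_intros)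
qed simp

lemma Ck_power: "Ck k S (\<lambda>x. x ^ n)"
  by (induction n) (auto intro: Ck_const Ck_mult Ck_ident)

lemma Ck_compose: "Ck k S g \<Longrightarrow> Ck k I f \<Longrightarrow> f ` I \<subseteq> S \<Longrightarrow> Ck k I (\<lambda>x. g (f x))"
proof (induction k arbitrary: g)
  case (Suc k)
  then obtain f' g' where d: "\<forall>x\<in>I. (f has_real_derivative f' x) (at x)" "Ck k I f'"
    "\<forall>x\<in>S. (g has_real_derivative g' x) (at x)" "Ck k S g'" by auto
  have "Ck k I (\<lambda>x. g' (f x) * f' x)"
    using Suc.IH[OF d(4) Ck_mono[OF Suc.prems(2)] Suc.prems(3)] d(2) by (rule Ck_mult)
  moreover have "((\<lambda>x. g (f x)) has_real_derivative g' (f x) * f' x) (at x)" if "x \<in> I" for x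
    using DERIV_chain2[of g "g' (f x)" f x "f' x" UNIV] d(1,3) that Suc.prems(3) by auto
  ultimately show ?case
    unfolding Ck.simps by (intro exI[of _ "\<lambda>x. g' (f x) * f' x"] conjI ballI)
qed simp

lemma Ck_powr_affine: "Ck k {s. 1 + s * c > 0} (\<lambda>s. (1 + s * c) powr a)"
proof (induction k arbitrary: a)
  case (Suc k)
  have "((\<lambda>s. (1 + s * c) powr a) has_real_derivative (a * c) * (1 + s * c) powr (a - 1)) (at s)"
    if "1 + s * c > 0" for s
  proof -
    have "((\<lambda>s. 1 + s * c) has_real_derivative c) (at s)"
      by (auto intro!: derivative_eq_intros)
    from DERIV_fun_powr[OF this that, of a] show ?thesis by (simp add: mult_ac)
  qed
  then show ?case
    unfolding Ck.simps using Ck_mult[OF Ck_const Suc, of "a * c" "a - 1"]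
    by (intro exI[of _ "\<lambda>s. (a * c) * (1 + s * c) powr (a - 1)"]) auto
qed simp

lemma Ck_power_int: "0 \<notin> S \<Longrightarrow> Ck k S (\<lambda>x. x powi n)"
proof (induction k arbitrary: n)
  case (Suc k)
  have "((\<lambda>x. x powi n) has_real_derivative of_int n * x powi (n - 1)) (at x)" if "x \<in> S" for x
    using that Suc.prems by (auto intro!: derivative_eq_intros)
  then show ?case
    unfolding Ck.simps using Ck_mult[OF Ck_const Suc.IH[OF Suc.prems], of "of_int n" "n - 1"]
    by (intro exI[of _ "\<lambda>x. of_int n * x powi (n - 1)"]) auto
qed simp

lemma Ck_continuous: "Ck (Suc 0) S g \<Longrightarrow> continuous_on S g"
  using Ck_SucE[of 0 S g] DERIV_isCont continuous_at_imp_continuous_on by metis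

section \<open>Order of vanishing at a point\<close>

lemma funpow_deriv_cong:
  assumes "open S" "\<And>y. y \<in> S \<Longrightarrow> f y = g y" "x \<in> S"
  shows "(deriv ^^ k) f x = (deriv ^^ k) (g :: real \<Rightarrow> real) x"
  using assms(3)
proof (induction k arbitrary: x)
  case (Suc k)
  have "eventually (\<lambda>y. (deriv ^^ k) f y = (deriv ^^ k) g y) (nhds x)"
    using Suc assms(1) by (auto simp: eventually_nhds)
  then show ?case by (simp add: deriv_cong_ev)
qed (use assms in auto)

lemma vanish_cong:
  assumes "open S" "\<And>y. y \<in> S \<Longrightarrow> f y = g y" "x \<in> S"
  shows "vanish f x k \<longleftrightarrow> vanish g x k"
  using funpow_deriv_cong[OF assms] by (simp add: vanish_def)

lemma vanish_Suc_deriv: "vanish g x (Suc k) \<longleftrightarrow> g x = 0 \<and> vanish (deriv g) x k"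
  unfolding vanish_def All_less_Suc2 funpow_Suc_right o_apply by simp

text \<open>Replaces one \<open>deriv\<close> by an explicitly known derivative; the inductions on
  the order of vanishing all descend through this equivalence.\<close>

lemma vanish_Suc:
  assumes "open S" "x \<in> S" "\<forall>y\<in>S. (g has_real_derivative g' y) (at y)"
  shows "vanish g x (Suc k) \<longleftrightarrow> g x = 0 \<and> vanish g' x k"
  using vanish_cong[of S "deriv g" g' x k] assms by (simp add: vanish_Suc_deriv DERIV_imp_deriv)

lemma vanish_mono: "vanish g x k \<Longrightarrow> j \<le> k \<Longrightarrow> vanish g x j"
  by (auto simp: vanish_def)

lemma vanish_0 [simp]: "vanish g x 0"
  by (simp add: vanish_def)

lemma vanish_1 [simp]: "vanish g x (Suc 0) \<longleftrightarrow> g x = 0"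
  by (simp add: vanish_def)

lemma vanish_add:
  assumes "open S" "x \<in> S"
  shows "Ck k S f \<Longrightarrow> Ck k S g \<Longrightarrow> vanish f x k \<Longrightarrow> vanish g x k \<Longrightarrow> vanish (\<lambda>y. f y + g y) x k"
proof (induction k arbitrary: f g)
  case (Suc k)
  then obtain f' g' where d: "\<forall>x\<in>S. (f has_real_derivative f' x) (at x)" "Ck k S f'"
    "\<forall>x\<in>S. (g has_real_derivative g' x) (at x)" "Ck k S g'" by auto
  have "vanish (\<lambda>y. f' y + g' y) x k"
    using Suc.IH[of f' g'] d Suc.prems(3,4) vanish_Suc[OF assms d(1)] vanish_Suc[OF assms d(3)] by simp
  moreover have "\<forall>y\<in>S. ((\<lambda>y. f y + g y) has_real_derivative f' y + g' y) (at y)"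
    using d by (auto intro!: derivative_eq_intros)
  ultimately show ?case
    using vanish_Suc[OF assms, of "\<lambda>y. f y + g y"] Suc.prems(3,4) vanish_Suc[OF assms d(1)]
      vanish_Suc[OF assms d(3)] by simp
qed simp

lemma vanish_mult:
  assumes "open S" "x \<in> S"
  shows "Ck k S w \<Longrightarrow> Ck k S g \<Longrightarrow> vanish g x k \<Longrightarrow> vanish (\<lambda>y. w y * g y) x k"
proof (induction k arbitrary: w g)
  case (Suc k)
  then obtain w' g' where d: "\<forall>x\<in>S. (w has_real_derivative w' x) (at x)" "Ck k S w'"
    "\<forall>x\<in>S. (g has_real_derivative g' x) (at x)" "Ck k S g'" by auto
  have v: "vanish g' x k" "g x = 0" "vanish g x k"
    using vanish_Suc[OF assms d(3)] Suc.prems(3) vanish_mono[OF Suc.prems(3), of k] by auto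
  have C: "Ck k S w" "Ck k S g" using Suc.prems Ck_mono by blast+
  have "vanish (\<lambda>y. w' y * g y + w y * g' y) x k"
    using Suc.IH C d v by (intro vanish_add[OF assms] Ck_mult) auto
  moreover have "\<forall>y\<in>S. ((\<lambda>y. w y * g y) has_real_derivative w' y * g y + w y * g' y) (at y)"
    using d by (auto intro!: derivative_eq_intros)
  ultimately show ?case
    using vanish_Suc[OF assms, of "\<lambda>y. w y * g y"] v by simp
qed simp

text \<open>Division by u without differentiating 1/u: by induction g already vanishes to order k,
  hence so does u' g; subtracting it from (u g)' leaves u g', and the induction hypothesis for g'
  gives the missing order.\<close>

lemma vanish_cancel:
  assumes "open S" "x \<in> S" "u x \<noteq> 0"
  shows "Ck k S u \<Longrightarrow> Ck k S g \<Longrightarrow> vanish (\<lambda>y. u y * g y) x k \<Longrightarrow> vanish g x k"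
proof (induction k arbitrary: g)
  case (Suc k)
  then obtain u' g' where d: "\<forall>x\<in>S. (u has_real_derivative u' x) (at x)" "Ck k S u'"
    "\<forall>x\<in>S. (g has_real_derivative g' x) (at x)" "Ck k S g'" by auto
  have C: "Ck k S u" "Ck k S g" using Suc.prems Ck_mono by blast+
  have "\<forall>y\<in>S. ((\<lambda>y. u y * g y) has_real_derivative u' y * g y + u y * g' y) (at y)"
    using d by (auto intro!: derivative_eq_intros)
  from vanish_Suc[OF assms(1,2) this] Suc.prems(3)
  have v: "u x * g x = 0" "vanish (\<lambda>y. u' y * g y + u y * g' y) x k" by auto
  have "vanish g x k"
    using Suc.IH[of g] C vanish_mono[OF Suc.prems(3)] by simp
  have C': "Ck k S (\<lambda>y. - u' y)" using Ck_mult[OF Ck_const[of _ _ "-1"] d(2)] by simp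
  have C3: "Ck k S (\<lambda>y. u' y * g y + u y * g' y)" "Ck k S (\<lambda>y. - u' y * g y)"
    using Ck_add[OF Ck_mult[OF d(2) C(2)] Ck_mult[OF C(1) d(4)]] Ck_mult[OF C' C(2)] .
  have "vanish (\<lambda>y. - u' y * g y) x k"
    using vanish_mult[OF assms(1,2) C' C(2) \<open>vanish g x k\<close>] .
  from vanish_add[OF assms(1,2) C3 v(2) this]
  have "vanish (\<lambda>y. u y * g' y) x k" by simp
  then have "vanish g' x k" using Suc.IH[of g'] C d by simp
  then show ?case using v assms(3) vanish_Suc[OF assms(1,2) d(3)] by simp
qed simp

text \<open>The derivative of the composition is f' times g' composed with f; the factor f', nonzero
  at x, is cancelled and the induction continues with g'.\<close>

lemma vanish_compose:
  assumes "open S" "open I" "x \<in> I" "f ` I \<subseteq> S"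
    "\<forall>y\<in>I. (f has_real_derivative f' y) (at y)" "f' x \<noteq> 0" "Ck k I f'"
  shows "Ck k S g \<Longrightarrow> vanish (\<lambda>y. g (f y)) x k \<Longrightarrow> vanish g (f x) k"
  using assms(7)
proof (induction k arbitrary: g)
  case (Suc k)
  then obtain g' where d: "\<forall>x\<in>S. (g has_real_derivative g' x) (at x)" "Ck k S g'" by auto
  have "\<forall>y\<in>I. ((\<lambda>y. g (f y)) has_real_derivative f' y * g' (f y)) (at y)"
  proof
    fix y assume "y \<in> I"
    then show "((\<lambda>y. g (f y)) has_real_derivative f' y * g' (f y)) (at y)"
      using DERIV_chain2[of g "g' (f y)" f y "f' y" UNIV] d(1) assms(4,5) by (auto simp: mult.commute)
  qed
  from vanish_Suc[OF assms(2,3) this] Suc.prems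
  have v: "g (f x) = 0" "vanish (\<lambda>y. f' y * g' (f y)) x k" by auto
  have C: "Ck k I f'" using Suc.prems(3) by (rule Ck_mono)
  have "Ck (Suc k) I f" using assms(5) C by auto
  then have "Ck k I f" by (rule Ck_mono)
  then have C2: "Ck k I (\<lambda>y. g' (f y))" using Ck_compose[OF d(2) _ assms(4)] by simp
  have "vanish (\<lambda>y. g' (f y)) x k"
    using vanish_cancel[where u=f' and g="\<lambda>y. g' (f y)" and k=k, OF assms(2,3,6) C C2 v(2)] .
  then have "vanish g' (f x) k" using Suc.IH[OF d(2) _ C] by simp
  moreover have "f x \<in> S" using assms(3,4) by auto
  ultimately show ?case using v vanish_Suc[OF assms(1) _ d(1)] by simp
qed simp

text \<open>In Leibniz's formula of order i + j every other term contains a derivative of f below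
  order i or one of g below order j, and these vanish.\<close>

lemma deriv_funpow_mult:
  assumes "open S" "x \<in> S"
  shows "Ck (Suc (i + j)) S f \<Longrightarrow> Ck (Suc (i + j)) S g \<Longrightarrow> vanish f x i \<Longrightarrow> vanish g x j \<Longrightarrow>
    (deriv ^^ (i + j)) (\<lambda>y. f y * g y) x =
      real ((i + j) choose i) * (deriv ^^ i) f x * (deriv ^^ j) g x"
proof (induction "i + j" arbitrary: i j f g)
  case 0
  then have "i = 0" "j = 0" by simp_all
  then show ?case by simp
next
  case (Suc n)
  have "Ck (Suc (Suc n)) S f" "Ck (Suc (Suc n)) S g"
    using Suc.prems(1,2) unfolding Suc.hyps(2)[symmetric] by blast+
  note C2 = this
  obtain f' where f': "\<forall>x\<in>S. (f has_real_derivative f' x) (at x)" "Ck (Suc n) S f'"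
    using Ck_SucE[OF C2(1)] .
  obtain g' where g': "\<forall>x\<in>S. (g has_real_derivative g' x) (at x)" "Ck (Suc n) S g'"
    using Ck_SucE[OF C2(2)] .
  note d = f' g' and C = C2[THEN Ck_mono]
  have step: "(deriv ^^ Suc k) h x = (deriv ^^ k) h' x"
    if "\<forall>y\<in>S. (h has_real_derivative h' y) (at y)" for h h' k
    unfolding funpow_Suc_right o_apply
    by (rule funpow_deriv_cong[OF assms(1) _ assms(2)]) (use that DERIV_imp_deriv in blast)
  have sum: "(deriv ^^ k) (\<lambda>y. u y + v y) x = (deriv ^^ k) u x + (deriv ^^ k) v x"
    if "Ck k S u" "Ck k S v" for u v k
    using that
  proof (induction k arbitrary: u v)
    case (Suc k)
    then obtain u' v' where d: "\<forall>x\<in>S. (u has_real_derivative u' x) (at x)" "Ck k S u'"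
      "\<forall>x\<in>S. (v has_real_derivative v' x) (at x)" "Ck k S v'" by auto
    have "\<forall>y\<in>S. ((\<lambda>y. u y + v y) has_real_derivative u' y + v' y) (at y)"
      using d by (auto intro!: derivative_eq_intros)
    from step[OF this] step[OF d(1)] step[OF d(3)] Suc.IH[OF d(2,4)] show ?case by simp
  qed simp
  \<comment> \<open>One summand of the product rule: f' vanishes to order i - 1, so the induction
    hypothesis applies to (i - 1, j). For i = 0 the factor g vanishes to order n + 1 and kills the
    n-th derivative. It is used a second time with f and g exchanged.\<close>
  have half: "(deriv ^^ n) (\<lambda>y. f' y * g y) x
      = (if i = 0 then 0 else real (n choose (i - 1)) * (deriv ^^ i) f x * (deriv ^^ j) g x)"
    if "\<forall>x\<in>S. (f has_real_derivative f' x) (at x)" "Ck (Suc n) S f'" "Ck (Suc n) S g"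
      "vanish f x i" "vanish g x j" "Suc n = i + j" for i j f f' g
  proof (cases i)
    case 0
    then have "vanish (\<lambda>y. f' y * g y) x (Suc n)"
      using vanish_mult[OF assms that(2,3)] that by auto
    with 0 show ?thesis by (simp add: vanish_def)
  next
    case (Suc i')
    then have n: "n = i' + j" using that by simp
    have "vanish f' x i'"
      using that(4) Suc vanish_Suc[OF assms(1,2) that(1)] by simp
    from Suc.hyps(1)[OF n _ _ this that(5)] that(2,3) n step[OF that(1), of i'] Suc
    show ?thesis by simp
  qed
  have "\<forall>y\<in>S. ((\<lambda>y. f y * g y) has_real_derivative f' y * g y + g' y * f y) (at y)"
    using d by (auto intro!: derivative_eq_intros)
  from step[OF this, of n] sum[of n "\<lambda>y. f' y * g y" "\<lambda>y. g' y * f y"]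
  have "(deriv ^^ (i + j)) (\<lambda>y. f y * g y) x
      = (deriv ^^ n) (\<lambda>y. f' y * g y) x + (deriv ^^ n) (\<lambda>y. g' y * f y) x"
    using Ck_mult[OF d(2) C(2)] Ck_mult[OF d(4) C(1)] Ck_mono unfolding Suc.hyps(2)[symmetric] by metis
  also have "(deriv ^^ n) (\<lambda>y. f' y * g y) x
      = (if i = 0 then 0 else real (n choose (i - 1)) * (deriv ^^ i) f x * (deriv ^^ j) g x)"
    using half[OF d(1,2) C(2) Suc.prems(3,4)] Suc.hyps(2) by simp
  also have "(deriv ^^ n) (\<lambda>y. g' y * f y) x
      = (if j = 0 then 0 else real (n choose (j - 1)) * (deriv ^^ j) g x * (deriv ^^ i) f x)"
    using half[OF d(3,4) C(1) Suc.prems(4,3)] Suc.hyps(2) by simp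
  \<comment> \<open>Since (j - 1) + i = n, the two binomials agree by symmetry; Pascal's rule then
    adds the two halves.\<close>
  also have "(if j = 0 then 0 else real (n choose (j - 1)) * (deriv ^^ j) g x * (deriv ^^ i) f x)
      = real (n choose i) * (deriv ^^ i) f x * (deriv ^^ j) g x"
  proof (cases j)
    case (Suc j')
    then have "n choose j' = n choose i"
      using Suc.hyps(2) binomial_symmetric[of i n] by auto
    then show ?thesis using Suc by simp
  qed (use Suc.hyps(2) in simp)
  also have "(if i = 0 then 0 else real (n choose (i - 1)) * (deriv ^^ i) f x * (deriv ^^ j) g x)
     + real (n choose i) * (deriv ^^ i) f x * (deriv ^^ j) g x
     = real (Suc n choose i) * (deriv ^^ i) f x * (deriv ^^ j) g x"
    by (cases i) (auto simp: algebra_simps)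
  finally show ?case using Suc.hyps(2) by simp
qed

text \<open>Let i be the exact order of f. Then the derivative of order i + j of the product is a
  nonzero multiple of the j-th derivative of g, so the derivatives of g vanish one after another up
  to total order k.\<close>

lemma vanish_mult_split:
  assumes "open S" "x \<in> S" "\<And>k. Ck k S f" "\<And>k. Ck k S g" "vanish (\<lambda>y. f y * g y) x k"
  obtains i where "i \<le> k" "vanish f x i" "vanish g x (k - i)"
proof (cases "vanish f x k")
  case True
  then show ?thesis using that[of k] by simp
next
  case False
  define i where "i = (LEAST i. (deriv ^^ i) f x \<noteq> 0)"
  from False obtain i' where i': "i' < k" "(deriv ^^ i') f x \<noteq> 0" by (auto simp: vanish_def)
  have i: "(deriv ^^ i) f x \<noteq> 0" "vanish f x i" "i \<le> i'"
    using LeastI[of "\<lambda>i. (deriv ^^ i) f x \<noteq> 0" i'] i' Least_le[of "\<lambda>i. (deriv ^^ i) f x \<noteq> 0" i']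
      not_less_Least[of _ "\<lambda>i. (deriv ^^ i) f x \<noteq> 0"]
    by (auto simp: i_def vanish_def)
  have "vanish g x j" if "j \<le> k - i" for j
    using that
  proof (induction j)
    case (Suc j)
    then have v: "vanish g x j" by simp
    have "(deriv ^^ (i + j)) (\<lambda>y. f y * g y) x = 0"
      using assms(5) Suc.prems by (auto simp: vanish_def)
    then have "(deriv ^^ j) g x = 0"
      using deriv_funpow_mult[OF assms(1-4) i(2) v] i(1) by simp
    with v show ?case by (auto simp: vanish_def less_Suc_eq)
  qed simp
  then show ?thesis using that[of i] i i' by auto
qed

text \<open>At points of \<open>E\<close> only the presence of a zero is counted, not its order.\<close>

definition zeros_le :: "real set \<Rightarrow> (real \<Rightarrow> real) \<Rightarrow> real set \<Rightarrow> nat \<Rightarrow> bool"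
  where "zeros_le E g I k \<longleftrightarrow> (\<forall>X \<mu>. finite X \<longrightarrow> X \<subseteq> I \<longrightarrow> (\<forall>x\<in>X. vanish g x (\<mu> x)) \<longrightarrow>
    (\<forall>x\<in>X \<inter> E. \<mu> x \<le> 1) \<longrightarrow> sum \<mu> X \<le> k)"

lemma zeros_leD:
  assumes "zeros_le E g I k" "finite X" "X \<subseteq> I" "\<And>x. x \<in> X \<Longrightarrow> vanish g x (\<mu> x)"
    "\<And>x. x \<in> X \<Longrightarrow> x \<in> E \<Longrightarrow> \<mu> x \<le> 1"
  shows "sum \<mu> X \<le> k"
  using assms unfolding zeros_le_def by blast

lemma zeros_le_mono:
  assumes "zeros_le E g I k" "I' \<subseteq> I" "k \<le> k'"
  shows "zeros_le E g I' k'"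
  unfolding zeros_le_def
proof (intro allI impI)
  fix X and \<mu> :: "real \<Rightarrow> nat"
  assume X: "finite X" "X \<subseteq> I'" "\<forall>x\<in>X. vanish g x (\<mu> x)" "\<forall>x\<in>X \<inter> E. \<mu> x \<le> 1"
  have "sum \<mu> X \<le> k"
    by (rule zeros_leD[OF assms(1)]) (use X assms(2) in auto)
  with assms(3) show "sum \<mu> X \<le> k'" by simp
qed

lemma zeros_le_empty_exc:
  assumes "zeros_le E g I k" "I \<inter> E = {}"
  shows "zeros_le {} g I k"
  unfolding zeros_le_def
proof (intro allI impI)
  fix X and \<mu> :: "real \<Rightarrow> nat"
  assume "finite X" "X \<subseteq> I" "\<forall>x\<in>X. vanish g x (\<mu> x)"
  then show "sum \<mu> X \<le> k"
    using assms(2) by (intro zeros_leD[OF assms(1)]) auto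
qed

lemma zeros_le_union:
  assumes "zeros_le {} g I k" "zeros_le {} g I' k'"
  shows "zeros_le {} g (I \<union> I') (k + k')"
  unfolding zeros_le_def
proof (intro allI impI)
  fix X and \<mu> :: "real \<Rightarrow> nat"
  assume X: "finite X" "X \<subseteq> I \<union> I'" "\<forall>x\<in>X. vanish g x (\<mu> x)"
  have "sum \<mu> (X \<inter> I) \<le> k"
    using X by (intro zeros_leD[OF assms(1)]) auto
  moreover have "sum \<mu> (X - I) \<le> k'"
    using X by (intro zeros_leD[OF assms(2)]) auto
  moreover have "sum \<mu> X = sum \<mu> (X \<inter> I) + sum \<mu> (X - I)"
    using X(1) by (simp add: sum.Int_Diff)
  ultimately show "sum \<mu> X \<le> k + k'" by simp
qed

text \<open>The least admissible bound is attained by some configuration of zeros, since otherwise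
  it could be lowered by one.\<close>

lemma zeros_le_sharp:
  assumes "zeros_le {} g I k"
  obtains i X \<mu> where "zeros_le {} g I i" "finite X" "X \<subseteq> I" "\<forall>x\<in>X. vanish g x (\<mu> x)" "sum \<mu> X \<ge> i"
proof -
  define i where "i = (LEAST i. zeros_le {} g I i)"
  have i: "zeros_le {} g I i" unfolding i_def using assms by (rule LeastI)
  show ?thesis
  proof (cases i)
    case 0
    then show ?thesis using that[OF i, of "{}"] by simp
  next
    case (Suc i')
    then have "\<not> zeros_le {} g I i'"
      using not_less_Least[of i' "zeros_le {} g I"] by (simp add: i_def)
    then obtain X \<mu> where "finite X" "X \<subseteq> I" "\<forall>x\<in>X. vanish g x (\<mu> x)" "\<not> sum \<mu> X \<le> i'"
      unfolding zeros_le_def by auto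
    then show ?thesis using that[OF i, of X \<mu>] Suc by simp
  qed
qed

text \<open>A configuration attaining the sharp bound i on I can be joined with any configuration on
  I', so at most k - i remains for I'. Two separate bounds that still share the total can then be
  processed independently on each half-line.\<close>

lemma zeros_le_split:
  assumes "zeros_le {} g (I \<union> I') k" "I \<inter> I' = {}"
  obtains i j where "i + j \<le> k" "zeros_le {} g I i" "zeros_le {} g I' j"
proof -
  have "zeros_le {} g I k" using zeros_le_mono[OF assms(1)] by auto
  then obtain i X \<mu> where i: "zeros_le {} g I i"
    and X: "finite X" "X \<subseteq> I" "\<forall>x\<in>X. vanish g x (\<mu> x)" "sum \<mu> X \<ge> i"
    by (rule zeros_le_sharp)
  have ik: "sum \<mu> X + sum \<nu> Y \<le> k"
    if Y: "finite Y" "Y \<subseteq> I'" "\<forall>x\<in>Y. vanish g x (\<nu> x)" for Y \<nu>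
  proof -
    define \<xi> where "\<xi> = (\<lambda>x. if x \<in> I then \<mu> x else \<nu> x)"
    have "sum \<xi> (X \<union> Y) = sum \<xi> X + sum \<xi> Y"
      using X Y assms(2) by (intro sum.union_disjoint) auto
    moreover have "sum \<xi> X = sum \<mu> X" "sum \<xi> Y = sum \<nu> Y"
      using X(2) Y(2) assms(2) by (fastforce simp: \<xi>_def intro!: sum.cong)+
    moreover have "sum \<xi> (X \<union> Y) \<le> k"
      using X Y assms(2) by (intro zeros_leD[OF assms(1)]) (auto simp: \<xi>_def)
    ultimately show ?thesis by simp
  qed
  from ik[of "{}"] have "i \<le> k" using X by simp
  moreover have "zeros_le {} g I' (k - i)"
    unfolding zeros_le_def
  proof (intro allI impI)
    fix Y and \<nu> :: "real \<Rightarrow> nat"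
    assume "finite Y" "Y \<subseteq> I'" "\<forall>x\<in>Y. vanish g x (\<nu> x)"
    from ik[OF this] X(4) show "sum \<nu> Y \<le> k - i" by simp
  qed
  ultimately show ?thesis using that[of i "k - i"] i by simp
qed

lemma zeros_le_cong:
  assumes "open S" "I \<subseteq> S" "\<And>x. x \<in> S \<Longrightarrow> f x = g x" "zeros_le E f I k"
  shows "zeros_le E g I k"
  unfolding zeros_le_def
proof (intro allI impI)
  fix X and \<mu> :: "real \<Rightarrow> nat"
  assume X: "finite X" "X \<subseteq> I" "\<forall>x\<in>X. vanish g x (\<mu> x)" "\<forall>x\<in>X \<inter> E. \<mu> x \<le> 1"
  show "sum \<mu> X \<le> k"
    by (rule zeros_leD[OF assms(4)]) (use X assms(2) vanish_cong[OF assms(1,3)] in auto)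
qed

lemma zeros_le_factor:
  assumes "open S" "I \<subseteq> S" "\<And>k. Ck k S u" "\<And>k. Ck k S g" "\<And>x. x \<in> I \<Longrightarrow> u x \<noteq> 0"
    "zeros_le E g I k"
  shows "zeros_le E (\<lambda>x. u x * g x) I k"
  unfolding zeros_le_def
proof (intro allI impI)
  fix X and \<mu> :: "real \<Rightarrow> nat"
  assume X: "finite X" "X \<subseteq> I" "\<forall>x\<in>X. vanish (\<lambda>x. u x * g x) x (\<mu> x)" "\<forall>x\<in>X \<inter> E. \<mu> x \<le> 1"
  have "vanish g x (\<mu> x)" if "x \<in> X" for x
    using vanish_cancel[where u=u and g=g, OF assms(1) _ _ assms(3,4)] X that assms(2,5) by blast
  then show "sum \<mu> X \<le> k"
    using X by (intro zeros_leD[OF assms(6)]) auto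
qed

text \<open>Removing a factor can only lose zeros, so in contrast to \<open>zeros_le_factor\<close>
  the factor u may vanish.\<close>

lemma zeros_le_cofactor:
  assumes "open S" "I \<subseteq> S" "\<And>k. Ck k S u" "\<And>k. Ck k S g" "zeros_le E (\<lambda>x. u x * g x) I k"
  shows "zeros_le E g I k"
  unfolding zeros_le_def
proof (intro allI impI)
  fix X and \<mu> :: "real \<Rightarrow> nat"
  assume X: "finite X" "X \<subseteq> I" "\<forall>x\<in>X. vanish g x (\<mu> x)" "\<forall>x\<in>X \<inter> E. \<mu> x \<le> 1"
  have "vanish (\<lambda>x. u x * g x) x (\<mu> x)" if "x \<in> X" for x
    using vanish_mult[OF assms(1) _ assms(3,4)] X that assms(2) by blast
  then show "sum \<mu> X \<le> k"
    using X by (intro zeros_leD[OF assms(5)]) auto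
qed

lemma zeros_le_mult:
  assumes "open S" "I \<subseteq> S" "\<And>k. Ck k S f" "\<And>k. Ck k S g" "zeros_le {} f I k" "zeros_le {} g I l"
  shows "zeros_le {} (\<lambda>x. f x * g x) I (k + l)"
  unfolding zeros_le_def
proof (intro allI impI)
  fix X and \<mu> :: "real \<Rightarrow> nat"
  assume X: "finite X" "X \<subseteq> I" "\<forall>x\<in>X. vanish (\<lambda>x. f x * g x) x (\<mu> x)"
  have "\<exists>i. i \<le> \<mu> x \<and> vanish f x i \<and> vanish g x (\<mu> x - i)" if "x \<in> X" for x
  proof -
    have "x \<in> S" "vanish (\<lambda>x. f x * g x) x (\<mu> x)" using X that assms(2) by auto
    from vanish_mult_split[OF assms(1) this(1) assms(3,4) this(2)] show ?thesis by blast
  qed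
  then obtain i where i: "\<And>x. x \<in> X \<Longrightarrow> i x \<le> \<mu> x \<and> vanish f x (i x) \<and> vanish g x (\<mu> x - i x)"
    by metis
  have "sum \<mu> X = sum i X + (\<Sum>x\<in>X. \<mu> x - i x)"
    unfolding sum.distrib[symmetric] using i by (intro sum.cong) auto
  moreover have "sum i X \<le> k"
    using X i by (intro zeros_leD[OF assms(5)]) auto
  moreover have "(\<Sum>x\<in>X. \<mu> x - i x) \<le> l"
    using X i by (intro zeros_leD[OF assms(6)]) auto
  ultimately show "sum \<mu> X \<le> k + l" by simp
qed

text \<open>The set E absorbs the critical points of f: an order of vanishing cannot be carried
  through f there, but the bare presence of a zero can. Injectivity keeps distinct zeros
  distinct.\<close>

lemma zeros_le_compose:
  assumes "open S" "open I" "f ` I \<subseteq> S" "inj_on f I" "\<And>k. Ck k S g"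
    "\<forall>y\<in>I. (f has_real_derivative f' y) (at y)" "\<And>x. x \<in> I - E \<Longrightarrow> f' x \<noteq> 0"
    "\<And>k. Ck k I f'" "zeros_le {} g S k"
  shows "zeros_le E (\<lambda>x. g (f x)) I k"
  unfolding zeros_le_def
proof (intro allI impI)
  fix X and \<mu> :: "real \<Rightarrow> nat"
  assume X: "finite X" "X \<subseteq> I" "\<forall>x\<in>X. vanish (\<lambda>x. g (f x)) x (\<mu> x)" "\<forall>x\<in>X \<inter> E. \<mu> x \<le> 1"
  define \<nu> where "\<nu> = (\<lambda>y. \<mu> (the_inv_into X f y))"
  have inj: "inj_on f X" using assms(4) X(2) inj_on_subset by blast
  have \<nu>: "\<nu> (f x) = \<mu> x" if "x \<in> X" for x
    using the_inv_into_f_f[OF inj that] by (simp add: \<nu>_def)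
  have "vanish g (f x) (\<mu> x)" if "x \<in> X" for x
  proof (cases "x \<in> E")
    case True
    then have "\<mu> x = 0 \<or> \<mu> x = Suc 0" using X(4) that by force
    then show ?thesis using X(3) that by auto
  next
    case False
    then show ?thesis
      using vanish_compose[OF assms(1,2) _ assms(3,6), of x "\<mu> x" g] X that assms(5,7,8) by blast
  qed
  then have "sum \<nu> (f ` X) \<le> k"
    using X(1,2) assms(3) \<nu> by (intro zeros_leD[OF assms(9)]) (auto simp: image_subset_iff)
  moreover have "sum \<nu> (f ` X) = sum \<mu> X"
    unfolding sum.reindex[OF inj] o_def using \<nu> by (rule sum.cong[OF refl])
  ultimately show "sum \<mu> X \<le> k" by simp
qed

section \<open>Rolle's theorem with multiplicities\<close>

lemma nonzero_const_sign:
  fixes h :: "real \<Rightarrow> real"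
  assumes c: "continuous_on {c<..<d} h" "{t\<in>{c<..<d}. h t = 0} = {}"
  shows "(\<forall>t\<in>{c<..<d}. h t > 0) \<or> (\<forall>t\<in>{c<..<d}. h t < 0)"
proof (rule ccontr)
  assume "\<not> ?thesis"
  then obtain s t where st: "s \<in> {c<..<d}" "t \<in> {c<..<d}" "h s \<le> 0" "h t \<ge> 0"
    by (auto simp: not_less)
  have "connected (h ` {c<..<d})"
    using c(1) by (intro connected_continuous_image) auto
  then have "0 \<in> h ` {c<..<d}"
    using st by (meson connectedD_interval imageI)
  then show False using c(2) by auto
qed

lemma interval_subset_is_interval:
  assumes "is_interval I" "a \<in> I" "b \<in> I"
  shows "{a..b::real} \<subseteq> I"
proof
  fix x assume "x \<in> {a..b}"
  then show "x \<in> I" using mem_is_interval_1_I[OF assms, of x] by simp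
qed

text \<open>Equal end values would make g constant, and then its derivative would be 0 at some point
  outside the finite set E.\<close>

lemma strict_increasing_finite_exc:
  fixes g v :: "real \<Rightarrow> real"
  assumes "a < b" "finite E" "continuous_on {a..b} g"
    and g': "\<And>x. a < x \<Longrightarrow> x < b \<Longrightarrow> (g has_real_derivative v x) (at x)"
    and v: "\<And>x. a < x \<Longrightarrow> x < b \<Longrightarrow> v x \<ge> 0" "\<And>x. a < x \<Longrightarrow> x < b \<Longrightarrow> x \<notin> E \<Longrightarrow> v x \<noteq> 0"
  shows "g a < g b"
proof -
  have mono: "g c \<le> g d" if "a \<le> c" "c \<le> d" "d \<le> b" for c d
  proof (rule DERIV_nonneg_imp_increasing_open[OF that(2)])
    show "continuous_on {c..d} g"
      by (rule continuous_on_subset[OF assms(3)]) (use that in auto)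
    show "\<exists>y. (g has_real_derivative y) (at x) \<and> 0 \<le> y" if "c < x" "x < d" for x
      using g'[of x] v(1)[of x] that \<open>a \<le> c\<close> \<open>d \<le> b\<close> by auto
  qed
  have "infinite ({a<..<b} - E)"
    using assms(1,2) by (simp add: Diff_infinite_finite)
  then have "{a<..<b} - E \<noteq> {}" by force
  then obtain y where "y \<in> {a<..<b} - E" by blast
  then have y: "a < y" "y < b" "y \<notin> E" by auto
  show ?thesis
  proof (rule ccontr)
    assume "\<not> g a < g b"
    then have const: "g x = g a" if "x \<in> {a<..<b}" for x
      using mono[of a x] mono[of x b] mono[of a b] that by auto
    have "(g has_real_derivative 0) (at y)"
      by (rule has_field_derivative_transform_within_open[of "\<lambda>_. g a" _ _ "{a<..<b}"])
        (use y const in auto)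
    then have "v y = 0" using g'[of y] y DERIV_unique by blast
    then show False using v(2)[of y] y by simp
  qed
qed

text \<open>If g1 had no zero in between, it would keep one sign. For empty E the classical Rolle
  theorem contradicts this. Otherwise a Rolle point might lie in E and say nothing about g1; instead
  u \<ge> 0 makes g strictly monotone, against its equal end values.\<close>

lemma zero_between:
  fixes g u g1 :: "real \<Rightarrow> real"
  assumes ab: "a < b" "g a = 0" "g b = 0" and sub: "{a..b} \<subseteq> I"
    and g': "\<forall>x\<in>I. (g has_real_derivative u x * g1 x) (at x)"
    and C: "Ck (Suc 0) I g1"
    and u: "\<And>x. x \<in> I - E \<Longrightarrow> u x \<noteq> 0" "E = {} \<or> (\<forall>x\<in>I. u x \<ge> 0)" "finite E"
  shows "\<exists>y. a < y \<and> y < b \<and> g1 y = 0"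
proof (rule ccontr)
  assume no: "\<not> ?thesis"
  have dI: "x \<in> I" if "a \<le> x" "x \<le> b" for x using that sub by auto
  have gc: "continuous_on {a..b} g"
    by (rule DERIV_continuous_on[of _ _ "\<lambda>x. u x * g1 x"])
      (use g' dI in \<open>auto intro: has_field_derivative_at_within\<close>)
  have g1c: "continuous_on {a<..<b} g1"
    by (rule continuous_on_subset[OF Ck_continuous[OF C]]) (use dI in auto)
  have sgn: "(\<forall>y\<in>{a<..<b}. g1 y > 0) \<or> (\<forall>y\<in>{a<..<b}. g1 y < 0)"
    by (rule nonzero_const_sign[OF g1c]) (use no in auto)
  show False
  proof (cases "E = {}")
    case True
    have "\<exists>z. a < z \<and> z < b \<and> (\<lambda>v. u z * g1 z * v) = (\<lambda>v. 0)"
      by (rule Rolle_deriv[OF ab(1) _ gc])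
        (use ab g' dI in \<open>auto simp: has_field_derivative_def\<close>)
    then obtain z where "a < z" "z < b" "u z * g1 z * 1 = 0" by metis
    then show False using True u(1)[of z] no dI[of z] by auto
  next
    case False
    then have u0: "\<forall>x\<in>I. u x \<ge> 0" using u(2) by auto
    show False
      using sgn
    proof
      assume s: "\<forall>y\<in>{a<..<b}. g1 y > 0"
      have "g a < g b"
      proof (rule strict_increasing_finite_exc[of a b E g "\<lambda>x. u x * g1 x"])
        fix x assume x: "a < x" "x < b"
        then have "x \<in> I" "g1 x > 0" using dI s by auto
        then show "(g has_real_derivative u x * g1 x) (at x)" "0 \<le> u x * g1 x"
          "x \<notin> E \<Longrightarrow> u x * g1 x \<noteq> 0"
          using g' u0 u(1)[of x] by auto
      qed (use ab u gc in auto)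
      then show False using ab by simp
    next
      assume s: "\<forall>y\<in>{a<..<b}. g1 y < 0"
      have "- g a < - g b"
      proof (rule strict_increasing_finite_exc[of a b E "\<lambda>x. - g x" "\<lambda>x. - (u x * g1 x)"])
        fix x assume x: "a < x" "x < b"
        then have "x \<in> I" "g1 x < 0" using dI s by auto
        then show "((\<lambda>x. - g x) has_real_derivative - (u x * g1 x)) (at x)" "0 \<le> - (u x * g1 x)"
          "x \<notin> E \<Longrightarrow> - (u x * g1 x) \<noteq> 0"
          using g' u0 u(1)[of x] by (auto intro: DERIV_minus simp: mult_le_0_iff)
      qed (use ab u gc in \<open>auto intro: continuous_on_minus\<close>)
      then show False using ab by simp
    qed
  qed
qed

text \<open>A zero of order \<open>\<mu>\<close> of \<open>g\<close> is one of order \<open>\<mu> - 1\<close> of \<open>g\<^sub>1\<close>, and \<open>g\<^sub>1\<close> has a further zero between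
  consecutive zeros of \<open>g\<close>; the latter may lie in \<open>E\<close>, where \<open>u\<close> vanishes, because \<open>u\<close> does not change sign.\<close>

lemma zeros_le_Rolle:
  assumes I: "open I" "is_interval I"
    and g': "\<forall>x\<in>I. (g has_real_derivative u x * g1 x) (at x)"
    and C: "\<And>k. Ck k I u" "\<And>k. Ck k I g1"
    and u: "\<And>x. x \<in> I - E \<Longrightarrow> u x \<noteq> 0" "E = {} \<or> (\<forall>x\<in>I. u x \<ge> 0)" "finite E"
    and z: "zeros_le E g1 I k"
  shows "zeros_le {} g (I - E) (Suc k)"
  unfolding zeros_le_def
proof (intro allI impI)
  fix X0 and \<mu> :: "real \<Rightarrow> nat"
  assume X0: "finite X0" "X0 \<subseteq> I - E" "\<forall>x\<in>X0. vanish g x (\<mu> x)"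
  \<comment> \<open>Points of weight 0 are dropped because they need not be zeros of g and must not
    take part in the interlacing.\<close>
  define X where "X = {x\<in>X0. \<mu> x \<noteq> 0}"
  have X: "finite X" "X \<subseteq> I - E" "\<forall>x\<in>X. vanish g x (\<mu> x)" "\<forall>x\<in>X. g x = 0" "\<forall>x\<in>X. \<mu> x \<ge> 1"
    using X0 vanish_mono[of g _ _ "Suc 0"] by (auto simp: X_def)
  have between: "\<exists>y. a < y \<and> y < b \<and> g1 y = 0"
    if "a \<in> I" "b \<in> I" "a < b" "g a = 0" "g b = 0" for a b
    by (rule zero_between[OF that(3-5) interval_subset_is_interval[OF I(2) that(1,2)] g' C(2) u])
  \<comment> \<open>Points are added from left to right. The clause \<open>y < Max A\<close>
    guarantees that the zero found in the last gap is new.\<close>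
  have interlace: "\<exists>Y. finite Y \<and> card Y = card A - 1 \<and> Y \<inter> A = {} \<and> Y \<subseteq> I \<and> (\<forall>y\<in>Y. g1 y = 0 \<and> y < Max A)"
    if "A \<subseteq> X" for A
  proof -
    have "finite A" using that X(1) finite_subset by auto
    then show ?thesis using that
    proof (induction A rule: finite_linorder_max_induct)
      case (insert b A)
      show ?case
      proof (cases "A = {}")
        case False
        from insert obtain Y where Y: "finite Y" "card Y = card A - 1" "Y \<inter> A = {}" "Y \<subseteq> I"
          "\<forall>y\<in>Y. g1 y = 0 \<and> y < Max A" by auto
        have mA: "Max A \<in> A" using False insert.hyps by simp
        have mX: "Max A \<in> X" "b \<in> X" "Max A < b" using mA insert.prems insert.hyps(2) by auto
        then have mI: "Max A \<in> I" "b \<in> I" using X(2) by auto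
        obtain y where y: "Max A < y" "y < b" "g1 y = 0"
          using between[OF mI mX(3)] mX(1,2) X(4) by auto
        then have "y \<in> I" using interval_subset_is_interval[OF I(2) mI] by auto
        have "Max (insert b A) = b"
          using insert.hyps by (intro Max_eqI) (auto intro: less_imp_le)
        moreover have "y \<notin> A" using y(1) Max_ge[OF insert.hyps(1), of y] by auto
        moreover have "y \<notin> Y" using Y(5) y(1) by auto
        moreover have "Suc (card A - 1) = card A" using False insert.hyps by (simp add: card_gt_0_iff)
        moreover have "b \<notin> A" using insert.hyps by auto
        moreover have "\<forall>z\<in>Y. z < b" using Y(5) y by force
        ultimately show ?thesis
          using Y y insert.hyps \<open>y \<in> I\<close>
          by (intro exI[of _ "insert y Y"]) auto
      qed (use insert.hyps in \<open>auto intro!: exI[of _ "{}"]\<close>)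
    next
      case empty
      show ?case by (rule exI[of _ "{}"]) simp
    qed
  qed
  obtain Y where Y: "finite Y" "card Y = card X - 1" "Y \<inter> X = {}" "Y \<subseteq> I"
    "\<forall>y\<in>Y. g1 y = 0" using interlace[OF order_refl] by blast
  \<comment> \<open>Every zero of g loses one order and every gap contributes one new zero, so the
    total drops by exactly one. X avoids E, so only the new points, of weight 1, can lie in
    E.\<close>
  define \<nu> where "\<nu> = (\<lambda>x. if x \<in> X then \<mu> x - 1 else 1)"
  have "sum \<nu> (X \<union> Y) \<le> k"
  proof (rule zeros_leD[OF z])
    show "finite (X \<union> Y)" "X \<union> Y \<subseteq> I" using X(1,2) Y(1,4) by auto
    show "\<nu> x \<le> 1" if "x \<in> X \<union> Y" "x \<in> E" for x
      using that X(2) by (auto simp: \<nu>_def)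
    fix x assume x: "x \<in> X \<union> Y"
    show "vanish g1 x (\<nu> x)"
    proof (cases "x \<in> X")
      case True
      then have xI: "x \<in> I" "u x \<noteq> 0" using X(2) u(1)[of x] by auto
      have "1 \<le> \<mu> x" using True X(5) by blast
      then have "\<mu> x = Suc (\<nu> x)" using True by (simp add: \<nu>_def)
      then have "vanish g x (Suc (\<nu> x))" using bspec[OF X(3) True] by metis
      then have "vanish (\<lambda>x. u x * g1 x) x (\<nu> x)"
        using vanish_Suc[OF I(1) xI(1) g'] by blast
      then show ?thesis
        by (rule vanish_cancel[where u=u and g=g1 and x=x, OF I(1) xI C])
    next
      case False
      then show ?thesis using Y(5) x by (simp add: \<nu>_def)
    qed
  qed
  moreover have "sum \<nu> (X \<union> Y) = sum \<nu> X + sum \<nu> Y"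
    using X(1) Y(1,3) by (intro sum.union_disjoint) auto
  moreover have "sum \<nu> Y = card X - 1"
  proof -
    have "sum \<nu> Y = (\<Sum>y\<in>Y. 1)" using Y(3) by (intro sum.cong) (auto simp: \<nu>_def)
    then show ?thesis using Y(2) by simp
  qed
  moreover have "sum \<mu> X = sum \<nu> X + card X"
  proof -
    have "sum \<nu> X + card X = (\<Sum>x\<in>X. \<nu> x + 1)"
      unfolding sum.distrib by simp
    also have "\<dots> = sum \<mu> X" using X(5) by (intro sum.cong) (auto simp: \<nu>_def)
    finally show ?thesis by simp
  qed
  moreover have "sum \<mu> X0 = sum \<mu> X"
    unfolding X_def by (rule sum.mono_neutral_right) (use X0(1) in auto)
  ultimately show "sum \<mu> X0 \<le> Suc k" by linarith
qed

text \<open>Without common zeros, at each point all of the order belongs to one factor, so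
  configurations for f and for g add up to one for the product, even when their points coincide
  formally. Taking a sharp one for f leaves k - i for g.\<close>

lemma zeros_le_mult_split:
  assumes "open S" "I \<subseteq> S" "\<And>k. Ck k S f" "\<And>k. Ck k S g"
    and ne: "\<And>x. x \<in> I \<Longrightarrow> f x \<noteq> 0 \<or> g x \<noteq> 0" and z: "zeros_le {} (\<lambda>x. f x * g x) I k"
  obtains i j where "i + j \<le> k" "zeros_le {} f I i" "zeros_le {} g I j"
proof -
  have "zeros_le {} (\<lambda>x. g x * f x) I k" using z by (simp add: mult.commute)
  then have "zeros_le {} f I k" by (rule zeros_le_cofactor[OF assms(1,2,4,3)])
  then obtain i X \<mu> where i: "zeros_le {} f I i"
    and X: "finite X" "X \<subseteq> I" "\<forall>x\<in>X. vanish f x (\<mu> x)" "sum \<mu> X \<ge> i"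
    by (rule zeros_le_sharp)
  have ik: "sum \<mu> X + sum \<nu> Y \<le> k"
    if Y: "finite Y" "Y \<subseteq> I" "\<forall>x\<in>Y. vanish g x (\<nu> x)" for Y \<nu>
  proof -
    define \<xi> where "\<xi> = (\<lambda>x. (if x \<in> X then \<mu> x else 0) + (if x \<in> Y then \<nu> x else 0))"
    have vf: "vanish f x (if x \<in> X then \<mu> x else 0)" and vg: "vanish g x (if x \<in> Y then \<nu> x else 0)" for x
      using X(3) Y(3) by auto
    have "vanish (\<lambda>x. f x * g x) x (\<xi> x)" if x: "x \<in> X \<union> Y" for x
    proof -
      have xI: "x \<in> I" "x \<in> S" using x X(2) Y(2) assms(2) by auto
      have "(if x \<in> X then \<mu> x else 0) = 0 \<or> (if x \<in> Y then \<nu> x else 0) = 0"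
      proof (rule ccontr)
        assume "\<not> ?thesis"
        then have "Suc 0 \<le> (if x \<in> X then \<mu> x else 0)" "Suc 0 \<le> (if x \<in> Y then \<nu> x else 0)" by linarith+
        from vanish_mono[OF vf this(1)] vanish_mono[OF vg this(2)] show False
          using ne[OF xI(1)] by simp
      qed
      then show ?thesis
      proof
        assume "(if x \<in> X then \<mu> x else 0) = 0"
        then have "vanish g x (\<xi> x)" using vg[of x] by (simp add: \<xi>_def)
        then show ?thesis by (rule vanish_mult[OF assms(1) xI(2) assms(3,4)])
      next
        assume "(if x \<in> Y then \<nu> x else 0) = 0"
        then have "vanish f x (\<xi> x)" using vf[of x] by (simp add: \<xi>_def)
        then have "vanish (\<lambda>x. g x * f x) x (\<xi> x)" by (rule vanish_mult[OF assms(1) xI(2) assms(4,3)])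
        then show ?thesis by (simp add: mult.commute)
      qed
    qed
    then have "sum \<xi> (X \<union> Y) \<le> k"
      using X Y by (intro zeros_leD[OF z]) auto
    moreover have "sum \<xi> (X \<union> Y) = sum \<mu> X + sum \<nu> Y"
    proof -
      have "(\<Sum>x\<in>X \<union> Y. if x \<in> X then \<mu> x else 0) = sum \<mu> X"
        by (rule sum.mono_neutral_cong_right) (use X(1) Y(1) in auto)
      moreover have "(\<Sum>x\<in>X \<union> Y. if x \<in> Y then \<nu> x else 0) = sum \<nu> Y"
        by (rule sum.mono_neutral_cong_right) (use X(1) Y(1) in auto)
      ultimately show ?thesis unfolding \<xi>_def sum.distrib by simp
    qed
    ultimately show ?thesis by simp
  qed
  from ik[of "{}"] have "i \<le> k" using X by simp
  moreover have "zeros_le {} g I (k - i)"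
    unfolding zeros_le_def
  proof (intro allI impI)
    fix Y and \<nu> :: "real \<Rightarrow> nat"
    assume "finite Y" "Y \<subseteq> I" "\<forall>x\<in>Y. vanish g x (\<nu> x)"
    from ik[OF this] X(4) show "sum \<nu> Y \<le> k - i" by simp
  qed
  ultimately show ?thesis using that[of i "k - i"] i by simp
qed

section \<open>From weighted bounds to the counts in the statement\<close>

lemma zero_mult_eq:
  assumes "vanish g x k" "(deriv ^^ k) g x \<noteq> 0"
  shows "zero_mult g x = enat k"
  unfolding zero_mult_def
proof (rule antisym)
  show "(INF k\<in>{k. (deriv ^^ k) g x \<noteq> 0}. enat k) \<le> enat k"
    by (rule INF_lower) (use assms in simp)
  show "enat k \<le> (INF k\<in>{k. (deriv ^^ k) g x \<noteq> 0}. enat k)"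
  proof (rule INF_greatest)
    fix i assume "i \<in> {k. (deriv ^^ k) g x \<noteq> 0}"
    then have "\<not> i < k" using assms(1) by (auto simp: vanish_def)
    then show "enat k \<le> enat i" by simp
  qed
qed

lemma zero_mult_cases:
  assumes "\<not> vanish g x (Suc n)"
  obtains k where "k \<le> n" "vanish g x k" "zero_mult g x = enat k"
proof -
  from assms obtain j where j: "j \<le> n" "(deriv ^^ j) g x \<noteq> 0"
    by (auto simp: vanish_def less_Suc_eq_le)
  define k where "k = (LEAST k. (deriv ^^ k) g x \<noteq> 0)"
  have "(deriv ^^ k) g x \<noteq> 0" "k \<le> j"
    unfolding k_def using LeastI[of "\<lambda>k. (deriv ^^ k) g x \<noteq> 0", OF j(2)]
      Least_le[of "\<lambda>k. (deriv ^^ k) g x \<noteq> 0", OF j(2)] by simp_all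
  moreover have "vanish g x k"
    unfolding vanish_def k_def using not_less_Least by blast
  ultimately show ?thesis using that[of k] zero_mult_eq j(1) by simp
qed

lemma zeros_le_finite:
  assumes "zeros_le {} g S k"
  shows "finite {x\<in>S. g x = 0}" "card {x\<in>S. g x = 0} \<le> k"
proof -
  have le: "card X \<le> k" if "finite X" "X \<subseteq> {x\<in>S. g x = 0}" for X
    using zeros_leD[OF assms that(1), of "\<lambda>_. Suc 0"] that(2) by auto
  show fin: "finite {x\<in>S. g x = 0}"
  proof (rule ccontr)
    assume "infinite {x\<in>S. g x = 0}"
    then obtain X where "X \<subseteq> {x\<in>S. g x = 0}" "finite X" "card X = Suc k"
      using infinite_arbitrarily_large by blast
    with le[of X] show False by simp
  qed
  show "card {x\<in>S. g x = 0} \<le> k"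
    by (rule le[OF fin]) simp
qed

text \<open>The bound k excludes order k + 1 at every zero, so the value \<open>\<infinity>\<close>
  never occurs and the actual multiplicities form one of the configurations that
  \<open>zeros_le\<close> bounds.\<close>

lemma zero_count_le:
  assumes "zeros_le {} g S k"
  shows "zero_count g S \<le> enat k"
proof -
  define Z where "Z = {x\<in>S. g x = 0}"
  have Z: "finite Z" using zeros_le_finite[OF assms] by (simp add: Z_def)
  have "\<not> vanish g x (Suc k)" if "x \<in> Z" for x
    using zeros_leD[OF assms, of "{x}" "\<lambda>_. Suc k"] that by (auto simp: Z_def)
  then have "\<exists>i. vanish g x i \<and> zero_mult g x = enat i" if "x \<in> Z" for x
    using zero_mult_cases that by blast
  then obtain \<mu> where \<mu>: "\<And>x. x \<in> Z \<Longrightarrow> vanish g x (\<mu> x) \<and> zero_mult g x = enat (\<mu> x)"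
    by metis
  have sum: "(\<Sum>x\<in>Y. enat (\<mu> x)) = enat (sum \<mu> Y)" for Y
    by (induction Y rule: infinite_finite_induct) (auto simp: zero_enat_def)
  have "zero_count g S = (\<Sum>x\<in>Z. zero_mult g x)"
    using Z by (simp add: zero_count_def Z_def)
  also have "\<dots> = enat (sum \<mu> Z)"
    unfolding sum[symmetric] by (rule sum.cong) (use \<mu> in auto)
  also have "sum \<mu> Z \<le> k"
    using Z \<mu> by (intro zeros_leD[OF assms]) (auto simp: Z_def)
  finally show ?thesis by simp
qed

lemma zero_count_add_le:
  assumes "zeros_le {} g (A \<union> B) k" "A \<inter> B = {}"
  shows "zero_count g A + zero_count g B \<le> enat k"
proof -
  from zeros_le_split[OF assms] obtain i j
    where ij: "i + j \<le> k" "zeros_le {} g A i" "zeros_le {} g B j" .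
  have "zero_count g A + zero_count g B \<le> enat i + enat j"
    using ij by (intro add_mono zero_count_le)
  also have "\<dots> \<le> enat k" using ij by simp
  finally show ?thesis .
qed

text \<open>Once as many zeros are known as the bound permits, a further zero or a double one would
  exceed it. This turns each upper bound into simplicity of the zeros that are constructed.\<close>

lemma simple_zeros_eq:
  assumes "zeros_le {} g S (card X)" "finite X" "X \<subseteq> S" "\<And>x. x \<in> X \<Longrightarrow> g x = 0"
  shows "simple_zeros g S = X" "\<And>x. x \<in> X \<Longrightarrow> deriv g x \<noteq> 0"
proof -
  show simple: "deriv g x \<noteq> 0" if "x \<in> X" for x
  proof
    assume "deriv g x = 0"
    then have "vanish g x 2" using assms(4)[OF that] by (simp add: vanish_def numeral_2_eq_2 less_Suc_eq)
    then have "sum (\<lambda>y. if y = x then 2 else 1) X \<le> card X"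
      using assms(4) by (intro zeros_leD[OF assms(1-3)]) auto
    moreover have "sum (\<lambda>y. if y = x then 2 else 1) X = Suc (card X)"
      using sum.remove[OF assms(2) that, of "\<lambda>y. if y = x then 2 else 1 :: nat"]
        card.remove[OF assms(2) that] by simp
    ultimately show False by simp
  qed
  have "{x\<in>S. g x = 0} = X"
    by (rule sym, rule card_seteq) (use assms zeros_le_finite[OF assms(1)] in auto)
  then show "simple_zeros g S = X"
    using simple by (auto simp: simple_zeros_def)
qed

section \<open>Zeros of the integrals\<close>

text \<open>The set \<open>S\<close> collects the sign changes of \<open>h\<close>.\<close>

lemma sign_change_product:
  fixes G h :: "real \<Rightarrow> real"
  assumes "finite Z"
  shows "continuous_on {a<..<b} h \<Longrightarrow> {t\<in>{a<..<b}. h t = 0} = Z \<Longrightarrow>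
    (\<And>s t. a < s \<Longrightarrow> s \<le> t \<Longrightarrow> t < b \<Longrightarrow> G t \<le> G s) \<Longrightarrow>
    \<exists>S \<sigma>. S \<subseteq> Z \<and> \<bar>\<sigma>\<bar> = (1::real) \<and> (\<forall>t\<in>{a<..<b}. \<sigma> * (h t * (\<Prod>s\<in>S. G t - G s)) \<ge> 0)"
  using assms
proof (induction Z arbitrary: b rule: finite_linorder_max_induct)
    case empty
    from nonzero_const_sign[OF empty(1,2)] show ?case
    proof
      assume "\<forall>t\<in>{a<..<b}. h t > 0"
      then show ?thesis by (intro exI[of _ "{}"] exI[of _ 1]) (simp add: less_imp_le)
    next
      assume "\<forall>t\<in>{a<..<b}. h t < 0"
      then show ?thesis by (intro exI[of _ "{}"] exI[of _ "-1"]) (simp add: less_imp_le)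
    qed
  next
    case (insert z Z)
    have mem: "t \<in> insert z Z \<longleftrightarrow> a < t \<and> t < b \<and> h t = 0" for t
      unfolding insert.prems(2)[symmetric] by simp
    have z: "a < z" "z < b" "h z = 0" using mem[of z] by simp_all
    have lt: "t < z" if "t \<in> Z" for t using insert.hyps(2) that by blast
    have "t \<in> {t\<in>{a<..<z}. h t = 0} \<longleftrightarrow> t \<in> Z" for t
      using mem[of t] lt[of t] z by auto
    then have "{t\<in>{a<..<z}. h t = 0} = Z" by blast
    moreover have "continuous_on {a<..<z} h"
      by (rule continuous_on_subset[OF insert.prems(1)]) (use z in auto)
    ultimately obtain S \<sigma> where S: "S \<subseteq> Z" "\<bar>\<sigma>\<bar> = (1::real)"
      "\<And>t. t \<in> {a<..<z} \<Longrightarrow> \<sigma> * (h t * (\<Prod>s\<in>S. G t - G s)) \<ge> 0"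
      using insert.IH[of z] insert.prems(3) less_trans[OF _ z(2)] by blast
    have finS: "finite S" using S(1) insert.hyps(1) finite_subset by blast
    have zS: "z \<notin> S" using S(1) insert.hyps(2) by auto
    have Sa: "a < s" "s < z" if "s \<in> S" for s
    proof -
      have "s \<in> Z" using that S(1) by blast
      then show "s < z" "a < s" using lt mem[of s] by auto
    qed
    \<comment> \<open>To the right of all points of S every factor \<open>G t - G s\<close> is
      nonpositive, so the sign of the product is that of (-1)^card S.\<close>
    have sg: "(-1) ^ card S * (\<Prod>s\<in>S. G t - G s) \<ge> 0" if "z \<le> t" "t < b" for t
    proof -
      have "(-1) ^ card S * (\<Prod>s\<in>S. G t - G s) = (\<Prod>s\<in>S. G s - G t)"
        using prod.distrib[of "\<lambda>_. -1" "\<lambda>s. G t - G s" S] by simp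
      also have "\<dots> \<ge> 0"
      proof (rule prod_nonneg)
        fix s assume "s \<in> S"
        then show "0 \<le> G s - G t" using insert.prems(3)[of s t] Sa[of s] that by simp
      qed
      finally show ?thesis .
    qed
    have "{t\<in>{z<..<b}. h t = 0} = {}"
    proof (rule ccontr)
      assume "\<not> ?thesis"
      then obtain t where t: "z < t" "t < b" "h t = 0" by auto
      then have "t \<in> Z" using mem[of t] z by auto
      then show False using t(1) lt[of t] by simp
    qed
    moreover have "continuous_on {z<..<b} h"
      by (rule continuous_on_subset[OF insert.prems(1)]) (use z in auto)
    ultimately have "(\<forall>t\<in>{z<..<b}. h t > 0) \<or> (\<forall>t\<in>{z<..<b}. h t < 0)"
      by (intro nonzero_const_sign)
    then obtain \<tau> where \<tau>: "\<bar>\<tau>\<bar> = (1::real)" "\<And>t. t \<in> {z<..<b} \<Longrightarrow> \<tau> * h t \<ge> 0"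
    proof
      assume "\<forall>t\<in>{z<..<b}. h t > 0"
      then show ?thesis using that[of 1] by (simp add: less_imp_le)
    next
      assume "\<forall>t\<in>{z<..<b}. h t < 0"
      then show ?thesis using that[of "- 1"] by (simp add: less_imp_le)
    qed
    define m :: real where "m = (-1) ^ card S"
    have m: "\<bar>m\<bar> = 1" by (simp add: m_def power_abs)
    have right: "\<tau> * m * (h t * (\<Prod>s\<in>S. G t - G s)) \<ge> 0" if "z < t" "t < b" for t
    proof -
      have "\<tau> * m * (h t * (\<Prod>s\<in>S. G t - G s)) = (\<tau> * h t) * (m * (\<Prod>s\<in>S. G t - G s))"
        by (simp add: mult_ac)
      also have "\<dots> \<ge> 0"
        by (rule mult_nonneg_nonneg) (use \<tau>(2)[of t] sg[of t] that in \<open>simp_all add: m_def\<close>)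
      finally show ?thesis .
    qed
    \<comment> \<open>If the product has the same sign on both sides of z, then S is kept. Otherwise
      z joins S: the factor \<open>G t - G z\<close> is nonnegative on the left and nonpositive on
      the right, which restores the common sign.\<close>
    show ?case
    proof (cases "\<tau> * m = \<sigma>")
      case True
      have "\<sigma> * (h t * (\<Prod>s\<in>S. G t - G s)) \<ge> 0" if "t \<in> {a<..<b}" for t
      proof (cases t z rule: linorder_cases)
        case less
        then show ?thesis using S(3)[of t] that by simp
      next
        case greater
        then show ?thesis using right[of t] that True by simp
      qed (use z in simp)
      then show ?thesis using S(1,2) by (intro exI[of _ S] exI[of _ \<sigma>]) auto
    next
      case False
      have "\<bar>\<tau> * m\<bar> = 1" using \<tau>(1) m by (simp add: abs_mult)
      then have opp: "\<tau> * m = - \<sigma>" using S(2) False by (auto simp: abs_if split: if_splits)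
      have "\<sigma> * (h t * (\<Prod>s\<in>insert z S. G t - G s)) \<ge> 0" if t: "t \<in> {a<..<b}" for t
      proof -
        have eq: "\<sigma> * (h t * (\<Prod>s\<in>insert z S. G t - G s))
            = (\<sigma> * (h t * (\<Prod>s\<in>S. G t - G s))) * (G t - G z)"
          using finS zS by (simp add: mult_ac)
        show ?thesis
        proof (cases t z rule: linorder_cases)
          case less
          show ?thesis unfolding eq
            by (rule mult_nonneg_nonneg) (use less S(3)[of t] t insert.prems(3)[of t z] z in simp_all)
        next
          case greater
          have "\<sigma> * (h t * (\<Prod>s\<in>S. G t - G s)) \<le> 0"
            using right[of t] greater t opp by simp
          then show ?thesis unfolding eq
            by (rule mult_nonpos_nonpos) (use greater t insert.prems(3)[of z t] z in simp)
        qed (use z in simp)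
      qed
      then show ?thesis using S(1,2) by (intro exI[of _ "insert z S"] exI[of _ \<sigma>]) auto
    qed
qed

locale weight =
  fixes T :: real and G :: "real \<Rightarrow> real"
  assumes T_pos: "T > 0"
    and G_cont: "continuous_on {0..T} G"
    and G_nonneg: "\<And>t. t \<in> {0..T} \<Longrightarrow> G t \<ge> 0"
    and G_antimono: "\<And>s t. 0 \<le> s \<Longrightarrow> s \<le> t \<Longrightarrow> t \<le> T \<Longrightarrow> G t \<le> G s"
    and G_nonconst: "G T < G 0"
begin

text \<open>Testing t = 0 suffices, because G is largest there and this is the critical point for
  negative s.\<close>

definition D :: "real set" where "D = {s. 1 + s * G 0 > 0}"

definition Psi :: "(real \<Rightarrow> real) \<Rightarrow> real \<Rightarrow> real \<Rightarrow> real"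
  where "Psi h \<kappa> s = integral {0..T} (\<lambda>t. h t * (1 + s * G t) powr \<kappa>)"

lemma open_D: "open D"
  unfolding D_def by (intro open_Collect_less continuous_intros)

lemma D_upward: "s \<in> D \<Longrightarrow> s \<le> s' \<Longrightarrow> s' \<in> D"
  using mult_right_mono[of s s' "G 0"] G_nonneg[of 0] T_pos by (auto simp: D_def)

lemma interval_D: "is_interval D"
  unfolding is_interval_1 using D_upward by blast

lemma D_pos:
  assumes "s \<in> D" "t \<in> {0..T}"
  shows "1 + s * G t > 0"
proof (cases "s \<ge> 0")
  case True
  then have "s * G t \<ge> 0" using G_nonneg[OF assms(2)] by simp
  then show ?thesis by linarith
next
  case False
  then have "s * G 0 \<le> s * G t"
    using G_antimono[of 0 t] assms(2) by (intro mult_left_mono_neg) auto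
  then show ?thesis using assms(1) by (simp add: D_def)
qed

lemma Psi_integrand_cont:
  assumes "continuous_on {0..T} h" "s \<in> D"
  shows "continuous_on {0..T} (\<lambda>t. h t * (1 + s * G t) powr \<kappa>)"
  by (intro continuous_intros assms G_cont) (auto dest: D_pos[OF assms(2)])

lemma Psi_deriv:
  assumes "continuous_on {0..T} h" "s \<in> D"
  shows "(Psi h \<kappa> has_real_derivative \<kappa> * Psi (\<lambda>t. h t * G t) (\<kappa> - 1) s) (at s)"
proof -
  have c2: "continuous_on (D \<times> {0..T}) (\<lambda>x. f (snd x))" if "continuous_on {0..T} f" for f :: "real \<Rightarrow> real"
    by (rule continuous_on_compose2[OF that continuous_on_snd[OF continuous_on_id]]) auto
  have "((\<lambda>s. integral (cbox 0 T) (\<lambda>t. h t * (1 + s * G t) powr \<kappa>)) has_real_derivative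
      integral (cbox 0 T) (\<lambda>t. \<kappa> * (h t * G t * (1 + s * G t) powr (\<kappa> - 1)))) (at s within D)"
  proof (rule leibniz_rule_field_derivative)
    fix x t :: real assume x: "x \<in> D" and t: "t \<in> cbox 0 T"
    have pos: "1 + x * G t > 0" using D_pos[OF x] t by simp
    have "((\<lambda>x. 1 + x * G t) has_real_derivative G t) (at x)"
      by (auto intro!: derivative_eq_intros)
    from DERIV_cmult[OF DERIV_fun_powr[OF this pos, of \<kappa>], of "h t"]
    show "((\<lambda>x. h t * (1 + x * G t) powr \<kappa>) has_real_derivative \<kappa> * (h t * G t * (1 + x * G t) powr (\<kappa> - 1)))
        (at x within D)"
      by (auto intro: has_field_derivative_at_within simp: mult_ac)
  next
    fix x assume "x \<in> D"
    then show "(\<lambda>t. h t * (1 + x * G t) powr \<kappa>) integrable_on cbox 0 T"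
      using Psi_integrand_cont[OF assms(1)] integrable_continuous by (metis box_real(2))
  next
    show "continuous_on (D \<times> cbox 0 T) (\<lambda>(x, t). \<kappa> * (h t * G t * (1 + x * G t) powr (\<kappa> - 1)))"
      unfolding split_beta box_real
      by (intro continuous_intros c2 assms G_cont) (auto dest: D_pos)
  qed (use assms(2) interval_D is_interval_convex in auto)
  then have "(Psi h \<kappa> has_real_derivative \<kappa> * Psi (\<lambda>t. h t * G t) (\<kappa> - 1) s) (at s within D)"
    by (simp add: Psi_def[abs_def])
  then show ?thesis using at_within_open[OF assms(2) open_D] by simp
qed

lemma Psi_lin:
  assumes "continuous_on {0..T} h" "continuous_on {0..T} h'" "s \<in> D"
  shows "Psi (\<lambda>t. a * h t + b * h' t) \<kappa> s = a * Psi h \<kappa> s + b * Psi h' \<kappa> s"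
proof -
  have i: "(\<lambda>t. c * (g t * (1 + s * G t) powr \<kappa>)) integrable_on {0..T}" if "continuous_on {0..T} g" for g c
    by (intro integrable_continuous_interval continuous_on_mult continuous_on_const
        Psi_integrand_cont that assms(3))
  have "Psi (\<lambda>t. a * h t + b * h' t) \<kappa> s =
      integral {0..T} (\<lambda>t. a * (h t * (1 + s * G t) powr \<kappa>) + b * (h' t * (1 + s * G t) powr \<kappa>))"
    unfolding Psi_def by (simp add: algebra_simps)
  also have "\<dots> = a * Psi h \<kappa> s + b * Psi h' \<kappa> s"
    unfolding Psi_def by (subst integral_add[OF i[OF assms(1)] i[OF assms(2)]]) simp
  finally show ?thesis .
qed

text \<open>One factor 1 + s G is split off the weight, so that an integral and its derivative,
  whose exponent is \<kappa> - 1, can be combined under one exponent.\<close>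

lemma Psi_lower:
  assumes "continuous_on {0..T} h" "s \<in> D"
  shows "Psi h \<kappa> s = Psi h (\<kappa> - 1) s + s * Psi (\<lambda>t. h t * G t) (\<kappa> - 1) s"
proof -
  have "Psi h \<kappa> s = Psi (\<lambda>t. 1 * h t + s * (h t * G t)) (\<kappa> - 1) s"
    unfolding Psi_def
  proof (rule integral_cong)
    fix t assume "t \<in> {0..T}"
    then have "(1 + s * G t) powr \<kappa> = (1 + s * G t) * (1 + s * G t) powr (\<kappa> - 1)"
      using D_pos[OF assms(2), of t] by (simp add: powr_diff)
    then show "h t * (1 + s * G t) powr \<kappa> = (1 * h t + s * (h t * G t)) * (1 + s * G t) powr (\<kappa> - 1)"
      by (simp add: algebra_simps)
  qed
  then show ?thesis
    using Psi_lin[of h "\<lambda>t. h t * G t" s 1 s "\<kappa> - 1"] assms G_cont by (simp add: continuous_on_mult)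
qed

lemma Psi_Ck: "continuous_on {0..T} h \<Longrightarrow> Ck k D (Psi h \<kappa>)"
proof (induction k arbitrary: h \<kappa>)
  case (Suc k)
  have "Ck k D (Psi (\<lambda>t. h t * G t) (\<kappa> - 1))"
    by (rule Suc.IH) (intro continuous_on_mult Suc.prems G_cont)
  then have "Ck k D (\<lambda>s. \<kappa> * Psi (\<lambda>t. h t * G t) (\<kappa> - 1) s)"
    by (rule Ck_mult[OF Ck_const])
  then show ?case
    unfolding Ck.simps using Psi_deriv[OF Suc.prems, of _ \<kappa>]
    by (intro exI[of _ "\<lambda>s. \<kappa> * Psi (\<lambda>t. h t * G t) (\<kappa> - 1) s"]) blast
qed simp

text \<open>Without sign changes the integrand has one sign and is not identically zero, so there
  are no zeros. Each point of S costs one application of Rolle; excluding all natural \<kappa>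
  survives the passage to \<kappa> - 1 and keeps the factor \<kappa> of the derivative
  nonzero.\<close>

lemma Psi_zeros_le_aux:
  assumes "finite S"
  shows "S \<subseteq> {0..T} \<Longrightarrow> continuous_on {0..T} h \<Longrightarrow> (\<And>i::nat. \<kappa> \<noteq> real i) \<Longrightarrow>
    (\<And>t. t \<in> {0<..<T} \<Longrightarrow> h t * (\<Prod>s\<in>S. G t - G s) \<ge> 0) \<Longrightarrow>
    (\<exists>t\<in>{0..T}. h t * (\<Prod>s\<in>S. G t - G s) \<noteq> 0) \<Longrightarrow> zeros_le {} (Psi h \<kappa>) D (card S)"
  using assms
proof (induction S arbitrary: h \<kappa> rule: finite_induct)
  case empty
  have "Psi h \<kappa> s \<noteq> 0" if s: "s \<in> D" for s
  proof
    assume "Psi h \<kappa> s = 0"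
    moreover have cont: "continuous_on {0..T} (\<lambda>t. h t * (1 + s * G t) powr \<kappa>)"
      using Psi_integrand_cont[OF empty.prems(2) s] .
    ultimately have int0: "((\<lambda>t. h t * (1 + s * G t) powr \<kappa>) has_integral 0) {0..T}"
      unfolding Psi_def using integrable_continuous_interval[OF cont] by (metis integrable_integral)
    have "h t * (1 + s * G t) powr \<kappa> = 0" if "t \<in> {0..T}" for t
      by (rule has_integral_0_cbox_imp_0[of 0 T "\<lambda>t. h t * (1 + s * G t) powr \<kappa>"])
        (use cont int0 T_pos that empty.prems(4) in auto)
    moreover have "(1 + s * G t) powr \<kappa> \<noteq> 0" if "t \<in> {0..T}" for t
      using D_pos[OF s that] by simp
    ultimately show False using empty.prems(5) by auto
  qed
  then have "\<mu> x = 0" if "x \<in> D" "vanish (Psi h \<kappa>) x (\<mu> x)" for x and \<mu> :: "real \<Rightarrow> nat"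
    using vanish_mono[OF that(2), of "Suc 0"] that(1) by (cases "\<mu> x") auto
  then show ?case unfolding zeros_le_def by (auto simp: subset_iff)
next
  case (insert z S)
  have z: "z \<in> {0..T}" using insert.prems(1) by simp
  define h' where "h' = (\<lambda>t. h t * (G t - G z))"
  have h'_cont: "continuous_on {0..T} h'"
    unfolding h'_def by (intro continuous_intros insert.prems(2) G_cont)
  have hG_cont: "continuous_on {0..T} (\<lambda>t. h t * G t)"
    by (intro continuous_intros insert.prems(2) G_cont)
  have prod: "h t * (\<Prod>s\<in>insert z S. G t - G s) = h' t * (\<Prod>s\<in>S. G t - G s)" for t
    using insert.hyps by (simp add: h'_def mult_ac)
  have IH: "zeros_le {} (Psi h' (\<kappa> - 1)) D (card S)"
  proof (rule insert.IH)
    show "\<kappa> - 1 \<noteq> real i" for i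
      using insert.prems(3)[of "Suc i"] by auto
  qed (use insert.prems h'_cont prod in auto)
  define c where "c = G z"
  have D_sub: "D \<subseteq> {s. 1 + s * c > 0}"
    unfolding c_def using D_pos z by auto
  define u where "u = (\<lambda>a s. (1 + s * c) powr a)"
  have uC: "Ck k D (u a)" for k a
    unfolding u_def by (rule Ck_subset[OF Ck_powr_affine D_sub])
  \<comment> \<open>With u = (1 + s c)^(-\<kappa>-1) the product rule gives -\<kappa> c u Psi(h,
    \<kappa>) + \<kappa> (1 + s c) u Psi(h G, \<kappa>-1). Expanding the first integral by
    \<open>Psi_lower\<close>, the terms with s c cancel, and \<kappa> u (Psi(h G, \<kappa>-1) - c
    Psi(h, \<kappa>-1)) remains.\<close>
  have deriv: "((\<lambda>s. u (-\<kappa>) s * Psi h \<kappa> s) has_real_derivative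
      (\<kappa> * u (-\<kappa> - 1) s) * Psi h' (\<kappa> - 1) s) (at s)" if s: "s \<in> D" for s
  proof -
    have pos: "1 + s * c > 0" using s D_sub by auto
    have "((\<lambda>s. 1 + s * c) has_real_derivative c) (at s)"
      by (auto intro!: derivative_eq_intros)
    from DERIV_fun_powr[OF this pos, of "-\<kappa>"]
    have d1: "(u (-\<kappa>) has_real_derivative - \<kappa> * u (-\<kappa> - 1) s * c) (at s)"
      by (simp add: u_def)
    have u1: "u (-\<kappa>) s = (1 + s * c) * u (-\<kappa> - 1) s"
      using pos by (simp add: u_def powr_diff)
    have "Psi h' (\<kappa> - 1) s = Psi (\<lambda>t. 1 * (h t * G t) + (- c) * h t) (\<kappa> - 1) s"
      by (simp add: h'_def c_def algebra_simps)
    also have "\<dots> = Psi (\<lambda>t. h t * G t) (\<kappa> - 1) s - c * Psi h (\<kappa> - 1) s"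
      using Psi_lin[OF hG_cont insert.prems(2) s, of 1 "- c"] by simp
    finally have h': "Psi h' (\<kappa> - 1) s = Psi (\<lambda>t. h t * G t) (\<kappa> - 1) s - c * Psi h (\<kappa> - 1) s" .
    show ?thesis
      using DERIV_mult[OF d1 Psi_deriv[OF insert.prems(2) s, of \<kappa>]]
      by (rule DERIV_cong) (simp add: h' u1 Psi_lower[OF insert.prems(2) s, of \<kappa>] algebra_simps)
  qed
  have "zeros_le {} (\<lambda>s. u (-\<kappa>) s * Psi h \<kappa> s) (D - {}) (Suc (card S))"
  proof (rule zeros_le_Rolle[OF open_D interval_D _ _ _ _ _ _ IH])
    show "\<forall>x\<in>D. ((\<lambda>s. u (-\<kappa>) s * Psi h \<kappa> s) has_real_derivative
      (\<kappa> * u (-\<kappa> - 1) x) * Psi h' (\<kappa> - 1) x) (at x)" using deriv by blast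
    show "Ck k D (\<lambda>s. \<kappa> * u (-\<kappa> - 1) s)" for k by (intro Ck_mult Ck_const uC)
    show "\<kappa> * u (-\<kappa> - 1) x \<noteq> 0" if "x \<in> D - {}" for x
      using that D_sub insert.prems(3)[of 0] by (auto simp: u_def)
  qed (auto intro: Psi_Ck h'_cont)
  then have "zeros_le {} (Psi h \<kappa>) D (Suc (card S))"
    using zeros_le_cofactor[OF open_D order_refl uC Psi_Ck[OF insert.prems(2)]] by simp
  then show ?case using insert.hyps by simp
qed

theorem Psi_zeros_le:
  assumes h: "continuous_on {0..T} h" and fin: "finite {t\<in>{0<..<T}. h t = 0}"
    and card: "card {t\<in>{0<..<T}. h t = 0} \<le> k" and \<kappa>: "\<And>i::nat. \<kappa> \<noteq> real i"
  shows "zeros_le {} (Psi h \<kappa>) D k"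
proof -
  define Z where "Z = {t\<in>{0<..<T}. h t = 0}"
  have "\<exists>S \<sigma>. S \<subseteq> Z \<and> \<bar>\<sigma>\<bar> = (1::real) \<and> (\<forall>t\<in>{0<..<T}. \<sigma> * (h t * (\<Prod>s\<in>S. G t - G s)) \<ge> 0)"
  proof (rule sign_change_product)
    show "continuous_on {0<..<T} h"
      by (rule continuous_on_subset[OF h]) auto
    show "G t \<le> G s" if "0 < s" "s \<le> t" "t < T" for s t
      using G_antimono[of s t] that by simp
  qed (use fin in \<open>auto simp: Z_def\<close>)
  then obtain S \<sigma> where S: "S \<subseteq> Z" "\<bar>\<sigma>\<bar> = (1::real)"
    "\<And>t. t \<in> {0<..<T} \<Longrightarrow> \<sigma> * (h t * (\<Prod>s\<in>S. G t - G s)) \<ge> 0" by blast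
  have finS: "finite S" "card S \<le> k"
    using S(1) fin card card_mono[of Z S] finite_subset[of S Z] by (auto simp: Z_def)
  have S01: "S \<subseteq> {0..T}" using S(1) by (auto simp: Z_def)
  \<comment> \<open>The modified integrand must be nonzero somewhere, although G may be constant on
    subintervals. As G takes infinitely many values, one of them differs from all values at the
    zeros of h and at the end points.\<close>
  have "{G T..G 0} \<subseteq> G ` {0..T}"
  proof
    fix v assume "v \<in> {G T..G 0}"
    then show "v \<in> G ` {0..T}"
      using IVT2'[of G T v 0] T_pos G_cont by auto
  qed
  moreover have "infinite {G T..G 0}" using G_nonconst by simp
  ultimately have "infinite (G ` {0..T})" using finite_subset by blast
  moreover have "finite (G ` ({0, T} \<union> Z))" using fin by (simp add: Z_def)
  ultimately have "G ` {0..T} - G ` ({0, T} \<union> Z) \<noteq> {}"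
    by (metis Diff_infinite_finite finite.emptyI)
  then obtain t where t: "t \<in> {0..T}" "G t \<notin> G ` ({0, T} \<union> Z)" by blast
  then have "t \<notin> {0, T} \<union> Z" by blast
  then have "h t \<noteq> 0" using t(1) by (auto simp: Z_def)
  moreover have "(\<Prod>s\<in>S. G t - G s) \<noteq> 0"
    using t(2) S(1) finS(1) by (auto simp: subset_iff)
  ultimately have ne: "\<sigma> * h t * (\<Prod>s\<in>S. G t - G s) \<noteq> 0" using S(2) by auto
  have "zeros_le {} (Psi (\<lambda>t. \<sigma> * h t) \<kappa>) D (card S)"
    by (rule Psi_zeros_le_aux[OF finS(1) S01 _ \<kappa>])
      (use S(3) ne t(1) h in \<open>auto intro!: continuous_intros simp: mult_ac\<close>)
  moreover have "Psi (\<lambda>t. \<sigma> * h t) \<kappa> = (\<lambda>s. \<sigma> * Psi h \<kappa> s)"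
    by (simp add: Psi_def fun_eq_iff mult.assoc)
  ultimately have "zeros_le {} (\<lambda>s. \<sigma> * Psi h \<kappa> s) D (card S)" by simp
  then have "zeros_le {} (Psi h \<kappa>) D (card S)"
    by (rule zeros_le_cofactor[OF open_D order_refl Ck_const Psi_Ck[OF h]])
  then show ?thesis by (rule zeros_le_mono[OF _ order_refl finS(2)])
qed

end

section \<open>Analytic dependence of the solution on the parameter\<close>

text \<open>Polynomials in \<open>e\<close> and \<open>z\<close> with coefficients depending on \<open>t\<close>, as syntax so that the same equation can be
  read over the reals and over the complex numbers.\<close>

datatype kexp = KC "real \<Rightarrow> real" | KE | KZ | KAdd kexp kexp | KMul kexp kexp

primrec kev :: "kexp \<Rightarrow> real \<Rightarrow> 'a \<Rightarrow> 'a \<Rightarrow> 'a :: real_normed_field" where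
  "kev (KC c) t e z = of_real (c t)"
| "kev KE t e z = e"
| "kev KZ t e z = z"
| "kev (KAdd A B) t e z = kev A t e z + kev B t e z"
| "kev (KMul A B) t e z = kev A t e z * kev B t e z"

primrec kcont :: "real set \<Rightarrow> kexp \<Rightarrow> bool" where
  "kcont S (KC c) \<longleftrightarrow> continuous_on S c"
| "kcont S KE \<longleftrightarrow> True"
| "kcont S KZ \<longleftrightarrow> True"
| "kcont S (KAdd A B) \<longleftrightarrow> kcont S A \<and> kcont S B"
| "kcont S (KMul A B) \<longleftrightarrow> kcont S A \<and> kcont S B"

lemma kev_of_real: "kev K t (of_real e) (of_real z) = of_real (kev K t e z)"
  by (induction K) simp_all

lemma kev_cont:
  assumes "continuous_on S z" "kcont S K"
  shows "continuous_on S (\<lambda>t. kev K t e (z t))"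
  using assms(2) by (induction K) (auto intro!: continuous_intros assms(1))

text \<open>The constants are uniform for e in the unit disc, so the bound and the Lipschitz
  constant of \<open>e * kev K t e z\<close> become small with e.\<close>

lemma kev_Lipschitz:
  assumes "kcont {a..b} K"
  shows "\<exists>B L. B \<ge> 0 \<and> L \<ge> 0 \<and> (\<forall>t\<in>{a..b}. \<forall>e z z' :: 'a :: real_normed_field.
    norm e \<le> 1 \<longrightarrow> norm z \<le> R \<longrightarrow> norm z' \<le> R \<longrightarrow>
    norm (kev K t e z) \<le> B \<and> norm (kev K t e z - kev K t e z') \<le> L * norm (z - z'))"
  using assms
proof (induction K)
  case (KC c)
  then have "bounded (c ` {a..b})"
    by (auto intro: compact_imp_bounded compact_continuous_image)
  then obtain B where "\<forall>x\<in>c ` {a..b}. norm x \<le> B"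
    unfolding bounded_iff by blast
  then have B: "\<bar>c t\<bar> \<le> B" if "t \<in> {a..b}" for t using that by auto
  then show ?case
    by (intro exI[of _ "max B 0"] exI[of _ 0]) (auto simp: le_max_iff_disj)
next
  case KE
  show ?case by (intro exI[of _ 1] exI[of _ 0]) auto
next
  case KZ
  show ?case by (intro exI[of _ "max R 0"] exI[of _ 1]) auto
next
  case (KAdd K K')
  then obtain B L B' L' where BL: "B \<ge> 0" "L \<ge> 0" "B' \<ge> 0" "L' \<ge> 0"
    and 1: "\<forall>t\<in>{a..b}. \<forall>e z z' :: 'a. norm e \<le> 1 \<longrightarrow> norm z \<le> R \<longrightarrow> norm z' \<le> R \<longrightarrow>
      norm (kev K t e z) \<le> B \<and> norm (kev K t e z - kev K t e z') \<le> L * norm (z - z')"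
    and 2: "\<forall>t\<in>{a..b}. \<forall>e z z' :: 'a. norm e \<le> 1 \<longrightarrow> norm z \<le> R \<longrightarrow> norm z' \<le> R \<longrightarrow>
      norm (kev K' t e z) \<le> B' \<and> norm (kev K' t e z - kev K' t e z') \<le> L' * norm (z - z')"
    by auto
  show ?case
  proof (rule exI[of _ "B + B'"], rule exI[of _ "L + L'"], intro conjI ballI allI impI)
    fix t and e z z' :: 'a
    assume h: "t \<in> {a..b}" "norm e \<le> 1" "norm z \<le> R" "norm z' \<le> R"
    show "norm (kev (KAdd K K') t e z) \<le> B + B'"
      using 1 2 h by (simp add: norm_triangle_mono)
    have "norm (kev (KAdd K K') t e z - kev (KAdd K K') t e z')
        = norm ((kev K t e z - kev K t e z') + (kev K' t e z - kev K' t e z'))"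
      by (simp add: algebra_simps)
    also have "\<dots> \<le> L * norm (z - z') + L' * norm (z - z')"
      using 1 2 h by (intro norm_triangle_mono) auto
    finally show "norm (kev (KAdd K K') t e z - kev (KAdd K K') t e z') \<le> (L + L') * norm (z - z')"
      by (simp add: algebra_simps)
  qed (use BL in auto)
next
  case (KMul K K')
  then obtain B L B' L' where BL: "B \<ge> 0" "L \<ge> 0" "B' \<ge> 0" "L' \<ge> 0"
    and 1: "\<forall>t\<in>{a..b}. \<forall>e z z' :: 'a. norm e \<le> 1 \<longrightarrow> norm z \<le> R \<longrightarrow> norm z' \<le> R \<longrightarrow>
      norm (kev K t e z) \<le> B \<and> norm (kev K t e z - kev K t e z') \<le> L * norm (z - z')"
    and 2: "\<forall>t\<in>{a..b}. \<forall>e z z' :: 'a. norm e \<le> 1 \<longrightarrow> norm z \<le> R \<longrightarrow> norm z' \<le> R \<longrightarrow>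
      norm (kev K' t e z) \<le> B' \<and> norm (kev K' t e z - kev K' t e z') \<le> L' * norm (z - z')"
    by auto
  show ?case
  proof (rule exI[of _ "B * B'"], rule exI[of _ "L * B' + B * L'"], intro conjI ballI allI impI)
    fix t and e z z' :: 'a
    assume h: "t \<in> {a..b}" "norm e \<le> 1" "norm z \<le> R" "norm z' \<le> R"
    have b: "norm (kev K t e z') \<le> B" "norm (kev K t e z) \<le> B" "norm (kev K' t e z) \<le> B'"
      "norm (kev K t e z - kev K t e z') \<le> L * norm (z - z')"
      "norm (kev K' t e z - kev K' t e z') \<le> L' * norm (z - z')"
      using 1 2 h by blast+
    show "norm (kev (KMul K K') t e z) \<le> B * B'"
      using b BL by (simp add: norm_mult mult_mono)
    have "norm (kev (KMul K K') t e z - kev (KMul K K') t e z')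
        = norm ((kev K t e z - kev K t e z') * kev K' t e z + kev K t e z' * (kev K' t e z - kev K' t e z'))"
      by (simp add: algebra_simps)
    also have "\<dots> \<le> (L * norm (z - z')) * B' + B * (L' * norm (z - z'))"
      unfolding norm_mult[symmetric]
      by (rule norm_triangle_mono; unfold norm_mult; rule mult_mono) (use b BL in auto)
    finally show "norm (kev (KMul K K') t e z - kev (KMul K K') t e z') \<le> (L * B' + B * L') * norm (z - z')"
      by (simp add: algebra_simps)
  qed (use BL in auto)
qed

text \<open>Polynomials in e whose coefficients are continuous in t. The class is stable under
  integration in t and holomorphic in e by construction, so no differentiation under an integral is
  needed. The clause \<open>cong\<close> restricts attention to t in {a..b}.\<close>

inductive epoly :: "real \<Rightarrow> real \<Rightarrow> (real \<Rightarrow> complex \<Rightarrow> complex) \<Rightarrow> bool" for a b where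
  monom: "continuous_on {a..b} c \<Longrightarrow> epoly a b (\<lambda>t e. c t * e ^ j)"
| add: "epoly a b u \<Longrightarrow> epoly a b v \<Longrightarrow> epoly a b (\<lambda>t e. u t e + v t e)"
| cong: "epoly a b u \<Longrightarrow> (\<And>t e. t \<in> {a..b} \<Longrightarrow> u t e = v t e) \<Longrightarrow> epoly a b v"

lemma epoly_mult_monom:
  assumes "epoly a b u" "continuous_on {a..b} c"
  shows "epoly a b (\<lambda>t e. u t e * (c t * e ^ j))"
  using assms(1)
proof induction
  case (monom d i)
  have "epoly a b (\<lambda>t e. (d t * c t) * e ^ (i + j))"
    by (intro epoly.monom continuous_on_mult monom assms(2))
  then show ?case by (rule epoly.cong) (simp add: power_add mult_ac)
next
  case (add u v)
  show ?case by (rule epoly.cong[OF epoly.add[OF add.IH]]) (simp add: algebra_simps)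
next
  case (cong u v)
  show ?case by (rule epoly.cong[OF cong.IH]) (simp add: cong.hyps)
qed

lemma epoly_mult:
  assumes "epoly a b v" "epoly a b u"
  shows "epoly a b (\<lambda>t e. u t e * v t e)"
  using assms(1)
proof induction
  case (monom c j)
  then show ?case by (rule epoly_mult_monom[OF assms(2)])
next
  case (add v w)
  show ?case by (rule epoly.cong[OF epoly.add[OF add.IH]]) (simp add: algebra_simps)
next
  case (cong v w)
  show ?case by (rule epoly.cong[OF cong.IH]) (simp add: cong.hyps)
qed

lemma epoly_kev: "kcont {a..b} K \<Longrightarrow> epoly a b u \<Longrightarrow> epoly a b (\<lambda>t e. kev K t e (u t e))"
proof (induction K)
  case (KC c)
  have "epoly a b (\<lambda>t e. of_real (c t) * e ^ 0)"
    by (rule epoly.monom) (use KC in \<open>auto intro: continuous_intros\<close>)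
  then show ?case by simp
next
  case KE
  have "epoly a b (\<lambda>t e. 1 * e ^ 1)"
    by (rule epoly.monom) auto
  then show ?case by simp
qed (simp_all add: epoly.add epoly_mult)

lemma epoly_cont: "epoly a b u \<Longrightarrow> continuous_on {a..b} (\<lambda>t. u t e)"
proof (induction rule: epoly.induct)
  case (cong u v)
  then show ?case using continuous_on_cong[of "{a..b}" "{a..b}" "\<lambda>t. u t e" "\<lambda>t. v t e"] by simp
qed (auto intro!: continuous_intros)

lemma epoly_holomorphic: "epoly a b u \<Longrightarrow> t \<in> {a..b} \<Longrightarrow> u t holomorphic_on S"
proof (induction rule: epoly.induct)
  case (cong u v)
  then have "u t = v t" by auto
  with cong show ?case by simp
qed (auto intro!: holomorphic_intros)

lemma epoly_integral: "epoly a b u \<Longrightarrow> epoly a b (\<lambda>t e. integral {a..t} (\<lambda>s. u s e))"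
proof (induction rule: epoly.induct)
  case (monom c j)
  have "epoly a b (\<lambda>t e. integral {a..t} c * e ^ j)"
    by (rule epoly.monom) (intro indefinite_integral_continuous_1 integrable_continuous_interval monom)
  then show ?case by (rule epoly.cong) simp
next
  case (add u v)
  have "(\<lambda>s. w s e) integrable_on {a..t}" if "epoly a b w" "t \<in> {a..b}" for w t e
    by (rule integrable_continuous_interval, rule continuous_on_subset[OF epoly_cont[OF that(1)]])
      (use that(2) in auto)
  then show ?case
    by (intro epoly.cong[OF epoly.add[OF add.IH]]) (simp add: integral_add add.hyps)
next
  case (cong u v)
  have "integral {a..t} (\<lambda>s. u s e) = integral {a..t} (\<lambda>s. v s e)" if "t \<in> {a..b}" for t e
    by (rule integral_cong) (use that cong.hyps(2) in auto)
  then show ?case by (rule epoly.cong[OF cong.IH])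
qed

section \<open>Picard iteration with a complex parameter\<close>

primrec picard :: "kexp \<Rightarrow> real \<Rightarrow> nat \<Rightarrow> real \<Rightarrow> complex \<Rightarrow> complex" where
  "picard F a 0 t e = 0"
| "picard F a (Suc k) t e = integral {a..t} (\<lambda>s. kev F s e (picard F a k s e))"

lemma epoly_picard:
  assumes "kcont {a..b} F"
  shows "epoly a b (picard F a k)"
proof (induction k)
  case 0
  have "epoly a b (\<lambda>t e. 0 * e ^ 0)" by (rule epoly.monom) auto
  then show ?case by (rule epoly.cong) simp
next
  case (Suc k)
  show ?case by (rule epoly.cong[OF epoly_integral[OF epoly_kev[OF assms Suc]]]) simp
qed

text \<open>Leads back from the complex parameter to the real equation: for real e the limit of the
  iterates is real as well.\<close>

lemma picard_Reals:
  assumes "kcont {a..b} F" "t \<in> {a..b}"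
  shows "picard F a k t (of_real e) \<in> \<real>"
proof -
  have "\<exists>z. continuous_on {a..b} z \<and> (\<forall>t\<in>{a..b}. picard F a k t (of_real e) = of_real (z t))"
  proof (induction k)
    case 0
    show ?case by (intro exI[of _ "\<lambda>_. 0"]) auto
  next
    case (Suc k)
    then obtain z where z: "continuous_on {a..b} z"
      "\<And>t. t \<in> {a..b} \<Longrightarrow> picard F a k t (of_real e) = of_real (z t)" by auto
    have c: "continuous_on {a..b} (\<lambda>s. kev F s e (z s))" by (rule kev_cont[OF z(1) assms(1)])
    have "picard F a (Suc k) t (of_real e) = of_real (integral {a..t} (\<lambda>s. kev F s e (z s)))"
      if t: "t \<in> {a..b}" for t
    proof -
      have "picard F a (Suc k) t (of_real e) = integral {a..t} (\<lambda>s. complex_of_real (kev F s e (z s)))"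
        unfolding picard.simps by (rule integral_cong) (use t z(2) kev_of_real[where 'a=complex] in auto)
      also have "\<dots> = of_real (integral {a..t} (\<lambda>s. kev F s e (z s)))"
        by (intro integral_unique has_integral_of_real integrable_integral integrable_continuous_interval
            continuous_on_subset[OF c]) (use t in auto)
      finally show ?thesis .
    qed
    moreover have "continuous_on {a..b} (\<lambda>t. integral {a..t} (\<lambda>s. kev F s e (z s)))"
      by (intro indefinite_integral_continuous_1 integrable_continuous_interval c)
    ultimately show ?case by blast
  qed
  then show ?thesis using assms(2) by auto
qed

text \<open>The condition \<open>(b - a) * B \<le> R\<close> keeps the iterates in the ball of
  radius R, and \<open>(b - a) * L \<le> 1 / 2\<close> halves consecutive differences. The resulting
  geometric bound is uniform in t and e together, so Weierstrass's test gives the joint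
  limit.\<close>

lemma picard_limit:
  assumes ab: "a < b" and F: "kcont {a..b} F"
    and B: "B \<ge> 0" "(b - a) * B \<le> R" and L: "L \<ge> 0" "(b - a) * L \<le> 1 / 2"
    and bound: "\<And>t e z z'. t \<in> {a..b} \<Longrightarrow> norm (e :: complex) < d \<Longrightarrow> norm z \<le> R \<Longrightarrow> norm z' \<le> R \<Longrightarrow>
      norm (kev F t e z) \<le> B \<and> norm (kev F t e z - kev F t e z') \<le> L * norm (z - z')"
  obtains w where
    "uniform_limit ({a..b} \<times> ball 0 d) (\<lambda>n (t, e). picard F a n t e) (\<lambda>(t, e). w t e) sequentially"
    "\<And>e. norm e < d \<Longrightarrow> continuous_on {a..b} (\<lambda>t. w t e)"
    "\<And>t e. t \<in> {a..b} \<Longrightarrow> norm e < d \<Longrightarrow> w t e = integral {a..t} (\<lambda>s. kev F s e (w s e))"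
proof -
  have cont: "continuous_on {a..t} (\<lambda>s. kev F s e (picard F a n s e))"
    if "t \<in> {a..b}" for t n and e :: complex
    by (rule continuous_on_subset[OF epoly_cont[OF epoly_kev[OF F epoly_picard[OF F]]]])
      (use that in auto)
  have R: "R \<ge> 0" using B ab by (meson diff_ge_0_iff_ge less_imp_le mult_nonneg_nonneg order_trans)
  have bd: "norm (picard F a n t e) \<le> R" if "t \<in> {a..b}" "norm e < d" for n t e
    using that(1)
  proof (induction n arbitrary: t)
    case (Suc n)
    have "norm (picard F a (Suc n) t e) \<le> B * (t - a)"
      unfolding picard.simps
    proof (rule integral_bound[OF _ cont])
      fix s assume "s \<in> {a..t}"
      then have s: "s \<in> {a..b}" using Suc.prems by auto
      show "norm (kev F s e (picard F a n s e)) \<le> B"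
        using bound[OF s that(2) Suc.IH[OF s] Suc.IH[OF s]] by blast
    qed (use Suc.prems in auto)
    also have "\<dots> \<le> B * (b - a)" using Suc.prems B by (intro mult_left_mono) auto
    finally show ?case using B by (simp add: mult.commute)
  qed (use R in simp)
  have diff: "norm (picard F a (Suc n) t e - picard F a n t e) \<le> R * (1 / 2) ^ n"
    if "t \<in> {a..b}" "norm e < d" for n t e
    using that(1)
  proof (induction n arbitrary: t)
    case 0
    then show ?case using bd[OF 0 that(2), of 1] by simp
  next
    case (Suc n)
    have "picard F a (Suc (Suc n)) t e - picard F a (Suc n) t e
      = integral {a..t} (\<lambda>s. kev F s e (picard F a (Suc n) s e) - kev F s e (picard F a n s e))"
      unfolding picard.simps(2)[of F a "Suc n"] picard.simps(2)[of F a n t e]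
      by (rule integral_diff[symmetric]; rule integrable_continuous_interval[OF cont[OF Suc.prems]])
    also have "norm \<dots> \<le> (L * (R * (1 / 2) ^ n)) * (t - a)"
    proof (rule integral_bound)
      fix s assume s: "s \<in> {a..t}"
      then have s': "s \<in> {a..b}" using Suc.prems by auto
      have "norm (kev F s e (picard F a (Suc n) s e) - kev F s e (picard F a n s e))
          \<le> L * norm (picard F a (Suc n) s e - picard F a n s e)"
        using bound[OF s' that(2) bd[OF s' that(2)] bd[OF s' that(2)]] by blast
      also have "\<dots> \<le> L * (R * (1 / 2) ^ n)"
        using Suc.IH[OF s'] L by (intro mult_left_mono)
      finally show "norm (kev F s e (picard F a (Suc n) s e) - kev F s e (picard F a n s e))
          \<le> L * (R * (1 / 2) ^ n)" .
    qed (use Suc.prems in \<open>auto intro!: continuous_on_diff cont simp del: picard.simps\<close>)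
    also have "\<dots> \<le> (L * (R * (1 / 2) ^ n)) * (b - a)"
      using Suc.prems L R by (intro mult_left_mono) auto
    also have "\<dots> = ((b - a) * L) * (R * (1 / 2) ^ n)" by (simp add: mult_ac)
    also have "\<dots> \<le> (1 / 2) * (R * (1 / 2) ^ n)"
      using L R by (intro mult_right_mono) auto
    finally show ?case by simp
  qed
  define A where "A = {a..b} \<times> ball (0 :: complex) d"
  define f where "f = (\<lambda>n (t, e). picard F a (Suc n) t e - picard F a n t e)"
  define w where "w = (\<lambda>t e. \<Sum>n. f n (t, e))"
  have "uniform_limit A (\<lambda>n x. \<Sum>i<n. f i x) (\<lambda>x. \<Sum>i. f i x) sequentially"
  proof (rule Weierstrass_m_test_ev)
    show "\<forall>\<^sub>F n in sequentially. \<forall>x\<in>A. norm (f n x) \<le> R * (1 / 2) ^ n"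
      using diff by (auto simp: A_def f_def simp del: picard.simps)
    show "summable (\<lambda>n. R * (1 / 2) ^ n)"
      by (intro summable_mult summable_geometric) simp
  qed
  moreover have "(\<Sum>i<n. f i x) = (case x of (t, e) \<Rightarrow> picard F a n t e)" for n x
    by (cases x, induction n) (simp_all add: f_def del: picard.simps(2))
  moreover have "(\<lambda>x. \<Sum>i. f i x) = (\<lambda>(t, e). w t e)"
    by (auto simp: w_def)
  ultimately have ul: "uniform_limit A (\<lambda>n (t, e). picard F a n t e) (\<lambda>(t, e). w t e) sequentially"
    by simp
  have ul_e: "uniform_limit {a..t} (\<lambda>n s. picard F a n s e) (\<lambda>s. w s e) sequentially"
    if "norm e < d" "t \<le> b" for e t
  proof -
    have "uniform_limit {a..t} (\<lambda>n s. (\<lambda>(t, e). picard F a n t e) (s, e)) (\<lambda>s. (\<lambda>(t, e). w t e) (s, e)) sequentially"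
      by (rule uniform_limit_compose'[OF ul]) (use that in \<open>auto simp: A_def\<close>)
    then show ?thesis by simp
  qed
  have w_cont: "continuous_on {a..b} (\<lambda>t. w t e)" if "norm e < d" for e
    by (rule uniform_limit_theorem[OF _ ul_e[OF that order_refl]])
      (auto intro: always_eventually epoly_cont[OF epoly_picard[OF F]])
  have w_lim: "(\<lambda>n. picard F a n t e) \<longlonglongrightarrow> w t e" if "t \<in> {a..b}" "norm e < d" for t e
    using tendsto_uniform_limitI[OF ul_e[OF that(2) order_refl] that(1)] .
  have w_bd: "norm (w t e) \<le> R" if "t \<in> {a..b}" "norm e < d" for t e
    by (rule Lim_norm_ubound[OF _ w_lim[OF that]]) (auto intro: always_eventually bd that)
  have eq: "w t e = integral {a..t} (\<lambda>s. kev F s e (w s e))" if te: "t \<in> {a..b}" "norm e < d" for t e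
  proof -
    \<comment> \<open>The Lipschitz bound transfers uniform convergence to the integrands, which
      permits the limit under the integral. Using L + 1 avoids division by 0 when L = 0.\<close>
    have u: "uniform_limit {a..t} (\<lambda>n s. kev F s e (picard F a n s e)) (\<lambda>s. kev F s e (w s e)) sequentially"
    proof (rule uniform_limitI)
      fix r :: real assume r: "r > 0"
      have "\<forall>\<^sub>F n in sequentially. \<forall>s\<in>{a..t}. dist (picard F a n s e) (w s e) < r / (L + 1)"
        by (rule uniform_limitD[OF ul_e]) (use te r L in auto)
      then show "\<forall>\<^sub>F n in sequentially. \<forall>s\<in>{a..t}. dist (kev F s e (picard F a n s e)) (kev F s e (w s e)) < r"
      proof eventually_elim
        case (elim n)
        show ?case
        proof
          fix s assume s: "s \<in> {a..t}"
          then have s': "s \<in> {a..b}" using te by auto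
          have "dist (kev F s e (picard F a n s e)) (kev F s e (w s e)) \<le> L * dist (picard F a n s e) (w s e)"
            unfolding dist_norm using bound[OF s' te(2) bd[OF s' te(2)] w_bd[OF s' te(2)]] by blast
          also have "\<dots> \<le> L * (r / (L + 1))"
            using elim s L by (intro mult_left_mono) (auto intro: less_imp_le)
          also have "\<dots> < r" using L r by (simp add: field_simps)
          finally show "dist (kev F s e (picard F a n s e)) (kev F s e (w s e)) < r" .
        qed
      qed
    qed
    obtain I J where IJ: "\<And>n. ((\<lambda>s. kev F s e (picard F a n s e)) has_integral I n) {a..t}"
      "((\<lambda>s. kev F s e (w s e)) has_integral J) {a..t}" "I \<longlonglongrightarrow> J"
      using uniform_limit_integral[OF u cont[OF te(1)]] by auto
    have "I = (\<lambda>n. picard F a (Suc n) t e)"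
      using integral_unique[OF IJ(1)] by auto
    then have "(\<lambda>n. picard F a (Suc n) t e) \<longlonglongrightarrow> J" using IJ(3) by blast
    then have "J = w t e"
      using LIMSEQ_unique LIMSEQ_Suc[OF w_lim[OF te]] by blast
    then show ?thesis using integral_unique[OF IJ(2)] by simp
  qed
  show ?thesis using that[of w] ul w_cont eq by (auto simp: A_def)
qed

text \<open>Since the perturbation carries a factor \<open>e\<close>, the Picard map is a contraction on the whole interval for
  small \<open>e\<close>; its iterates are polynomials in \<open>e\<close>, so the limit is holomorphic in \<open>e\<close>.\<close>

theorem analytic_solution:
  fixes a b :: real
  assumes ab: "a < b" and B0: "continuous_on {a..b} B0" and K: "kcont {a..b} K"
  obtains d c where "d > 0" "c 0 = integral {a..b} B0"
    "\<And>e::real. \<bar>e\<bar> < d \<Longrightarrow> \<exists>z. z a = 0 \<and> (\<lambda>n. c n * e ^ n) sums z b \<and>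
      (\<forall>t\<in>{a..b}. (z has_real_derivative B0 t + e * kev K t e (z t)) (at t within {a..b}))"
proof -
  define F where "F = KAdd (KC B0) (KMul KE K)"
  have F: "kcont {a..b} F" using B0 K by (simp add: F_def)
  have Fev: "kev F t e z = of_real (B0 t) + e * kev K t e z" for t and e z :: "'a :: real_normed_field"
    by (simp add: F_def)
  have "bounded (B0 ` {a..b})"
    using B0 by (auto intro: compact_imp_bounded compact_continuous_image)
  then obtain M where M: "M > 0" "\<And>t. t \<in> {a..b} \<Longrightarrow> \<bar>B0 t\<bar> \<le> M"
    by (auto simp: bounded_pos)
  \<comment> \<open>B0 contributes at most M and the perturbation at most 1, once the norm of e
    times B is at most 1.\<close>
  define R where "R = (b - a) * (M + 1)"
  obtain B L where BL: "B \<ge> 0" "L \<ge> 0"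
    and bd: "\<And>t e z z'. t \<in> {a..b} \<Longrightarrow> norm (e :: complex) \<le> 1 \<Longrightarrow> norm z \<le> R \<Longrightarrow> norm z' \<le> R \<Longrightarrow>
      norm (kev K t e z) \<le> B \<and> norm (kev K t e z - kev K t e z') \<le> L * norm (z - z')"
    using kev_Lipschitz[OF K, of R, where 'a=complex] by blast
  \<comment> \<open>Its reciprocal d meets three demands at once: d \<le> 1, d B \<le> 1 and (b - a)
    d L \<le> 1/2.\<close>
  define N where "N = 1 + B + 2 * ((b - a) * L)"
  define d where "d = 1 / N"
  have "(b - a) * L \<ge> 0" using BL ab by (intro mult_nonneg_nonneg) auto
  then have N: "N \<ge> 1" "B \<le> N" "2 * ((b - a) * L) \<le> N" using BL(1) by (simp_all add: N_def)
  have d: "d > 0" "d \<le> 1" "d * B \<le> 1" "(b - a) * (d * L) \<le> 1 / 2"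
    using N by (simp_all add: d_def divide_le_eq mult.commute)
  obtain w where w:
    "uniform_limit ({a..b} \<times> ball 0 d) (\<lambda>n (t, e). picard F a n t e) (\<lambda>(t, e). w t e) sequentially"
    "\<And>e. norm e < d \<Longrightarrow> continuous_on {a..b} (\<lambda>t. w t e)"
    "\<And>t e. t \<in> {a..b} \<Longrightarrow> norm e < d \<Longrightarrow> w t e = integral {a..t} (\<lambda>s. kev F s e (w s e))"
  proof (rule picard_limit[OF ab F, of "M + 1" R "d * L" d])
    fix t and e z z' :: complex
    assume h: "t \<in> {a..b}" "norm e < d" "norm z \<le> R" "norm z' \<le> R"
    have e1: "norm e \<le> 1" using h(2) d(2) by simp
    note b = bd[OF h(1) e1 h(3,4)]
    have "norm (kev F t e z) \<le> M + d * B"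
      unfolding Fev using M(2)[OF h(1)] h(2) b BL d
      by (intro norm_triangle_mono) (auto simp: norm_mult intro!: mult_mono)
    then have 1: "norm (kev F t e z) \<le> M + 1" using d(3) by simp
    have "norm (kev F t e z - kev F t e z') = norm e * norm (kev K t e z - kev K t e z')"
      unfolding Fev by (simp add: norm_mult[symmetric] algebra_simps)
    also have "\<dots> \<le> d * (L * norm (z - z'))"
      using h(2) b d(1) by (intro mult_mono) auto
    finally show "norm (kev F t e z) \<le> M + 1 \<and> norm (kev F t e z - kev F t e z') \<le> d * L * norm (z - z')"
      using 1 by simp
  qed (use M BL d in \<open>auto simp: R_def\<close>)
  have hol: "w b holomorphic_on ball 0 d"
  proof (rule holomorphic_uniform_sequence[OF open_ball])
    show "picard F a n b holomorphic_on ball 0 d" for n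
      by (rule epoly_holomorphic[OF epoly_picard[OF F]]) (use ab in auto)
    fix x :: complex assume "x \<in> ball 0 d"
    then obtain r where r: "r > 0" "cball x r \<subseteq> ball 0 d"
      using open_contains_cball open_ball by blast
    have "uniform_limit (cball x r) (\<lambda>n e. (\<lambda>(t, e). picard F a n t e) (b, e)) (\<lambda>e. (\<lambda>(t, e). w t e) (b, e)) sequentially"
      by (rule uniform_limit_compose'[OF w(1)]) (use r ab in auto)
    then show "\<exists>r>0. cball x r \<subseteq> ball 0 d \<and> uniform_limit (cball x r) (\<lambda>n. picard F a n b) (w b) sequentially"
      using r by auto
  qed
  \<comment> \<open>For real e real parts may be taken termwise in the Taylor series of
    \<open>w b\<close>; since w is real there, its real part z solves the real equation.\<close>
  define c where "c = (\<lambda>n. Re ((deriv ^^ n) (w b) 0 / fact n))"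
  have sol: "\<exists>z. z a = 0 \<and> (\<lambda>n. c n * e ^ n) sums z b \<and>
      (\<forall>t\<in>{a..b}. (z has_real_derivative B0 t + e * kev K t e (z t)) (at t within {a..b})) \<and>
      z b = integral {a..b} (\<lambda>s. B0 s + e * kev K s e (z s))"
    if e: "\<bar>e\<bar> < d" for e :: real
  proof -
    have e': "norm (complex_of_real e) < d" using e by simp
    define z where "z = (\<lambda>t. Re (w t (of_real e)))"
    have wz: "w t (of_real e) = of_real (z t)" if t: "t \<in> {a..b}" for t
    proof -
      have "uniform_limit {of_real e} (\<lambda>n e. (\<lambda>(t, e). picard F a n t e) (t, e)) (\<lambda>e. (\<lambda>(t, e). w t e) (t, e)) sequentially"
        by (rule uniform_limit_compose'[OF w(1)]) (use t e in auto)
      then have "(\<lambda>n. picard F a n t (of_real e)) \<longlonglongrightarrow> w t (of_real e)"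
        by (auto dest: tendsto_uniform_limitI)
      then have "w t (of_real e) \<in> \<real>"
        by (rule closed_sequentially[OF closed_complex_Reals, rotated]) (rule picard_Reals[OF F t])
      then show ?thesis by (simp add: z_def)
    qed
    have z_cont: "continuous_on {a..b} z"
      unfolding z_def by (intro continuous_intros w(2) e')
    have c: "continuous_on {a..b} (\<lambda>s. kev F s e (z s))"
      by (rule kev_cont[OF z_cont F])
    have z_int: "z t = integral {a..t} (\<lambda>s. kev F s e (z s))" if t: "t \<in> {a..b}" for t
    proof -
      have "complex_of_real (z t) = integral {a..t} (\<lambda>s. kev F s (of_real e) (w s (of_real e)))"
        using w(3)[OF t e'] wz[OF t] by simp
      also have "\<dots> = integral {a..t} (\<lambda>s. complex_of_real (kev F s e (z s)))"
        by (rule integral_cong) (use t wz kev_of_real[where 'a=complex] in auto)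
      also have "\<dots> = of_real (integral {a..t} (\<lambda>s. kev F s e (z s)))"
        by (intro integral_unique has_integral_of_real integrable_integral integrable_continuous_interval
            continuous_on_subset[OF c]) (use t in auto)
      finally show ?thesis by simp
    qed
    have "(z has_real_derivative kev F t e (z t)) (at t within {a..b})" if t: "t \<in> {a..b}" for t
      by (rule has_field_derivative_transform_within[OF integral_has_real_derivative[OF c t] zero_less_one t])
        (use z_int in simp)
    moreover have "z a = 0" using z_int[of a] ab by simp
    moreover have "(\<lambda>n. c n * e ^ n) sums z b"
    proof -
      have "(\<lambda>n. (deriv ^^ n) (w b) 0 / fact n * (of_real e - 0) ^ n) sums w b (of_real e)"
        by (rule holomorphic_power_series[OF hol]) (use e in simp)
      from sums_Re[OF this]
      have "(\<lambda>n. Re ((deriv ^^ n) (w b) 0 / fact n * of_real (e ^ n))) sums z b"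
        by (simp add: z_def)
      moreover have "(\<lambda>n. Re ((deriv ^^ n) (w b) 0 / fact n * of_real (e ^ n))) = (\<lambda>n. c n * e ^ n)"
        unfolding c_def by (rule ext) (simp del: of_real_power times_divide_eq_left)
      ultimately show ?thesis by (simp only:)
    qed
    moreover have "z b = integral {a..b} (\<lambda>s. B0 s + e * kev K s e (z s))"
      using z_int[of b] ab by (simp add: Fev)
    ultimately show ?thesis by (auto simp: Fev)
  qed
  \<comment> \<open>At e = 0 the equation reduces to z' = B0 and the series to its constant
    term.\<close>
  have "c 0 = integral {a..b} B0"
  proof -
    from sol[of 0] d(1) obtain z where z: "(\<lambda>n. c n * 0 ^ n) sums z b" "z b = integral {a..b} B0"
      by auto
    show ?thesis using sums_unique2[OF z(1) powser_sums_zero] z(2) by simp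
  qed
  then show ?thesis using that[of d c] d(1) sol by blast
qed

section \<open>Expansion of the perturbed solution in the small parameter\<close>

lemma kexp_power:
  assumes "continuous_on I x" "continuous_on I v"
  shows "\<exists>S. kcont I S \<and> (\<forall>t e z::real. (x t + e * v t * z) ^ p = x t ^ p + e * kev S t e z)"
proof (induction p)
  case 0
  show ?case by (rule exI[of _ "KC (\<lambda>_. 0)"]) auto
next
  case (Suc p)
  then obtain S where S: "kcont I S" "\<And>t e z::real. (x t + e * v t * z) ^ p = x t ^ p + e * kev S t e z"
    by blast
  define S' where "S' = KAdd (KMul (KC (\<lambda>t. v t * x t ^ p)) KZ)
    (KAdd (KMul (KC x) S) (KMul KE (KMul (KMul (KC v) KZ) S)))"
  have "kcont I S'" using assms S(1) by (auto simp: S'_def intro!: continuous_intros)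
  moreover have "(x t + e * v t * z) ^ Suc p = x t ^ Suc p + e * kev S' t e z" for t and e z :: real
    unfolding power_Suc S(2) by (simp add: S'_def algebra_simps)
  ultimately show ?case by blast
qed

text \<open>The unperturbed coefficient \<open>f 1\<close> carries no factor \<epsilon>, so its
  power must be expanded to second order for the linear part to be cancelled by v. For the
  perturbation terms the first-order form \<open>kexp_power\<close> is enough.\<close>

lemma kexp_power_linear:
  assumes "continuous_on I x" "continuous_on I v"
  shows "\<exists>S. kcont I S \<and> (\<forall>t e z::real. (x t + e * v t * z) ^ p
    = x t ^ p + e * (real p * x t ^ (p - 1) * v t * z) + e\<^sup>2 * kev S t e z)"
proof (induction p)
  case 0
  show ?case by (rule exI[of _ "KC (\<lambda>_. 0)"]) auto
next
  case (Suc p)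
  then obtain S where S: "kcont I S" "\<And>t e z::real. (x t + e * v t * z) ^ p
      = x t ^ p + e * (real p * x t ^ (p - 1) * v t * z) + e\<^sup>2 * kev S t e z"
    by blast
  define S' where "S' = KAdd (KMul (KC (\<lambda>t. real p * x t ^ (p - 1) * v t * v t)) (KMul KZ KZ))
    (KAdd (KMul (KC x) S) (KMul KE (KMul (KMul (KC v) KZ) S)))"
  have "kcont I S'" using assms S(1) by (auto simp: S'_def intro!: continuous_intros)
  moreover have "(x t + e * v t * z) ^ Suc p
      = x t ^ Suc p + e * (real (Suc p) * x t ^ (Suc p - 1) * v t * z) + e\<^sup>2 * kev S' t e z" for t and e z :: real
  proof -
    have "x t * (e * (real p * x t ^ (p - 1) * v t * z)) = e * (real p * x t ^ p * v t * z)"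
      by (cases p) (auto simp: mult_ac)
    then show ?thesis
      unfolding power_Suc S(2) by (simp add: S'_def algebra_simps power2_eq_square)
  qed
  ultimately show ?case by blast
qed

lemma solution_continuous:
  assumes "solution T f p q n m \<mu> \<epsilon> \<rho> x"
  shows "continuous_on {-T..T} x"
  using assms unfolding solution_def by (auto intro: DERIV_continuous_on)

text \<open>The difference of two solutions satisfies a homogeneous linear equation.\<close>

lemma solution_unique:
  assumes f: "\<And>i. continuous_on {-T..T} (f i)"
    and x: "solution T f p q n m \<mu> \<epsilon> \<rho> x" and y: "solution T f p q n m \<mu> \<epsilon> \<rho> y"
    and t: "t \<in> {-T..T}"
  shows "x t = y t"
proof -
  define \<alpha> where "\<alpha> = (\<lambda>t. f 1 t + \<epsilon> * lin_comb f n (fst \<mu> 1) t + \<epsilon>\<^sup>2 * lin_comb f n (fst \<mu> 2) t)"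
  define \<beta> where "\<beta> = (\<lambda>t. \<epsilon> * lin_comb f m (snd \<mu> 1) t + \<epsilon>\<^sup>2 * lin_comb f m (snd \<mu> 2) t)"
  \<comment> \<open>P k is the cofactor of x - y in x^k - y^k. Thus A is the coefficient of the
    linear equation for x - y, and the integrating factor E makes \<open>(x - y) * E\<close>
    constant.\<close>
  define P where "P = (\<lambda>p t. \<Sum>i<p. y t ^ (p - Suc i) * x t ^ i)"
  define A where "A = (\<lambda>t. \<alpha> t * P p t + \<beta> t * P q t)"
  have lc: "continuous_on {-T..T} (lin_comb f k c)" for k c
    unfolding lin_comb_def by (intro continuous_intros f)
  note xc = solution_continuous[OF x] and yc = solution_continuous[OF y]
  have A: "continuous_on {-T..T} A"
    unfolding A_def P_def \<alpha>_def \<beta>_def by (intro continuous_intros lc f xc yc)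
  define E where "E = (\<lambda>t. exp (- integral {-T..t} A))"
  have "((\<lambda>t. (x t - y t) * E t) has_real_derivative 0) (at s within {-T..T})" if s: "s \<in> {-T..T}" for s
  proof -
    have E': "(E has_real_derivative - A s * E s) (at s within {-T..T})"
      unfolding E_def by (rule derivative_eq_intros integral_has_real_derivative A s refl)+ simp
    have "(x has_real_derivative \<alpha> s * x s ^ p + \<beta> s * x s ^ q) (at s within {-T..T})"
      "(y has_real_derivative \<alpha> s * y s ^ p + \<beta> s * y s ^ q) (at s within {-T..T})"
      using x y s unfolding solution_def perturbed_rhs_def \<alpha>_def \<beta>_def by blast+
    from DERIV_mult[OF DERIV_diff[OF this] E']
    have "((\<lambda>t. (x t - y t) * E t) has_real_derivative
        (\<alpha> s * x s ^ p + \<beta> s * x s ^ q - (\<alpha> s * y s ^ p + \<beta> s * y s ^ q)) * E s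
        + - A s * E s * (x s - y s)) (at s within {-T..T})" .
    moreover have d: "x s ^ k - y s ^ k = (x s - y s) * P k s" for k
      unfolding P_def by (rule power_diff_sumr2)
    have "(\<alpha> s * x s ^ p + \<beta> s * x s ^ q - (\<alpha> s * y s ^ p + \<beta> s * y s ^ q))
        = \<alpha> s * (x s ^ p - y s ^ p) + \<beta> s * (x s ^ q - y s ^ q)" by (simp add: algebra_simps)
    also have "\<dots> = A s * (x s - y s)" unfolding d A_def by (simp add: algebra_simps)
    ultimately show ?thesis by simp
  qed
  then obtain c where c: "\<And>s. s \<in> {-T..T} \<Longrightarrow> (x s - y s) * E s = c"
    using has_field_derivative_zero_constant[of "{-T..T}" "\<lambda>t. (x t - y t) * E t"] by auto
  have "x (-T) = y (-T)" using x y by (simp add: solution_def)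
  then have "c = 0" using c[of "-T"] t by simp
  then show ?thesis using c[OF t] by (simp add: E_def)
qed

text \<open>A nonzero coefficient of the difference series would keep its sum away from 0 on a
  punctured neighbourhood. The constant coefficient is read off at e = 0, the others have positive
  index.\<close>

lemma sums_unique_coeffs:
  fixes c c' :: "nat \<Rightarrow> real"
  assumes "\<forall>\<^sub>F e in nhds 0. \<exists>s. (\<lambda>i. e ^ i * c i) sums s \<and> (\<lambda>i. e ^ i * c' i) sums s"
  shows "c = c'"
proof -
  obtain r where r: "r > 0"
    "\<And>e. \<bar>e\<bar> < r \<Longrightarrow> \<exists>s. (\<lambda>i. e ^ i * c i) sums s \<and> (\<lambda>i. e ^ i * c' i) sums s"
    using assms unfolding eventually_nhds_metric by auto
  have sm: "(\<lambda>i. (c i - c' i) * (e - 0) ^ i) sums 0" if "norm (e - 0) < r" for e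
  proof -
    have "\<bar>e\<bar> < r" using that by simp
    then obtain s where s: "(\<lambda>i. e ^ i * c i) sums s" "(\<lambda>i. e ^ i * c' i) sums s"
      using r(2) by metis
    have "(\<lambda>i. e ^ i * c i - e ^ i * c' i) = (\<lambda>i. (c i - c' i) * (e - 0) ^ i)"
      by (simp add: fun_eq_iff algebra_simps)
    with sums_diff[OF s] show ?thesis by simp
  qed
  have "c i - c' i = 0" for i
  proof (cases "i = 0")
    case True
    have "(\<lambda>i. (c i - c' i) * 0 ^ i) sums 0" using sm[of 0] r(1) by simp
    from sums_unique2[OF this powser_sums_zero] show ?thesis unfolding True by simp
  next
    case False
    show ?thesis
    proof (rule ccontr)
      assume ne: "c i - c' i \<noteq> 0"
      have i: "i > 0" using False by simp
      show False
      proof (rule powser_0_nonzero[of r 0 "\<lambda>i. c i - c' i" "\<lambda>_. 0" i, OF r(1) sm refl ne i])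
        fix s :: real
        assume s: "0 < s" and *: "\<And>z. z \<in> cball (0 :: real) s - {0} \<Longrightarrow> (0 :: real) \<noteq> 0"
        have "s \<in> cball 0 s - {0}" using s by simp
        from *[OF this] show False by simp
      qed
    qed
  qed
  then show ?thesis by (intro ext) (metis eq_iff_diff_eq_0)
qed

text \<open>Makes the definite description in \<open>melnikov\<close> evaluate to whichever
  expansion has been constructed.\<close>

lemma melnikov_expansion_unique:
  assumes T: "T > 0" and f: "\<And>i. continuous_on {-T..T} (f i)"
    and M: "melnikov_expansion T f p q n m \<mu> \<rho> M" "melnikov_expansion T f p q n m \<mu> \<rho> M'"
  shows "M = M'"
proof (rule sums_unique_coeffs)
  have "\<forall>\<^sub>F e in nhds 0. (\<exists>x. solution T f p q n m \<mu> e \<rho> x \<and> (\<lambda>i. e ^ i * M i) sums (x T - \<rho>)) \<and>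
      (\<exists>x. solution T f p q n m \<mu> e \<rho> x \<and> (\<lambda>i. e ^ i * M' i) sums (x T - \<rho>))"
    using M unfolding melnikov_expansion_def by (intro eventually_conj) auto
  then show "\<forall>\<^sub>F e in nhds 0. \<exists>s. (\<lambda>i. e ^ i * M i) sums s \<and> (\<lambda>i. e ^ i * M' i) sums s"
  proof eventually_elim
    case (elim e)
    then obtain x y where xy: "solution T f p q n m \<mu> e \<rho> x" "(\<lambda>i. e ^ i * M i) sums (x T - \<rho>)"
      "solution T f p q n m \<mu> e \<rho> y" "(\<lambda>i. e ^ i * M' i) sums (y T - \<rho>)" by blast
    have "x T = y T" using solution_unique[OF f xy(1,3)] T by simp
    then show ?case using xy(2,4) by auto
  qed
qed

text \<open>With \<open>v\<close> solving the linearization along \<open>x0\<close>, the substitution \<open>x = x0 + \<epsilon> v z\<close> turns the equation into one for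
  \<open>z\<close> that is covered by \<open>analytic_solution\<close>.\<close>

lemma melnikov_first:
  assumes T: "T > 0" and f: "\<And>i. continuous_on {-T..T} (f i)"
    and x0: "\<And>t. t \<in> {-T..T} \<Longrightarrow> (x0 has_real_derivative f 1 t * x0 t ^ p) (at t within {-T..T})"
    and v: "\<And>t. t \<in> {-T..T} \<Longrightarrow>
      (v has_real_derivative real p * f 1 t * x0 t ^ (p - 1) * v t) (at t within {-T..T})"
    and v0: "\<And>t. t \<in> {-T..T} \<Longrightarrow> v t > 0"
    and bd: "x0 (-T) = \<rho>" "x0 T = \<rho>" "v T = 1"
  shows "melnikov T f p q n m 1 \<mu> \<rho> = integral {-T..T}
    (\<lambda>t. (lin_comb f n (fst \<mu> 1) t * x0 t ^ p + lin_comb f m (snd \<mu> 1) t * x0 t ^ q) / v t)"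
proof -
  define P1 where "P1 = lin_comb f n (fst \<mu> 1)"
  define P2 where "P2 = lin_comb f n (fst \<mu> 2)"
  define Q1 where "Q1 = lin_comb f m (snd \<mu> 1)"
  define Q2 where "Q2 = lin_comb f m (snd \<mu> 2)"
  have x0c: "continuous_on {-T..T} x0" and vc: "continuous_on {-T..T} v"
    using DERIV_continuous_on[OF x0] DERIV_continuous_on[OF v] by blast+
  have lc: "continuous_on {-T..T} (lin_comb f k c)" for k c
    unfolding lin_comb_def by (intro continuous_intros f)
  have PQ: "continuous_on {-T..T} P1" "continuous_on {-T..T} P2"
    "continuous_on {-T..T} Q1" "continuous_on {-T..T} Q2"
    by (simp_all add: P1_def P2_def Q1_def Q2_def lc)
  obtain Sp where Sp: "kcont {-T..T} Sp"
    "\<And>t e z::real. (x0 t + e * v t * z) ^ p = x0 t ^ p + e * kev Sp t e z"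
    using kexp_power[OF x0c vc] by blast
  obtain Sq where Sq: "kcont {-T..T} Sq"
    "\<And>t e z::real. (x0 t + e * v t * z) ^ q = x0 t ^ q + e * kev Sq t e z"
    using kexp_power[OF x0c vc] by blast
  obtain S2 where S2: "kcont {-T..T} S2"
    "\<And>t e z::real. (x0 t + e * v t * z) ^ p
      = x0 t ^ p + e * (real p * x0 t ^ (p - 1) * v t * z) + e\<^sup>2 * kev S2 t e z"
    using kexp_power_linear[OF x0c vc] by blast
  define B0 where "B0 = (\<lambda>t. (P1 t * x0 t ^ p + Q1 t * x0 t ^ q) / v t)"
  \<comment> \<open>What is left of the equation for x0 + e v z after subtracting the equation of x0
    and the linearized one of v, dividing by e v, and removing the leading term B0; all of it
    carries one more factor e.\<close>
  define K where "K = KMul (KC (\<lambda>t. 1 / v t))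
    (KAdd (KMul (KC (f 1)) S2)
    (KAdd (KMul (KAdd (KC P1) (KMul KE (KC P2))) Sp)
    (KAdd (KC (\<lambda>t. P2 t * x0 t ^ p))
    (KAdd (KMul (KAdd (KC Q1) (KMul KE (KC Q2))) Sq) (KC (\<lambda>t. Q2 t * x0 t ^ q))))))"
  have vn0: "\<forall>t\<in>{-T..T}. v t \<noteq> 0" using v0 less_numeral_extra(3) by metis
  have B0c: "continuous_on {-T..T} B0"
    unfolding B0_def by (intro continuous_intros PQ x0c vc vn0)
  have Kc: "kcont {-T..T} K"
    using Sp(1) Sq(1) S2(1) f by (auto simp: K_def intro!: continuous_intros PQ x0c vc vn0)
  have rhs: "f 1 t * x0 t ^ p + e * (real p * f 1 t * x0 t ^ (p - 1) * v t * z + v t * (B0 t + e * kev K t e z))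
      = perturbed_rhs f p q n m \<mu> e t (x0 t + e * v t * z)" if t: "t \<in> {-T..T}" for t e z
  proof -
    have vt: "v t \<noteq> 0" using v0[OF t] by simp
    have 1: "v t * B0 t = P1 t * x0 t ^ p + Q1 t * x0 t ^ q"
      using vt by (simp add: B0_def)
    have 2: "v t * kev K t e z = f 1 t * kev S2 t e z + (P1 t + e * P2 t) * kev Sp t e z + P2 t * x0 t ^ p
        + (Q1 t + e * Q2 t) * kev Sq t e z + Q2 t * x0 t ^ q"
      using vt by (simp add: K_def)
    have "perturbed_rhs f p q n m \<mu> e t (x0 t + e * v t * z)
      = f 1 t * (x0 t + e * v t * z) ^ p + (e * P1 t + e\<^sup>2 * P2 t) * (x0 t + e * v t * z) ^ p
        + (e * Q1 t + e\<^sup>2 * Q2 t) * (x0 t + e * v t * z) ^ q"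
      by (simp add: perturbed_rhs_def P1_def P2_def Q1_def Q2_def algebra_simps)
    also have "\<dots> = f 1 t * (x0 t ^ p + e * (real p * x0 t ^ (p - 1) * v t * z) + e\<^sup>2 * kev S2 t e z)
        + (e * P1 t + e\<^sup>2 * P2 t) * (x0 t ^ p + e * kev Sp t e z)
        + (e * Q1 t + e\<^sup>2 * Q2 t) * (x0 t ^ q + e * kev Sq t e z)"
      by (simp only: S2(2)[symmetric] Sp(2)[symmetric] Sq(2)[symmetric])
    also have "\<dots> = f 1 t * x0 t ^ p + e * (real p * f 1 t * x0 t ^ (p - 1) * v t * z + (v t * B0 t + e * (v t * kev K t e z)))"
      unfolding 1 2 by (simp add: algebra_simps power2_eq_square)
    finally show ?thesis by (simp add: algebra_simps)
  qed
  obtain d c where dc: "d > 0" "c 0 = integral {-T..T} B0"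
    "\<And>e::real. \<bar>e\<bar> < d \<Longrightarrow> \<exists>z. z (-T) = 0 \<and> (\<lambda>n. c n * e ^ n) sums z T \<and>
      (\<forall>t\<in>{-T..T}. (z has_real_derivative B0 t + e * kev K t e (z t)) (at t within {-T..T}))"
    using analytic_solution[OF _ B0c Kc] T by auto
  \<comment> \<open>An index shift: v T = 1 gives x T - \<rho> = e * z T, so the coefficient of
    e^(i+1) is c i, and the first-order one is c 0, the integral of B0.\<close>
  define M where "M = (\<lambda>i. case i of 0 \<Rightarrow> 0 | Suc i \<Rightarrow> c i)"
  have "\<exists>x. solution T f p q n m \<mu> e \<rho> x \<and> (\<lambda>i. e ^ i * M i) sums (x T - \<rho>)" if e: "\<bar>e\<bar> < d" for e
  proof -
    obtain z where z: "z (-T) = 0" "(\<lambda>n. c n * e ^ n) sums z T"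
      "\<And>t. t \<in> {-T..T} \<Longrightarrow> (z has_real_derivative B0 t + e * kev K t e (z t)) (at t within {-T..T})"
      using dc(3)[OF e] by blast
    define x where "x = (\<lambda>t. x0 t + e * v t * z t)"
    have "(x has_real_derivative perturbed_rhs f p q n m \<mu> e t (x t)) (at t within {-T..T})"
      if t: "t \<in> {-T..T}" for t
    proof -
      have "((\<lambda>t. x0 t + e * (v t * z t)) has_real_derivative
        f 1 t * x0 t ^ p + e * (real p * f 1 t * x0 t ^ (p - 1) * v t * z t + v t * (B0 t + e * kev K t e (z t))))
        (at t within {-T..T})"
        by (rule derivative_eq_intros x0 v z t refl)+ (simp add: algebra_simps)
      then show ?thesis unfolding rhs[OF t] by (simp add: x_def mult.assoc)
    qed
    moreover have "x (-T) = \<rho>" using z(1) bd by (simp add: x_def)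
    moreover have "(\<lambda>i. e ^ i * M i) sums (x T - \<rho>)"
    proof -
      have "(\<lambda>i. e ^ Suc i * M (Suc i)) sums (e * z T)"
        using sums_mult[OF z(2), of e] by (simp add: M_def mult_ac)
      then have "(\<lambda>i. e ^ i * M i) sums (e * z T + e ^ 0 * M 0)"
        by (rule sums_Suc)
      then show ?thesis using bd by (simp add: M_def x_def)
    qed
    ultimately show ?thesis by (auto simp: solution_def)
  qed
  then have M: "melnikov_expansion T f p q n m \<mu> \<rho> M"
    using dc(1) by (auto simp: melnikov_expansion_def M_def eventually_nhds_metric)
  have "(THE M. melnikov_expansion T f p q n m \<mu> \<rho> M) = M"
    by (rule the_equality[where P="melnikov_expansion T f p q n m \<mu> \<rho>", OF M])
      (rule melnikov_expansion_unique[OF T f _ M])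
  then have "melnikov T f p q n m 1 \<mu> \<rho> = M 1" by (simp only: melnikov_def)
  then show ?thesis using dc(2) by (simp add: M_def B0_def P1_def Q1_def)
qed

section \<open>Prescribing and creating zeros\<close>

text \<open>A homogeneous linear system with fewer equations (the points of X) than unknowns (the
  indices in S), solved by eliminating one unknown per point.\<close>

lemma nontrivial_combination:
  fixes g :: "'i \<Rightarrow> 'x \<Rightarrow> real"
  assumes "finite X"
  shows "finite S \<Longrightarrow> card X < card S \<Longrightarrow>
    \<exists>\<alpha>. (\<exists>i\<in>S. \<alpha> i \<noteq> 0) \<and> (\<forall>x\<in>X. (\<Sum>i\<in>S. \<alpha> i * g i x) = 0)"
  using assms
proof (induction X arbitrary: S g rule: finite_induct)
  case empty
  then have "S \<noteq> {}" by auto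
  then show ?case by (intro exI[of _ "\<lambda>_. 1"]) auto
next
  case (insert x X)
  show ?case
  proof (cases "\<forall>i\<in>S. g i x = 0")
    case True
    have "card X < card S" using insert by simp
    from insert.IH[OF insert.prems(1) this, of g] obtain \<alpha> where
      \<alpha>: "\<exists>i\<in>S. \<alpha> i \<noteq> 0" "\<forall>x\<in>X. (\<Sum>i\<in>S. \<alpha> i * g i x) = 0" by blast
    moreover have "(\<Sum>i\<in>S. \<alpha> i * g i x) = 0" using True by simp
    ultimately show ?thesis by blast
  next
    case False
    then obtain j where j: "j \<in> S" "g j x \<noteq> 0" by blast
    \<comment> \<open>Subtracting the multiple of the pivot function \<open>g j\<close> makes every
      \<open>g' i\<close> vanish at x, so only the other points remain to be treated; the
      coefficient of \<open>g j\<close> is recovered in \<beta>.\<close>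
    define g' where "g' = (\<lambda>i y. g i y - g i x / g j x * g j y)"
    have "card X < card (S - {j})" using insert j by simp
    from insert.IH[OF finite_Diff[OF insert.prems(1)] this, of g'] obtain \<alpha> where
      \<alpha>: "\<exists>i\<in>S - {j}. \<alpha> i \<noteq> 0" "\<And>y. y \<in> X \<Longrightarrow> (\<Sum>i\<in>S - {j}. \<alpha> i * g' i y) = 0" by blast
    define \<beta> where "\<beta> = \<alpha>(j := - (\<Sum>i\<in>S - {j}. \<alpha> i * g i x) / g j x)"
    have eq: "(\<Sum>i\<in>S. \<beta> i * g i y) = (\<Sum>i\<in>S - {j}. \<alpha> i * g' i y)" for y
    proof -
      have "(\<Sum>i\<in>S. \<beta> i * g i y) = \<beta> j * g j y + (\<Sum>i\<in>S - {j}. \<beta> i * g i y)"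
        by (rule sum.remove[OF insert.prems(1) j(1)])
      also have "(\<Sum>i\<in>S - {j}. \<beta> i * g i y) = (\<Sum>i\<in>S - {j}. \<alpha> i * g i y)"
        by (rule sum.cong) (auto simp: \<beta>_def)
      also have "\<beta> j * g j y = - (\<Sum>i\<in>S - {j}. \<alpha> i * g i x / g j x * g j y)"
        by (simp add: \<beta>_def sum_divide_distrib sum_distrib_right sum_negf)
      finally show ?thesis
        by (simp add: g'_def sum_subtractf algebra_simps)
    qed
    have "\<exists>i\<in>S. \<beta> i \<noteq> 0" using \<alpha>(1) by (auto simp: \<beta>_def)
    moreover have "(\<Sum>i\<in>S. \<beta> i * g i y) = 0" if "y \<in> insert x X" for y
    proof (cases "y = x")
      case True
      then show ?thesis unfolding eq using j(2) by (simp add: g'_def)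
    next
      case False
      then show ?thesis unfolding eq using \<alpha>(2) that by simp
    qed
    ultimately show ?thesis by blast
  qed
qed

text \<open>A form of zeros that is stable under small perturbations: strict sign changes at the
  ends of finitely many disjoint closed intervals. Zeros are recovered at the end by the
  intermediate value theorem.\<close>

definition sign_pairs :: "(real \<Rightarrow> real) \<Rightarrow> real set \<Rightarrow> (real \<times> real) set \<Rightarrow> bool"
  where "sign_pairs u S C \<longleftrightarrow> finite C \<and>
    (\<forall>(a, b)\<in>C. a < b \<and> {a..b} \<subseteq> S \<and> u a * u b < 0) \<and>
    (\<forall>c\<in>C. \<forall>c'\<in>C. c \<noteq> c' \<longrightarrow> {fst c..snd c} \<inter> {fst c'..snd c'} = {})"

lemma sign_pairsD:
  assumes "sign_pairs u S C" "c \<in> C"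
  shows "fst c < snd c" "{fst c..snd c} \<subseteq> S" "u (fst c) * u (snd c) < 0"
  using assms by (auto simp: sign_pairs_def split: prod.splits)

lemma sign_pairs_finite: "sign_pairs u S C \<Longrightarrow> finite C"
  by (simp add: sign_pairs_def)

lemma sign_pairsI:
  assumes "finite C" "\<And>c. c \<in> C \<Longrightarrow> fst c < snd c" "\<And>c. c \<in> C \<Longrightarrow> {fst c..snd c} \<subseteq> S"
    "\<And>c. c \<in> C \<Longrightarrow> u (fst c) * u (snd c) < 0"
    "\<And>c c'. c \<in> C \<Longrightarrow> c' \<in> C \<Longrightarrow> c \<noteq> c' \<Longrightarrow> {fst c..snd c} \<inter> {fst c'..snd c'} = {}"
  shows "sign_pairs u S C"
  using assms unfolding sign_pairs_def by (simp add: case_prod_beta)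

lemma sign_pairs_zeros:
  assumes "sign_pairs u S C" "continuous_on S u"
  obtains X where "finite X" "card X = card C" "X \<subseteq> S" "\<And>x. x \<in> X \<Longrightarrow> u x = 0"
proof -
  have "\<exists>z\<in>{fst c..snd c}. u z = 0" if c: "c \<in> C" for c
  proof -
    note d = sign_pairsD[OF assms(1) c]
    have cont: "continuous_on {fst c..snd c} u" using continuous_on_subset[OF assms(2) d(2)] .
    consider "u (fst c) \<le> 0" "0 \<le> u (snd c)" | "u (snd c) \<le> 0" "0 \<le> u (fst c)"
      using d(3) by (auto simp: mult_less_0_iff)
    then show ?thesis
    proof cases
      case 1
      then show ?thesis using IVT'[of u "fst c" 0 "snd c", OF _ _ _ cont] d(1) by auto
    next
      case 2
      then show ?thesis using IVT2'[of u "snd c" 0 "fst c", OF _ _ _ cont] d(1) by auto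
    qed
  qed
  then obtain z where z: "\<And>c. c \<in> C \<Longrightarrow> z c \<in> {fst c..snd c} \<and> u (z c) = 0" by metis
  have "inj_on z C"
  proof (rule inj_onI, rule ccontr)
    fix c c' assume h: "c \<in> C" "c' \<in> C" "z c = z c'" "c \<noteq> c'"
    then have "{fst c..snd c} \<inter> {fst c'..snd c'} = {}" using assms(1) unfolding sign_pairs_def by blast
    then show False using z[OF h(1)] z[OF h(2)] h(3) by (metis IntI empty_iff)
  qed
  show ?thesis
  proof (rule that[of "z ` C"])
    show "finite (z ` C)" using sign_pairs_finite[OF assms(1)] by simp
    show "card (z ` C) = card C" using \<open>inj_on z C\<close> by (rule card_image)
    show "z ` C \<subseteq> S" using z sign_pairsD(2)[OF assms(1)] by blast
    show "u x = 0" if "x \<in> z ` C" for x using z that by blast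
  qed
qed

lemma simple_zero_sign_change:
  fixes u :: "real \<Rightarrow> real"
  assumes "(u has_real_derivative l) (at x)" "u x = 0" "l \<noteq> 0"
  shows "\<forall>\<^sub>F d in at_right 0. u (x - d) * u (x + d) < 0"
proof -
  obtain d1 where d1: "d1 > 0" "\<And>h. 0 < h \<Longrightarrow> h < d1 \<Longrightarrow> (u (x + h)) * l > 0"
  proof (cases "l > 0")
    case True
    from DERIV_pos_inc_right[OF assms(1) True] show ?thesis using that assms(2) True by (auto simp: zero_less_mult_iff)
  next
    case False
    then have "l < 0" using assms(3) by simp
    from DERIV_neg_dec_right[OF assms(1) this] show ?thesis using that assms(2) False by (auto simp: zero_less_mult_iff \<open>l < 0\<close>)
  qed
  obtain d2 where d2: "d2 > 0" "\<And>h. 0 < h \<Longrightarrow> h < d2 \<Longrightarrow> (u (x - h)) * l < 0"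
  proof (cases "l > 0")
    case True
    from DERIV_pos_inc_left[OF assms(1) True] show ?thesis using that assms(2) True by (auto simp: mult_less_0_iff)
  next
    case False
    then have "l < 0" using assms(3) by simp
    from DERIV_neg_dec_left[OF assms(1) this] show ?thesis using that assms(2) False by (auto simp: mult_less_0_iff \<open>l < 0\<close>)
  qed
  show ?thesis
    unfolding eventually_at_right_field
  proof (rule exI[of _ "min d1 d2"], intro conjI allI impI)
    fix d assume d: "0 < d" "d < min d1 d2"
    then have "u (x + d) * l > 0" "u (x - d) * l < 0" using d1(2)[of d] d2(2)[of d] by auto
    then show "u (x - d) * u (x + d) < 0"
      by (auto simp: zero_less_mult_iff mult_less_0_iff)
  qed (use d1 d2 in auto)
qed

text \<open>Finitely many conditions hold eventually as the radius tends to 0 from the right, so a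
  single radius d serves all zeros.\<close>

lemma sign_pairs_simple_zeros:
  assumes "finite X" "open S" "X \<subseteq> S" "\<And>x. x \<in> X \<Longrightarrow> u x = 0"
    and u': "\<And>x. x \<in> X \<Longrightarrow> \<exists>l. l \<noteq> 0 \<and> (u has_real_derivative l) (at x)"
  obtains C where "sign_pairs u S C" "card C = card X"
proof -
  have "\<forall>\<^sub>F d in at_right 0. u (x - d) * u (x + d) < 0" if "x \<in> X" for x
    using simple_zero_sign_change u'[OF that] assms(4)[OF that] by blast
  then have 1: "\<forall>\<^sub>F d in at_right 0. \<forall>x\<in>X. u (x - d) * u (x + d) < 0"
    using assms(1) by (simp add: eventually_ball_finite)
  have "\<forall>\<^sub>F d in at_right 0. {x - d..x + d} \<subseteq> S" if "x \<in> X" for x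
  proof -
    obtain r where r: "r > 0" "ball x r \<subseteq> S" using assms(2,3) \<open>x \<in> X\<close> open_contains_ball by blast
    show ?thesis
      unfolding eventually_at_right_field
    proof (rule exI[of _ r], intro conjI allI impI)
      fix d assume "0 < d" "d < r"
      then have "{x - d..x + d} \<subseteq> ball x r" by (auto simp: dist_real_def)
      then show "{x - d..x + d} \<subseteq> S" using r by blast
    qed (rule r)
  qed
  then have 2: "\<forall>\<^sub>F d in at_right 0. \<forall>x\<in>X. {x - d..x + d} \<subseteq> S"
    using assms(1) by (simp add: eventually_ball_finite)
  have "\<forall>\<^sub>F d in at_right 0. x \<noteq> y \<longrightarrow> {x - d..x + d} \<inter> {y - d..y + d} = {}" if "x \<in> X" "y \<in> X" for x y
    unfolding eventually_at_right_field
    by (rule exI[of _ "if x = y then 1 else \<bar>x - y\<bar> / 2"]) auto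
  then have 3: "\<forall>\<^sub>F d in at_right 0. \<forall>x\<in>X. \<forall>y\<in>X. x \<noteq> y \<longrightarrow> {x - d..x + d} \<inter> {y - d..y + d} = {}"
    using assms(1) by (simp add: eventually_ball_finite)
  have "\<forall>\<^sub>F d in at_right 0. (0::real) < d" by (rule eventually_at_right_less)
  from eventually_happens'[OF trivial_limit_at_right_real
      eventually_conj[OF this eventually_conj[OF 1 eventually_conj[OF 2 3]]]]
  obtain d where d: "d > 0" "\<forall>x\<in>X. u (x - d) * u (x + d) < 0" "\<forall>x\<in>X. {x - d..x + d} \<subseteq> S"
    "\<forall>x\<in>X. \<forall>y\<in>X. x \<noteq> y \<longrightarrow> {x - d..x + d} \<inter> {y - d..y + d} = {}"
    by (elim exE conjE) (rule that)
  show ?thesis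
  proof (rule that[of "(\<lambda>x. (x - d, x + d)) ` X"])
    show "sign_pairs u S ((\<lambda>x. (x - d, x + d)) ` X)"
    proof (rule sign_pairsI)
      show "finite ((\<lambda>x. (x - d, x + d)) ` X)" using assms(1) by simp
      fix c assume c: "c \<in> (\<lambda>x. (x - d, x + d)) ` X"
      then obtain x where x: "x \<in> X" "c = (x - d, x + d)" by blast
      show "fst c < snd c" using x(2) d(1) by simp
      show "{fst c..snd c} \<subseteq> S" unfolding x(2) fst_conv snd_conv using x(1) d(3) by blast
      show "u (fst c) * u (snd c) < 0" unfolding x(2) fst_conv snd_conv using x(1) d(2) by blast
      fix c' assume c': "c' \<in> (\<lambda>x. (x - d, x + d)) ` X" "c \<noteq> c'"
      then obtain y where y: "y \<in> X" "c' = (y - d, y + d)" by blast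
      have "x \<noteq> y" using c'(2) x(2) y(2) by auto
      then show "{fst c..snd c} \<inter> {fst c'..snd c'} = {}"
        unfolding x(2) y(2) fst_conv snd_conv using d(4) x(1) y(1) by blast
    qed
    show "card ((\<lambda>x. (x - d, x + d)) ` X) = card X"
      by (rule card_image) (auto simp: inj_on_def)
  qed
qed

text \<open>Intervals that avoid 0 have both ends on the same side, so sign changes can be passed
  between functions that differ by a power of x.\<close>

lemma sign_pairs_transfer:
  assumes "sign_pairs u (J - {0}) C"
    and "\<And>a b. 0 < a * b \<Longrightarrow> u a * u b < 0 \<Longrightarrow> g a * g b < 0"
  shows "sign_pairs g (J - {0}) C"
proof (rule sign_pairsI)
  fix c assume c: "c \<in> C"
  note d = sign_pairsD[OF assms(1) c]
  show "fst c < snd c" "{fst c..snd c} \<subseteq> J - {0}" by fact+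
  have "0 \<notin> {fst c..snd c}" using d(2) by blast
  then have "0 < fst c * snd c" using d(1) by (auto simp: zero_less_mult_iff)
  then show "g (fst c) * g (snd c) < 0" using assms(2) d(3) by blast
next
  fix c c' assume "c \<in> C" "c' \<in> C" "c \<noteq> c'"
  then show "{fst c..snd c} \<inter> {fst c'..snd c'} = {}"
    using assms(1) unfolding sign_pairs_def by blast
qed (use assms(1) in \<open>simp add: sign_pairs_finite\<close>)

text \<open>If \<open>\<epsilon> w\<close> and \<open>u\<close> have opposite signs at \<open>0\<close>, then the perturbed function changes sign between \<open>0\<close>, where \<open>\<epsilon> w\<close>
  dominates, and nearby points where \<open>x\<^sup>k u\<close> dominates: on the right of \<open>0\<close>, and also on the left if \<open>k\<close> is even.\<close>

lemma sign_pairs_perturb: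
  fixes u w :: "real \<Rightarrow> real"
  assumes J: "open J" "0 \<in> J" and cont: "continuous_on J u" "continuous_on J w"
    and ne: "u 0 \<noteq> 0" "w 0 \<noteq> 0" and k: "k \<ge> 1" and C: "sign_pairs u (J - {0}) C"
  obtains \<epsilon> C' where "\<epsilon> \<noteq> 0" "sign_pairs (\<lambda>x. \<epsilon> * w x + x ^ k * u x) (J - {0}) C'"
    "card C' = card C + (if even k then 2 else 1)"
proof -
  note finC = sign_pairs_finite[OF C]
  have evJ: "\<forall>\<^sub>F d in at_right 0. {-d..d} \<subseteq> J"
  proof -
    obtain r where r: "r > 0" "ball 0 r \<subseteq> J" using J open_contains_ball by blast
    show ?thesis unfolding eventually_at_right_field
    proof (rule exI[of _ r], intro conjI allI impI)
      fix d assume "0 < d" "d < r"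
      then have "{-d..d} \<subseteq> ball 0 r" by (auto simp: dist_real_def)
      then show "{-d..d} \<subseteq> J" using r by blast
    qed (rule r)
  qed
  have lim: "((\<lambda>d. g d) \<longlongrightarrow> g 0) (at_right 0)" "((\<lambda>d. g (- d)) \<longlongrightarrow> g 0) (at_right 0)"
    if "continuous_on J g" for g :: "real \<Rightarrow> real"
  proof -
    have c: "isCont g 0" using that J continuous_on_eq_continuous_at by blast
    have t: "((\<lambda>d::real. d) \<longlongrightarrow> 0) (at_right 0)" "((\<lambda>d::real. - d) \<longlongrightarrow> 0) (at_right 0)"
      by (auto intro!: tendsto_eq_intros)
    show "((\<lambda>d. g d) \<longlongrightarrow> g 0) (at_right 0)" by (rule isCont_tendsto_compose[OF c t(1)])
    show "((\<lambda>d. g (- d)) \<longlongrightarrow> g 0) (at_right 0)" by (rule isCont_tendsto_compose[OF c t(2)])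
  qed
  have uu: "u 0 * u 0 > 0" using ne by (simp add: zero_less_mult_iff linorder_neq_iff disj_commute)
  have ev1: "\<forall>\<^sub>F d in at_right 0. u d * u 0 > 0"
    by (rule order_tendstoD(1)[OF tendsto_mult_right[OF lim(1)[OF cont(1)]] uu])
  have ev2: "\<forall>\<^sub>F d in at_right 0. u (- d) * u 0 > 0"
    by (rule order_tendstoD(1)[OF tendsto_mult_right[OF lim(2)[OF cont(1)]] uu])
  have "\<forall>\<^sub>F d in at_right 0. {fst c..snd c} \<inter> {-d..d} = {}" if c: "c \<in> C" for c
  proof -
    note d = sign_pairsD[OF C c]
    have "0 \<notin> {fst c..snd c}" using d(2) by blast
    then have "fst c > 0 \<or> snd c < 0" using d(1) by auto
    then show ?thesis
      unfolding eventually_at_right_field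
      by (intro exI[of _ "if fst c > 0 then fst c else - snd c"]) (use d(1) in auto)
  qed
  then have ev3: "\<forall>\<^sub>F d in at_right 0. \<forall>c\<in>C. {fst c..snd c} \<inter> {-d..d} = {}"
    using finC by (simp add: eventually_ball_finite)
  have "\<forall>\<^sub>F d in at_right 0. (0::real) < d" by (rule eventually_at_right_less)
  from eventually_happens'[OF trivial_limit_at_right_real
      eventually_conj[OF this eventually_conj[OF evJ eventually_conj[OF ev1 eventually_conj[OF ev2 ev3]]]]]
  obtain d where d: "d > 0" "{-d..d} \<subseteq> J" "u d * u 0 > 0" "u (- d) * u 0 > 0"
    "\<forall>c\<in>C. {fst c..snd c} \<inter> {-d..d} = {}"
    by (elim exE conjE) (rule that)
  \<comment> \<open>The coefficient is chosen so that g e 0 * u 0 = -e (u 0 * w 0)^2 < 0 for e > 0.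
    The order of choices matters: d, where x^k u has the sign of u 0, then e small enough not to
    disturb the signs at d and on C, and finally y so close to 0 that the term with w
    dominates.\<close>
  define g where "g = (\<lambda>e x. (- e * (u 0 * w 0)) * w x + x ^ k * u x)"
  have g_lim: "((\<lambda>e. g e x) \<longlongrightarrow> x ^ k * u x) (at_right 0)" for x
  proof -
    have "((\<lambda>e. g e x) \<longlongrightarrow> (- 0 * (u 0 * w 0)) * w x + x ^ k * u x) (at_right 0)"
      unfolding g_def by (intro tendsto_intros)
    then show ?thesis by simp
  qed
  have "\<forall>\<^sub>F e in at_right 0. g e (fst c) * g e (snd c) < 0" if c: "c \<in> C" for c
  proof -
    note dc = sign_pairsD[OF C c]
    have "0 \<notin> {fst c..snd c}" using dc(2) by blast
    then have "0 < fst c * snd c" using dc(1) by (auto simp: zero_less_mult_iff)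
    then have "(fst c * snd c) ^ k * (u (fst c) * u (snd c)) < 0"
      using dc(3) by (simp add: mult_less_0_iff)
    then have "(fst c ^ k * u (fst c)) * (snd c ^ k * u (snd c)) < 0"
      by (simp add: power_mult_distrib mult_ac)
    then show ?thesis by (rule order_tendstoD(2)[OF tendsto_mult[OF g_lim g_lim]])
  qed
  then have ev4: "\<forall>\<^sub>F e in at_right 0. \<forall>c\<in>C. g e (fst c) * g e (snd c) < 0"
    using finC by (simp add: eventually_ball_finite)
  have "d ^ k * u d * u 0 > 0" using d(1,3) by (simp add: mult.assoc)
  then have ev5: "\<forall>\<^sub>F e in at_right 0. g e d * u 0 > 0"
    by (rule order_tendstoD(1)[OF tendsto_mult_right[OF g_lim]])
  have ev6: "\<forall>\<^sub>F e in at_right 0. even k \<longrightarrow> g e (- d) * u 0 > 0"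
  proof (cases "even k")
    case True
    then have "(- d) ^ k * u (- d) * u 0 > 0" using d(1,4) by (simp add: mult.assoc)
    then have "\<forall>\<^sub>F e in at_right 0. g e (- d) * u 0 > 0"
      by (rule order_tendstoD(1)[OF tendsto_mult_right[OF g_lim]])
    then show ?thesis by (rule eventually_mono) simp
  qed simp
  have "\<forall>\<^sub>F d in at_right 0. (0::real) < d" by (rule eventually_at_right_less)
  from eventually_happens'[OF trivial_limit_at_right_real
      eventually_conj[OF this eventually_conj[OF ev4 eventually_conj[OF ev5 ev6]]]]
  obtain e where e: "e > 0" "\<forall>c\<in>C. g e (fst c) * g e (snd c) < 0" "g e d * u 0 > 0"
    "even k \<longrightarrow> g e (- d) * u 0 > 0"
    by (elim exE conjE) (rule that)
  have gc: "continuous_on J (g e)" unfolding g_def by (intro continuous_intros cont)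
  have "(u 0 * w 0)\<^sup>2 > 0" using ne by simp
  then have "0 < e * (u 0 * w 0)\<^sup>2" using e(1) by simp
  moreover have "g e 0 * u 0 = - (e * (u 0 * w 0)\<^sup>2)"
    using k by (simp add: g_def power2_eq_square zero_power algebra_simps)
  ultimately have g0: "g e 0 * u 0 < 0" by linarith
  have "\<forall>\<^sub>F y in at_right 0. g e y * u 0 < 0"
    by (rule order_tendstoD(2)[OF tendsto_mult_right[OF lim(1)[OF gc]] g0])
  moreover have "\<forall>\<^sub>F y in at_right 0. g e (- y) * u 0 < 0"
    by (rule order_tendstoD(2)[OF tendsto_mult_right[OF lim(2)[OF gc]] g0])
  moreover have "\<forall>\<^sub>F y in at_right 0. y < d"
    unfolding eventually_at_right_field using d(1) by blast
  moreover have "\<forall>\<^sub>F y in at_right 0. (0::real) < y" by (rule eventually_at_right_less)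
  ultimately have "\<forall>\<^sub>F y in at_right 0. g e y * u 0 < 0 \<and> g e (- y) * u 0 < 0 \<and> y < d \<and> 0 < y"
    by eventually_elim blast
  from eventually_happens'[OF trivial_limit_at_right_real this]
  obtain y where y: "g e y * u 0 < 0" "g e (- y) * u 0 < 0" "y < d" "0 < y"
    by (elim exE conjE) (rule that)
  have opp: "r * s < 0" if "r * u 0 < 0" "s * u 0 > 0" for r s
    using that by (auto simp: mult_less_0_iff zero_less_mult_iff)
  \<comment> \<open>g e has the sign of u 0 at d and the opposite one at y. For even k the factor
    x^k is positive on the left too, and the mirrored interval is a second sign change.\<close>
  define N where "N = insert (y, d) (if even k then {(- d, - y)} else {})"
  have Nd: "{fst c..snd c} \<subseteq> {-d..d} - {0}" "fst c < snd c" "g e (fst c) * g e (snd c) < 0" if "c \<in> N" for c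
    using that y d(1) opp[OF y(1) e(3)] opp[OF y(2), of "g e (- d)"] e(4)
    by (auto simp: N_def mult.commute split: if_splits)
  have Nn: "{fst c..snd c} \<inter> {fst c'..snd c'} = {}" if "c \<in> N" "c' \<in> N" "c \<noteq> c'" for c c'
    using that y by (auto simp: N_def split: if_splits)
  have disj: "c \<notin> N" if "c \<in> C" for c
  proof
    assume "c \<in> N"
    have "fst c \<in> {fst c..snd c}" using Nd(2)[OF \<open>c \<in> N\<close>] by simp
    then show False using d(5) that Nd(1)[OF \<open>c \<in> N\<close>] by blast
  qed
  show ?thesis
  proof (rule that[of "- e * (u 0 * w 0)" "C \<union> N"])
    show "- e * (u 0 * w 0) \<noteq> 0" using e(1) ne by simp
    show "sign_pairs (\<lambda>x. - e * (u 0 * w 0) * w x + x ^ k * u x) (J - {0}) (C \<union> N)"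
    proof (rule sign_pairsI)
      show "finite (C \<union> N)" using finC by (simp add: N_def)
      fix c assume c: "c \<in> C \<union> N"
      show "fst c < snd c" using c Nd(2) sign_pairsD(1)[OF C] by blast
      show "{fst c..snd c} \<subseteq> J - {0}" using c Nd(1) sign_pairsD(2)[OF C] d(2) by blast
      show "(- e * (u 0 * w 0) * w (fst c) + fst c ^ k * u (fst c)) *
          (- e * (u 0 * w 0) * w (snd c) + snd c ^ k * u (snd c)) < 0"
        using c Nd(3) e(2) unfolding g_def by blast
    next
      fix c c' assume h: "c \<in> C \<union> N" "c' \<in> C \<union> N" "c \<noteq> c'"
      show "{fst c..snd c} \<inter> {fst c'..snd c'} = {}"
      proof (cases "c \<in> C"; cases "c' \<in> C")
        assume "c \<in> C" "c' \<in> C"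
        then show ?thesis using C h(3) unfolding sign_pairs_def by blast
      next
        assume "c \<in> C" "c' \<notin> C"
        then show ?thesis using d(5) Nd(1)[of c'] h by blast
      next
        assume "c \<notin> C" "c' \<in> C"
        then show ?thesis using d(5) Nd(1)[of c] h by blast
      next
        assume "c \<notin> C" "c' \<notin> C"
        then show ?thesis using Nn h by blast
      qed
    qed
    have "card (C \<union> N) = card C + card N"
    proof (rule card_Un_disjoint)
      show "C \<inter> N = {}" using disj by blast
    qed (use finC in \<open>simp_all add: N_def\<close>)
    moreover have "(y, d) \<noteq> (- d, - y)" using y d(1) by auto
    then have "card N = (if even k then 2 else 1)"
      by (simp add: N_def)
    ultimately show "card (C \<union> N) = card C + (if even k then 2 else 1)" by simp
  qed
qed

section \<open>Zeros of the first-order Melnikov function\<close>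

text \<open>\<open>l\<close> is \<open>m\<^sub>1\<close>, \<open>S\<close> the set of non-odd indices, \<open>e i\<close> the even part of \<open>f\<^sub>i\<close>. Up to constant factors, \<open>A\<close> and \<open>\<beta>\<close>
  are the coefficient of \<open>f\<^sub>0\<close> in \<open>P\<^sub>1\<close> and those of \<open>Q\<^sub>1\<close>, and \<open>M A \<beta>\<close> is the first-order Melnikov function.\<close>

locale chebyshev_weight = weight T G for T :: real and G :: "real \<Rightarrow> real" +
  fixes p q :: nat and S :: "nat set" and e :: "nat \<Rightarrow> real \<Rightarrow> real" and l :: nat
  assumes p: "p \<ge> 2" and q: "q \<ge> 2" and pq: "p \<noteq> q"
    and S: "finite S" "0 \<in> S" "card S = Suc l" and l: "l \<ge> 1"
    and e_cont: "\<And>i. continuous_on {0..T} (e i)"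
    and e_pos: "\<And>t. t \<in> {0..T} \<Longrightarrow> e 0 t > 0"
    and e_int: "\<And>i. i \<in> S \<Longrightarrow> i \<noteq> 0 \<Longrightarrow> integral {0..T} (e i) = 0"
    and e_CT: "\<And>\<beta>. \<exists>i\<in>S. \<beta> i \<noteq> 0 \<Longrightarrow> finite {t\<in>{0<..<T}. (\<Sum>i\<in>S. \<beta> i * e i t) = 0} \<and>
      card {t\<in>{0<..<T}. (\<Sum>i\<in>S. \<beta> i * e i t) = 0} \<le> l"
begin

definition "\<kappa> = (real p - real q) / (real p - 1)"
definition h :: "(nat \<Rightarrow> real) \<Rightarrow> real \<Rightarrow> real" where "h \<beta> t = (\<Sum>i\<in>S. \<beta> i * e i t)"
definition J :: "real set" where "J = {\<rho>. \<rho> ^ (p - 1) \<in> D}"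
definition Phi :: "(nat \<Rightarrow> real) \<Rightarrow> real \<Rightarrow> real \<Rightarrow> real"
  where "Phi \<beta> a \<rho> = Psi (h \<beta>) a (\<rho> ^ (p - 1))"
definition M :: "real \<Rightarrow> (nat \<Rightarrow> real) \<Rightarrow> real \<Rightarrow> real"
  where "M A \<beta> \<rho> = A * \<rho> ^ p + \<rho> ^ q * Phi \<beta> \<kappa> \<rho>"
definition nontriv :: "(nat \<Rightarrow> real) \<Rightarrow> bool" where "nontriv \<beta> \<longleftrightarrow> (\<exists>i\<in>S. \<beta> i \<noteq> 0)"

lemma kappa: "\<kappa> < 1" "\<kappa> \<noteq> 0" "\<kappa> * real (p - 1) = real p - real q"
  using p q pq by (auto simp: \<kappa>_def field_simps of_nat_diff)

text \<open>The only natural number below 1 is 0, which is excluded by p \<noteq> q, and \<kappa> -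
  1 is negative.\<close>

lemma kappa_not_nat: "\<kappa> \<noteq> real i" "\<kappa> - 1 \<noteq> real i"
  using kappa(1,2) by (cases i; simp)+

lemma h_cont: "continuous_on {0..T} (h \<beta>)"
  unfolding h_def by (intro continuous_intros e_cont)

lemma Psi_h:
  assumes "s \<in> D"
  shows "Psi (h \<beta>) a s = (\<Sum>i\<in>S. \<beta> i * Psi (e i) a s)"
proof -
  have i: "(\<lambda>t. \<beta> i * (e i t * (1 + s * G t) powr a)) integrable_on {0..T}" for i
    by (intro integrable_continuous_interval continuous_on_mult continuous_on_const
        Psi_integrand_cont e_cont assms)
  have "Psi (h \<beta>) a s = integral {0..T} (\<lambda>t. \<Sum>i\<in>S. \<beta> i * (e i t * (1 + s * G t) powr a))"
    unfolding Psi_def h_def by (simp add: sum_distrib_right mult.assoc)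
  also have "\<dots> = (\<Sum>i\<in>S. \<beta> i * Psi (e i) a s)"
    unfolding Psi_def by (subst integral_sum[OF S(1) i]) simp
  finally show ?thesis .
qed

lemma Psi_h_zeros_le:
  assumes "nontriv \<beta>" "\<And>i::nat. a \<noteq> real i"
  shows "zeros_le {} (Psi (h \<beta>) a) D l"
  using Psi_zeros_le[OF h_cont _ _ assms(2), of \<beta> l] e_CT[of \<beta>] assms(1)
  by (auto simp: nontriv_def h_def)

lemma zero_D: "s \<ge> 0 \<Longrightarrow> s \<in> D"
  using G_nonneg[of 0] T_pos by (simp add: D_def add_pos_nonneg)

lemma Psi_zero: "Psi g a 0 = integral {0..T} g"
  by (simp add: Psi_def)

text \<open>At s = 0 the weight is 1, and among the even parts only that of index 0 has a nonzero
  mean. Hence \<beta> 0 alone decides whether \<open>Phi\<close> vanishes at 0.\<close>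

lemma Psi_h_zero: "Psi (h \<beta>) a 0 = \<beta> 0 * integral {0..T} (e 0)"
proof -
  have "Psi (h \<beta>) a 0 = (\<Sum>i\<in>S. \<beta> i * integral {0..T} (e i))"
    using Psi_h[OF zero_D[OF order_refl]] by (simp add: Psi_zero)
  also have "\<dots> = \<beta> 0 * integral {0..T} (e 0) + (\<Sum>i\<in>S - {0}. \<beta> i * integral {0..T} (e i))"
    by (rule sum.remove[OF S(1,2)])
  also have "(\<Sum>i\<in>S - {0}. \<beta> i * integral {0..T} (e i)) = 0"
    by (rule sum.neutral) (use e_int in auto)
  finally show ?thesis by simp
qed

lemma open_J: "open J"
proof -
  have "open ((\<lambda>\<rho>. \<rho> ^ (p - 1)) -` D)"
    by (rule open_vimage[OF open_D]) (intro continuous_intros)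
  then show ?thesis by (simp add: J_def vimage_def)
qed

lemma pos_J: "\<rho> \<ge> 0 \<Longrightarrow> \<rho> \<in> J"
  by (simp add: J_def zero_D)

lemma odd_J: "odd p \<Longrightarrow> \<rho> \<in> J"
  unfolding J_def by (auto intro!: zero_D zero_le_even_power)

lemma interval_J: "is_interval J"
proof (cases "odd p")
  case True
  then have "J = UNIV" using odd_J by auto
  then show ?thesis by (simp add: is_interval_univ)
next
  case False
  then have o: "odd (p - 1)" using p by simp
  show ?thesis unfolding is_interval_1
  proof (intro ballI allI impI)
    fix a b x assume "a \<in> J" "b \<in> J" "a \<le> x \<and> x \<le> b"
    then show "x \<in> J"
      using D_upward[of "a ^ (p - 1)" "x ^ (p - 1)"] power_mono_odd[OF o, of a x] by (simp add: J_def)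
  qed
qed

lemma J_split: "J - {0} = (J \<inter> {0<..}) \<union> (J \<inter> {..<0})" "(J \<inter> {0<..}) \<inter> (J \<inter> {..<0}) = {}"
  by auto

lemma Psi_pow_Ck:
  assumes "continuous_on {0..T} g"
  shows "Ck k J (\<lambda>\<rho>. Psi g a (\<rho> ^ (p - 1)))"
  by (rule Ck_compose[OF Psi_Ck[OF assms] Ck_power]) (auto simp: J_def)

lemma Phi_Ck: "Ck k J (Phi \<beta> a)"
  unfolding Phi_def[abs_def] by (rule Psi_pow_Ck[OF h_cont])

lemma M_Ck: "Ck k J (M A \<beta>)"
  unfolding M_def[abs_def] by (intro Ck_add Ck_mult Ck_const Ck_power Phi_Ck)

lemma power_deriv: "((\<lambda>\<rho>::real. \<rho> ^ (p - 1)) has_real_derivative real (p - 1) * \<rho> ^ (p - 2)) (at \<rho>)"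
  by (auto intro!: derivative_eq_intros simp: numeral_2_eq_2)

lemma Phi_deriv:
  assumes "\<rho> \<in> J"
  shows "(Phi \<beta> a has_real_derivative a * Psi (\<lambda>t. h \<beta> t * G t) (a - 1) (\<rho> ^ (p - 1)) * (real (p - 1) * \<rho> ^ (p - 2))) (at \<rho>)"
  unfolding Phi_def[abs_def]
  by (rule DERIV_chain2[OF Psi_deriv[OF h_cont] power_deriv]) (use assms in \<open>simp add: J_def\<close>)

section \<open>Upper bounds for the number of zeros\<close>

lemma Phi_zeros_side:
  assumes "nontriv \<beta>" "\<And>i::nat. a \<noteq> real i" "I = J \<inter> {0<..} \<or> I = J \<inter> {..<0}"
  shows "zeros_le {} (Phi \<beta> a) I l"
  unfolding Phi_def[abs_def]
proof (rule zeros_le_compose[OF open_D _ _ _ Psi_Ck[OF h_cont] _ _ _ Psi_h_zeros_le[OF assms(1,2)]])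
  show "open I" using assms(3) open_J by auto
  show "(\<lambda>x. x ^ (p - 1)) ` I \<subseteq> D" using assms(3) by (auto simp: J_def)
  have p1: "p - 1 > 0" using p by simp
  have "x = y" if "x ^ (p - 1) = y ^ (p - 1)" "x > 0 \<and> y > 0 \<or> x < 0 \<and> y < 0" for x y :: real
  proof -
    have "\<bar>x\<bar> ^ (p - 1) = \<bar>y\<bar> ^ (p - 1)" using that(1) by (metis power_abs)
    then have "\<bar>x\<bar> = \<bar>y\<bar>" using power_eq_iff_eq_base[OF p1, of "\<bar>x\<bar>" "\<bar>y\<bar>"] by simp
    then show ?thesis using that(2) by auto
  qed
  then show "inj_on (\<lambda>x. x ^ (p - 1)) I"
    using assms(3) by (intro inj_onI) auto
  show "\<forall>y\<in>I. ((\<lambda>x. x ^ (p - 1)) has_real_derivative real (p - 1) * y ^ (p - 2)) (at y)"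
    using power_deriv by blast
  show "real (p - 1) * x ^ (p - 2) \<noteq> 0" if "x \<in> I - {}" for x
    using that assms(3) p by auto
  show "Ck k I (\<lambda>y. real (p - 1) * y ^ (p - 2))" for k
    by (intro Ck_mult Ck_const Ck_power)
qed

text \<open>For even p the odd power \<rho>^(p-1) is injective on all of J, so both half-lines share
  the bound l. Its derivative may vanish at 0, which therefore becomes the exceptional
  point.\<close>

lemma Phi_zeros_even:
  assumes "nontriv \<beta>" "\<And>i::nat. a \<noteq> real i" "even p"
  shows "zeros_le {0} (Phi \<beta> a) J l"
  unfolding Phi_def[abs_def]
proof (rule zeros_le_compose[OF open_D open_J _ _ Psi_Ck[OF h_cont] _ _ _ Psi_h_zeros_le[OF assms(1,2)]])
  show "(\<lambda>x. x ^ (p - 1)) ` J \<subseteq> D" by (auto simp: J_def)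
  have o: "odd (p - 1)" using assms(3) p by simp
  show "inj_on (\<lambda>x. x ^ (p - 1)) J"
    by (rule inj_onI) (metis o odd_real_root_power_cancel)
  show "\<forall>y\<in>J. ((\<lambda>x. x ^ (p - 1)) has_real_derivative real (p - 1) * y ^ (p - 2)) (at y)"
    using power_deriv by blast
  show "real (p - 1) * x ^ (p - 2) \<noteq> 0" if "x \<in> J - {0}" for x
    using that p by auto
  show "Ck k J (\<lambda>y. real (p - 1) * y ^ (p - 2))" for k
    by (intro Ck_mult Ck_const Ck_power)
qed

text \<open>An integer exponent, since q < p is allowed and makes it negative.\<close>

definition r :: int where "r = int q - int p"

lemma r: "of_int r = real q - real p" "r \<noteq> 0"
  using pq by (auto simp: r_def)

text \<open>The differentiated function is M / \<rho>^p - A. Because \<kappa> (p - 1) = -r, the term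
  from differentiating \<open>Phi\<close> cancels exactly the second summand of
  \<open>Psi_lower\<close>, and only the exponent \<kappa> - 1 is left.\<close>

lemma W_deriv:
  assumes \<rho>: "\<rho> \<in> J" "\<rho> \<noteq> 0"
  shows "((\<lambda>\<rho>. \<rho> powi r * Phi \<beta> \<kappa> \<rho>) has_real_derivative
    (of_int r * \<rho> powi (r - 1)) * Phi \<beta> (\<kappa> - 1) \<rho>) (at \<rho>)"
proof -
  define H where "H = Psi (\<lambda>t. h \<beta> t * G t) (\<kappa> - 1) (\<rho> ^ (p - 1))"
  have "((\<lambda>\<rho>. \<rho> powi r) has_real_derivative of_int r * \<rho> powi (r - 1)) (at \<rho>)"
    using \<rho>(2) by (auto intro!: derivative_eq_intros)
  from DERIV_mult[OF this Phi_deriv[OF \<rho>(1), of \<beta> \<kappa>]]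
  have "((\<lambda>\<rho>. \<rho> powi r * Phi \<beta> \<kappa> \<rho>) has_real_derivative
    of_int r * \<rho> powi (r - 1) * Phi \<beta> \<kappa> \<rho> + \<kappa> * H * (real (p - 1) * \<rho> ^ (p - 2)) * \<rho> powi r) (at \<rho>)"
    by (simp add: H_def)
  moreover have "\<rho> powi r = \<rho> * \<rho> powi (r - 1)"
    using \<rho>(2) by (simp add: power_int_diff)
  moreover have "\<rho> * \<rho> ^ (p - 2) = \<rho> ^ (p - 1)"
    using p by (metis Suc_1 Suc_diff_Suc Suc_le_lessD diff_Suc_1 power_Suc)
  moreover have "Phi \<beta> \<kappa> \<rho> = Phi \<beta> (\<kappa> - 1) \<rho> + \<rho> ^ (p - 1) * H"
    unfolding Phi_def H_def by (rule Psi_lower[OF h_cont]) (use \<rho>(1) in \<open>simp add: J_def\<close>)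
  moreover have "\<kappa> * real (p - 1) = - of_int r" using kappa(3) r(1) by linarith
  ultimately show ?thesis
  proof -
    assume d: "((\<lambda>\<rho>. \<rho> powi r * Phi \<beta> \<kappa> \<rho>) has_real_derivative
      of_int r * \<rho> powi (r - 1) * Phi \<beta> \<kappa> \<rho> + \<kappa> * H * (real (p - 1) * \<rho> ^ (p - 2)) * \<rho> powi r) (at \<rho>)"
      and 1: "\<rho> powi r = \<rho> * \<rho> powi (r - 1)" and 2: "\<rho> * \<rho> ^ (p - 2) = \<rho> ^ (p - 1)"
      and 3: "Phi \<beta> \<kappa> \<rho> = Phi \<beta> (\<kappa> - 1) \<rho> + \<rho> ^ (p - 1) * H" and 4: "\<kappa> * real (p - 1) = - of_int r"
    have "\<kappa> * H * (real (p - 1) * \<rho> ^ (p - 2)) * \<rho> powi r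
        = (\<kappa> * real (p - 1)) * H * (\<rho> * \<rho> ^ (p - 2)) * \<rho> powi (r - 1)"
      unfolding 1 by (simp only: mult_ac)
    also have "\<dots> = - of_int r * \<rho> powi (r - 1) * (\<rho> ^ (p - 1) * H)"
      unfolding 2 4 by (simp only: mult_ac)
    finally show ?thesis
      using d by (simp add: 3 algebra_simps)
  qed
qed

lemma M_factor: "\<rho> \<noteq> 0 \<Longrightarrow> M A \<beta> \<rho> = \<rho> ^ p * (A + \<rho> powi r * Phi \<beta> \<kappa> \<rho>)"
proof -
  assume "\<rho> \<noteq> 0"
  then have "\<rho> ^ p * \<rho> powi r = \<rho> ^ q"
    by (simp add: r_def power_int_diff)
  then show ?thesis by (simp add: M_def algebra_simps flip: mult.assoc)
qed

lemma W_Ck: "I \<subseteq> J \<Longrightarrow> 0 \<notin> I \<Longrightarrow> Ck k I (\<lambda>\<rho>. A + \<rho> powi r * Phi \<beta> \<kappa> \<rho>)"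
  by (intro Ck_add Ck_mult Ck_const Ck_power_int Ck_subset[OF Phi_Ck])

lemma M_zeros_step:
  assumes I: "open I" "is_interval I" "I \<subseteq> J" "0 \<notin> I" and z: "zeros_le {} (Phi \<beta> (\<kappa> - 1)) I k"
  shows "zeros_le {} (M A \<beta>) I (Suc k)"
proof -
  have "zeros_le {} (\<lambda>\<rho>. A + \<rho> powi r * Phi \<beta> \<kappa> \<rho>) (I - {}) (Suc k)"
  proof (rule zeros_le_Rolle[OF I(1,2) _ _ _ _ _ _ z])
    show "\<forall>x\<in>I. ((\<lambda>\<rho>. A + \<rho> powi r * Phi \<beta> \<kappa> \<rho>) has_real_derivative
      (of_int r * x powi (r - 1)) * Phi \<beta> (\<kappa> - 1) x) (at x)"
    proof
      fix x assume "x \<in> I"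
      then have "x \<in> J" "x \<noteq> 0" using I by auto
      from DERIV_add[OF DERIV_const W_deriv[OF this]]
      show "((\<lambda>\<rho>. A + \<rho> powi r * Phi \<beta> \<kappa> \<rho>) has_real_derivative
        (of_int r * x powi (r - 1)) * Phi \<beta> (\<kappa> - 1) x) (at x)" by simp
    qed
    show "Ck k I (\<lambda>\<rho>. of_int r * \<rho> powi (r - 1))" for k
      by (intro Ck_mult Ck_const Ck_power_int I(4))
    show "Ck k I (Phi \<beta> (\<kappa> - 1))" for k by (rule Ck_subset[OF Phi_Ck I(3)])
    show "of_int r * x powi (r - 1) \<noteq> 0" if "x \<in> I - {}" for x
      using that I(4) r(2) by auto
  qed auto
  then have "zeros_le {} (\<lambda>\<rho>. \<rho> ^ p * (A + \<rho> powi r * Phi \<beta> \<kappa> \<rho>)) I (Suc k)"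
    using I by (intro zeros_le_factor[OF I(1) order_refl Ck_power W_Ck]) auto
  then show ?thesis
    by (rule zeros_le_cong[OF I(1) order_refl, rotated]) (use I(4) M_factor in metis)
qed

lemma sides: "open (J \<inter> {0<..})" "is_interval (J \<inter> {0<..})" "open (J \<inter> {..<0})" "is_interval (J \<inter> {..<0})"
  using open_J interval_J by (auto intro!: is_interval_Int)

lemma M_zeros_trivial:
  assumes "\<not> nontriv \<beta>" "A \<noteq> 0"
  shows "zeros_le {} (M A \<beta>) (J - {0}) 0"
proof -
  have "h \<beta> = (\<lambda>t. 0)" using assms(1) by (auto simp: h_def nontriv_def)
  then have "M A \<beta> \<rho> = A * \<rho> ^ p" for \<rho> by (simp add: M_def Phi_def Psi_def)
  then have "M A \<beta> \<rho> \<noteq> 0" if "\<rho> \<noteq> 0" for \<rho> using that assms(2) by simp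
  then have "\<mu> x = 0" if "x \<in> J - {0}" "vanish (M A \<beta>) x (\<mu> x)" for x and \<mu> :: "real \<Rightarrow> nat"
    using vanish_mono[OF that(2), of "Suc 0"] that(1) by (cases "\<mu> x") auto
  then show ?thesis unfolding zeros_le_def by (simp add: subset_iff)
qed

lemma M_zeros_side:
  assumes "nontriv \<beta> \<or> A \<noteq> 0" "I = J \<inter> {0<..} \<or> I = J \<inter> {..<0}"
  shows "zeros_le {} (M A \<beta>) I (l + 1)"
proof (cases "nontriv \<beta>")
  case True
  have "open I" "is_interval I" "I \<subseteq> J" "0 \<notin> I" using assms(2) sides by auto
  from M_zeros_step[OF this Phi_zeros_side[OF True kappa_not_nat(2) assms(2)]]
  show ?thesis by simp
next
  case False
  then have "zeros_le {} (M A \<beta>) (J - {0}) 0" using M_zeros_trivial assms(1) by simp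
  then show ?thesis by (rule zeros_le_mono) (use assms(2) in auto)
qed

text \<open>The zeros of \<open>Phi\<close> on the two half-lines number at most l together; Rolle's
  theorem on each half-line then adds one per side.\<close>

lemma M_zeros_even_total:
  assumes "nontriv \<beta> \<or> A \<noteq> 0" "even p"
  shows "zeros_le {} (M A \<beta>) (J - {0}) (l + 2)"
proof (cases "nontriv \<beta>")
  case True
  have "zeros_le {0} (Phi \<beta> (\<kappa> - 1)) (J - {0}) l"
    by (rule zeros_le_mono[OF Phi_zeros_even[OF True kappa_not_nat(2) assms(2)]]) auto
  then have "zeros_le {} (Phi \<beta> (\<kappa> - 1)) ((J \<inter> {0<..}) \<union> (J \<inter> {..<0})) l"
    unfolding J_split(1)[symmetric] by (rule zeros_le_empty_exc) auto
  from zeros_le_split[OF this J_split(2)] obtain i j where ij: "i + j \<le> l"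
    "zeros_le {} (Phi \<beta> (\<kappa> - 1)) (J \<inter> {0<..}) i" "zeros_le {} (Phi \<beta> (\<kappa> - 1)) (J \<inter> {..<0}) j" .
  have "zeros_le {} (M A \<beta>) (J \<inter> {0<..}) (Suc i)"
    by (rule M_zeros_step[OF sides(1,2) _ _ ij(2)]) auto
  moreover have "zeros_le {} (M A \<beta>) (J \<inter> {..<0}) (Suc j)"
    by (rule M_zeros_step[OF sides(3,4) _ _ ij(3)]) auto
  ultimately have "zeros_le {} (M A \<beta>) (J - {0}) (Suc i + Suc j)"
    unfolding J_split(1) by (rule zeros_le_union)
  then show ?thesis by (rule zeros_le_mono) (use ij(1) in auto)
next
  case False
  then have "zeros_le {} (M A \<beta>) (J - {0}) 0" using M_zeros_trivial assms(1) by simp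
  then show ?thesis by (rule zeros_le_mono) auto
qed

text \<open>For \<open>p < q\<close> the quotient \<open>M / \<rho>\<^sup>p\<close> extends across \<open>0\<close>, so that Rolle's theorem applies on all of \<open>J\<close>.\<close>

lemma M_zeros_even_odd:
  assumes "nontriv \<beta> \<or> A \<noteq> 0" "even p" "odd q" "p < q"
  shows "zeros_le {} (M A \<beta>) (J - {0}) (l + 1)"
proof (cases "nontriv \<beta>")
  case True
  define d where "d = q - p"
  have d: "d \<ge> 1" "even (d - 1)" "real d = real q - real p" "r = int d"
    using assms(2-4) by (auto simp: d_def r_def)
  define N where "N = (\<lambda>\<rho>. A + \<rho> ^ d * Phi \<beta> \<kappa> \<rho>)"
  have N': "(N has_real_derivative (real d * \<rho> ^ (d - 1)) * Phi \<beta> (\<kappa> - 1) \<rho>) (at \<rho>)" if \<rho>: "\<rho> \<in> J" for \<rho>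
  proof (cases "\<rho> = 0")
    case False
    have "int d - 1 = int (d - 1)" using d(1) by simp
    then have "\<rho> powi (r - 1) = \<rho> ^ (d - 1)" unfolding d(4) by (metis power_int_of_nat)
    moreover have "x powi r = x ^ d" for x :: real unfolding d(4) by (rule power_int_of_nat)
    ultimately show ?thesis
      using DERIV_add[OF DERIV_const[of A] W_deriv[OF \<rho> False, of \<beta>]] d(4) by (simp add: N_def)
  next
    case True
    have pw: "((\<lambda>\<rho>::real. \<rho> ^ d) has_real_derivative real d * \<rho> ^ (d - 1)) (at \<rho>)"
      by (auto intro!: derivative_eq_intros)
    have s0: "\<rho> ^ (p - 1) = 0" "\<rho> ^ d = 0" using True p d(1) by auto
    \<comment> \<open>At \<rho> = 0 the weight is 1 for every exponent, and \<rho>^d = 0 removes the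
      term with the derivative of \<open>Phi\<close>, so the formula extends to 0.\<close>
    have "Phi \<beta> \<kappa> \<rho> = Phi \<beta> (\<kappa> - 1) \<rho>"
      unfolding Phi_def s0 by (simp add: Psi_zero)
    then show ?thesis
      using DERIV_add[OF DERIV_const[of A] DERIV_mult[OF pw Phi_deriv[OF \<rho>, of \<beta> \<kappa>]]] s0(2)
      by (simp add: N_def)
  qed
  have "zeros_le {} N (J - {0}) (Suc l)"
  proof (rule zeros_le_Rolle[OF open_J interval_J _ _ _ _ _ _ Phi_zeros_even[OF True kappa_not_nat(2) assms(2)]])
    show "\<forall>x\<in>J. (N has_real_derivative (real d * x ^ (d - 1)) * Phi \<beta> (\<kappa> - 1) x) (at x)"
      using N' by blast
    show "Ck k J (\<lambda>x. real d * x ^ (d - 1))" for k by (intro Ck_mult Ck_const Ck_power)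
    \<comment> \<open>Here p even and q odd enter: d is odd, so \<rho>^(d-1) is nonnegative on both
      sides of 0.\<close>
    show "{0} = {} \<or> (\<forall>x\<in>J. 0 \<le> real d * x ^ (d - 1))" using d(2) by (simp add: zero_le_even_power)
  qed (use d(1) in \<open>auto intro: Phi_Ck\<close>)
  moreover have NC: "Ck k J N" for k
    unfolding N_def by (intro Ck_add Ck_mult Ck_const Ck_power Phi_Ck)
  ultimately have "zeros_le {} (\<lambda>\<rho>. \<rho> ^ p * N \<rho>) (J - {0}) (Suc l)"
    by (intro zeros_le_factor[OF open_J _ Ck_power NC]) auto
  moreover have "\<rho> ^ p * N \<rho> = M A \<beta> \<rho>" for \<rho>
  proof -
    have "\<rho> ^ p * \<rho> ^ d = \<rho> ^ q" using assms(4) by (simp add: d_def flip: power_add)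
    then show ?thesis by (simp add: N_def M_def algebra_simps flip: mult.assoc)
  qed
  ultimately show ?thesis by simp
next
  case False
  then have "zeros_le {} (M A \<beta>) (J - {0}) 0" using M_zeros_trivial assms(1) by simp
  then show ?thesis by (rule zeros_le_mono) auto
qed

text \<open>With A = 0 no Rolle step is spent, and each half-line keeps the bound l of
  \<open>Phi\<close>.\<close>

lemma M0_zeros:
  assumes "nontriv \<beta>"
  shows "zeros_le {} (M 0 \<beta>) (J - {0}) (2 * l)"
proof -
  have "zeros_le {} (M 0 \<beta>) I l" if "I = J \<inter> {0<..} \<or> I = J \<inter> {..<0}" for I
  proof -
    have "zeros_le {} (\<lambda>\<rho>. \<rho> ^ q * Phi \<beta> \<kappa> \<rho>) I l"
      by (rule zeros_le_factor[OF open_J _ Ck_power Phi_Ck _ Phi_zeros_side[OF assms kappa_not_nat(1) that]])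
        (use that in auto)
    then show ?thesis by (simp add: M_def[abs_def])
  qed
  then have "zeros_le {} (M 0 \<beta>) ((J \<inter> {0<..}) \<union> (J \<inter> {..<0})) (l + l)"
    by (intro zeros_le_union) auto
  then show ?thesis unfolding J_split(1) by (simp add: mult_2)
qed

lemma Phi_even: "odd p \<Longrightarrow> Phi \<beta> a (- \<rho>) = Phi \<beta> a \<rho>"
  by (simp add: Phi_def)

text \<open>Writing \<open>M = \<rho>\<^sup>p (A + W)\<close> for \<open>\<rho> > 0\<close>, the zeros on the negative axis are those of \<open>A - W\<close>. Both are
  counted at once by Rolle's theorem for \<open>W\<^sup>2 - A\<^sup>2\<close>, whose derivative is \<open>2 W W'\<close>.\<close>

lemma M_zeros_odd_even:
  assumes "nontriv \<beta> \<or> A \<noteq> 0" "odd p" "even q"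
  shows "zeros_le {} (M A \<beta>) (J - {0}) (2 * l + 1)"
proof (cases "nontriv \<beta>")
  case False
  then have "zeros_le {} (M A \<beta>) (J - {0}) 0" using M_zeros_trivial assms(1) by simp
  then show ?thesis by (rule zeros_le_mono) auto
next
  case True
  show ?thesis
  proof (cases "A = 0")
    case A: True
    show ?thesis unfolding A by (rule zeros_le_mono[OF M0_zeros[OF True]]) auto
  next
    case A: False
    define I where "I = {0 <..} \<inter> J"
    have I: "open I" "is_interval I" "I \<subseteq> J" "0 \<notin> I" "I = J \<inter> {0<..} \<or> I = J \<inter> {..<0}"
      using sides(1,2) by (auto simp: I_def Int_commute)
    define W where "W = (\<lambda>\<rho>. \<rho> powi r * Phi \<beta> \<kappa> \<rho>)"
    have WC: "Ck k I (\<lambda>\<rho>. c + W \<rho>)" for k c unfolding W_def by (rule W_Ck[OF I(3,4)])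
    have W': "(W has_real_derivative (of_int r * \<rho> powi (r - 1)) * Phi \<beta> (\<kappa> - 1) \<rho>) (at \<rho>)"
      if "\<rho> \<in> I" for \<rho>
      unfolding W_def by (rule W_deriv) (use that I in auto)
    \<comment> \<open>Up to a factor without zeros the derivative is the product of
      \<open>Phi\<close> with exponents \<kappa> and \<kappa> - 1, each with at most l zeros on the
      half-line; one application of Rolle gives 2 l + 1.\<close>
    have "zeros_le {} (\<lambda>\<rho>. (A + W \<rho>) * (- A + W \<rho>)) (I - {}) (Suc (l + l))"
    proof (rule zeros_le_Rolle[OF I(1,2)])
      show "\<forall>x\<in>I. ((\<lambda>\<rho>. (A + W \<rho>) * (- A + W \<rho>)) has_real_derivative
        (2 * of_int r * (x powi r * x powi (r - 1))) * (Phi \<beta> \<kappa> x * Phi \<beta> (\<kappa> - 1) x)) (at x)"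
      proof
        fix x assume "x \<in> I"
        note d = W'[OF this]
        from DERIV_mult[OF DERIV_add[OF DERIV_const[of A] d] DERIV_add[OF DERIV_const[of "-A"] d]]
        show "((\<lambda>\<rho>. (A + W \<rho>) * (- A + W \<rho>)) has_real_derivative
          (2 * of_int r * (x powi r * x powi (r - 1))) * (Phi \<beta> \<kappa> x * Phi \<beta> (\<kappa> - 1) x)) (at x)"
          by (rule DERIV_cong) (simp add: W_def algebra_simps)
      qed
      show "Ck k I (\<lambda>x. 2 * of_int r * (x powi r * x powi (r - 1)))" for k
        by (intro Ck_mult Ck_const Ck_power_int I(4))
      show "Ck k I (\<lambda>x. Phi \<beta> \<kappa> x * Phi \<beta> (\<kappa> - 1) x)" for k
        by (intro Ck_mult Ck_subset[OF Phi_Ck I(3)])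
      show "2 * of_int r * (x powi r * x powi (r - 1)) \<noteq> 0" if "x \<in> I - {}" for x
        using that I(4) r(2) by auto
      show "zeros_le {} (\<lambda>x. Phi \<beta> \<kappa> x * Phi \<beta> (\<kappa> - 1) x) I (l + l)"
        by (rule zeros_le_mult[OF open_J I(3) Phi_Ck Phi_Ck Phi_zeros_side[OF True kappa_not_nat(1) I(5)]
              Phi_zeros_side[OF True kappa_not_nat(2) I(5)]])
    qed auto
    then have "zeros_le {} (\<lambda>\<rho>. (A + W \<rho>) * (- A + W \<rho>)) I (Suc (l + l))" by simp
    \<comment> \<open>The two factors differ by the nonzero constant 2 A and so have no common
      zero.\<close>
    then obtain i j where ij: "i + j \<le> Suc (l + l)"
      "zeros_le {} (\<lambda>\<rho>. A + W \<rho>) I i" "zeros_le {} (\<lambda>\<rho>. - A + W \<rho>) I j"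
      using zeros_le_mult_split[OF I(1) order_refl WC WC, of A "-A"] A by auto
    have "zeros_le {} (\<lambda>\<rho>. \<rho> ^ p * (A + W \<rho>)) I i"
      by (rule zeros_le_factor[OF I(1) order_refl Ck_power WC _ ij(2)]) (use I(4) in auto)
    then have pos: "zeros_le {} (M A \<beta>) (J \<inter> {0<..}) i"
      using zeros_le_cong[OF I(1) order_refl, of _ "M A \<beta>"] M_factor I(4) unfolding I_def W_def
      by (metis (no_types, lifting) Int_commute)
    have "zeros_le {} (\<lambda>\<rho>. \<rho> ^ p * (- A + W \<rho>)) I j"
      by (rule zeros_le_factor[OF I(1) order_refl Ck_power WC _ ij(3)]) (use I(4) in auto)
    \<comment> \<open>The reflection changes the sign of \<rho>^p but not that of \<rho>^q or
      \<open>Phi\<close>, so the second factor describes the negative half-line.\<close>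
    moreover have "\<rho> ^ p * (- A + W \<rho>) = M A \<beta> (- \<rho>)" if "\<rho> \<in> I" for \<rho>
    proof -
      have "\<rho> \<noteq> 0" using that I(4) by auto
      then have "\<rho> ^ p * \<rho> powi r = \<rho> ^ q" by (simp add: r_def power_int_diff)
      then show ?thesis
        using assms(2,3) by (simp add: M_def W_def Phi_even algebra_simps flip: mult.assoc)
    qed
    ultimately have "zeros_le {} (\<lambda>\<rho>. M A \<beta> (- \<rho>)) I j"
      by (rule zeros_le_cong[OF I(1) order_refl, rotated])
    moreover have "Ck k I (\<lambda>\<rho>. M A \<beta> (- \<rho>))" for k
      by (rule Ck_compose[OF M_Ck, of k I uminus])
        (use Ck_mult[OF Ck_const[of k I "-1"] Ck_ident] odd_J[OF assms(2)] in auto)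
    ultimately have "zeros_le {} (\<lambda>\<rho>. (\<lambda>\<rho>. M A \<beta> (- \<rho>)) (- \<rho>)) (J \<inter> {..<0}) j"
      by (intro zeros_le_compose[OF I(1) sides(3), where f' = "\<lambda>_. -1"])
        (auto simp: I_def odd_J[OF assms(2)] intro!: derivative_eq_intros Ck_const)
    then have "zeros_le {} (M A \<beta>) (J - {0}) (i + j)"
      unfolding J_split(1) using pos by (intro zeros_le_union) auto
    then show ?thesis by (rule zeros_le_mono) (use ij(1) in auto)
  qed
qed

section \<open>Configurations that attain the bounds\<close>

lemma Phi_interpolation:
  assumes "S' \<subseteq> S" "finite X" "X \<subseteq> J" "card X < card S'"
  obtains \<beta> where "nontriv \<beta>" "\<And>i. i \<notin> S' \<Longrightarrow> \<beta> i = 0" "\<And>\<rho>. \<rho> \<in> X \<Longrightarrow> Phi \<beta> a \<rho> = 0"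
proof -
  have fin: "finite S'" using S(1) assms(1) finite_subset by blast
  from nontrivial_combination[OF assms(2) fin assms(4), of "\<lambda>i \<rho>. Psi (e i) a (\<rho> ^ (p - 1))"]
  obtain \<alpha> where \<alpha>: "\<exists>i\<in>S'. \<alpha> i \<noteq> 0" "\<And>\<rho>. \<rho> \<in> X \<Longrightarrow> (\<Sum>i\<in>S'. \<alpha> i * Psi (e i) a (\<rho> ^ (p - 1))) = 0"
    by blast
  define \<beta> where "\<beta> = (\<lambda>i. if i \<in> S' then \<alpha> i else 0)"
  show ?thesis
  proof (rule that[of \<beta>])
    show "nontriv \<beta>" using \<alpha>(1) assms(1) by (auto simp: nontriv_def \<beta>_def)
    show "\<beta> i = 0" if "i \<notin> S'" for i using that by (simp add: \<beta>_def)
    fix \<rho> assume \<rho>: "\<rho> \<in> X"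
    have "\<rho> ^ (p - 1) \<in> D" using \<rho> assms(3) by (auto simp: J_def)
    then have "Phi \<beta> a \<rho> = (\<Sum>i\<in>S. \<beta> i * Psi (e i) a (\<rho> ^ (p - 1)))"
      unfolding Phi_def by (rule Psi_h)
    also have "\<dots> = (\<Sum>i\<in>S'. \<alpha> i * Psi (e i) a (\<rho> ^ (p - 1)))"
      by (rule sum.mono_neutral_cong_right) (use S(1) assms(1) in \<open>auto simp: \<beta>_def\<close>)
    also have "\<dots> = 0" by (rule \<alpha>(2)[OF \<rho>])
    finally show "Phi \<beta> a \<rho> = 0" .
  qed
qed

lemma M_interpolation:
  assumes "finite X" "X \<subseteq> J" "card X \<le> l + 1"
  obtains A \<beta> where "nontriv \<beta> \<or> A \<noteq> 0" "\<And>\<rho>. \<rho> \<in> X \<Longrightarrow> M A \<beta> \<rho> = 0"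
proof -
  \<comment> \<open>The index \<open>None\<close> stands for the coefficient A, which gives l + 2
    unknowns for at most l + 1 points.\<close>
  define S' where "S' = insert None (Some ` S)"
  have S': "finite S'" "card S' = l + 2"
    using S by (auto simp: S'_def card_image)
  define g where "g = (\<lambda>i \<rho>. case i of None \<Rightarrow> \<rho> ^ p | Some i \<Rightarrow> \<rho> ^ q * Psi (e i) \<kappa> (\<rho> ^ (p - 1)))"
  have "card X < card S'" using assms(3) S'(2) by simp
  from nontrivial_combination[OF assms(1) S'(1) this, of g]
  obtain \<alpha> where \<alpha>: "\<exists>i\<in>S'. \<alpha> i \<noteq> 0" "\<And>\<rho>. \<rho> \<in> X \<Longrightarrow> (\<Sum>i\<in>S'. \<alpha> i * g i \<rho>) = 0"
    by blast
  show ?thesis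
  proof (rule that[of "\<lambda>i. \<alpha> (Some i)" "\<alpha> None"])
    show "nontriv (\<lambda>i. \<alpha> (Some i)) \<or> \<alpha> None \<noteq> 0" using \<alpha>(1) by (auto simp: S'_def nontriv_def)
    fix \<rho> assume \<rho>: "\<rho> \<in> X"
    have D: "\<rho> ^ (p - 1) \<in> D" using \<rho> assms(2) by (auto simp: J_def)
    have "M (\<alpha> None) (\<lambda>i. \<alpha> (Some i)) \<rho> = \<alpha> None * g None \<rho> + (\<Sum>i\<in>S. \<alpha> (Some i) * g (Some i) \<rho>)"
      unfolding M_def Phi_def Psi_h[OF D] by (simp add: g_def sum_distrib_left mult_ac)
    also have "\<dots> = (\<Sum>i\<in>S'. \<alpha> i * g i \<rho>)"
      using S(1) by (simp add: S'_def sum.reindex)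
    also have "\<dots> = 0" by (rule \<alpha>(2)[OF \<rho>])
    finally show "M (\<alpha> None) (\<lambda>i. \<alpha> (Some i)) \<rho> = 0" .
  qed
qed

text \<open>A concrete choice of k positive points; the positive half-line always lies in J.\<close>

definition pts :: "nat \<Rightarrow> real set" where "pts k = real ` {1..k}"

lemma pts: "finite (pts k)" "card (pts k) = k" "pts k \<subseteq> J - {0}" "pts k \<subseteq> J" "pts k \<subseteq> {0<..}"
  using pos_J by (auto simp: pts_def card_image)

lemma M_interpolation_pts:
  obtains A \<beta> where "nontriv \<beta> \<or> A \<noteq> 0" "\<And>\<rho>. \<rho> \<in> pts (l + 1) \<Longrightarrow> M A \<beta> \<rho> = 0"
proof -
  have "card (pts (l + 1)) \<le> l + 1" using pts(2) by simp
  from M_interpolation[OF pts(1,4) this] show ?thesis using that by metis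
qed

text \<open>Restricting the support to S' permits \<beta> 0 = 0 to be imposed at the price of one
  point.\<close>

lemma Phi_interpolation_pts:
  assumes "S' \<subseteq> S" "k < card S'"
  obtains \<beta> where "nontriv \<beta>" "\<And>i. i \<notin> S' \<Longrightarrow> \<beta> i = 0" "\<And>\<rho>. \<rho> \<in> pts k \<Longrightarrow> Phi \<beta> \<kappa> \<rho> = 0"
proof -
  have "card (pts k) < card S'" using pts(2) assms(2) by simp
  from Phi_interpolation[OF assms(1) pts(1,4) this, of \<kappa>] show ?thesis using that by metis
qed

lemma pts_symmetric: "finite (pts k \<union> uminus ` pts k)" "card (pts k \<union> uminus ` pts k) = 2 * k"
  "odd p \<Longrightarrow> pts k \<union> uminus ` pts k \<subseteq> J - {0}"
proof -
  have "card (pts k \<union> uminus ` pts k) = card (pts k) + card (uminus ` pts k)"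
    by (rule card_Un_disjoint) (use pts in \<open>auto simp: pts_def\<close>)
  also have "card (uminus ` pts k) = card (pts k)" by (rule card_image) simp
  finally show "card (pts k \<union> uminus ` pts k) = 2 * k" using pts(2) by simp
qed (use pts odd_J in \<open>auto simp: pts_def\<close>)

lemma attained:
  assumes "zeros_le {} (M A \<beta>) (J - {0}) N" "finite X" "X \<subseteq> J - {0}" "card X = N"
    "\<And>\<rho>. \<rho> \<in> X \<Longrightarrow> M A \<beta> \<rho> = 0"
  shows "card (simple_zeros (M A \<beta>) (J - {0})) = N"
  using simple_zeros_eq(1)[of "M A \<beta>" "J - {0}" X] assms by simp

text \<open>M is an odd function, so l + 1 prescribed positive zeros are mirrored, and the bounds of
  both sides are reached together.\<close>

lemma attained_odd_odd:
  assumes "odd p" "odd q"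
  shows "\<exists>A \<beta>. card (simple_zeros (M A \<beta>) (J - {0})) = 2 * (l + 1)"
proof -
  obtain A \<beta> where M: "nontriv \<beta> \<or> A \<noteq> 0" "\<And>\<rho>. \<rho> \<in> pts (l + 1) \<Longrightarrow> M A \<beta> \<rho> = 0"
    by (rule M_interpolation_pts) blast
  have "M A \<beta> (- \<rho>) = - M A \<beta> \<rho>" for \<rho>
    using assms by (simp add: M_def Phi_even)
  then have zero: "M A \<beta> \<rho> = 0" if "\<rho> \<in> pts (l + 1) \<union> uminus ` pts (l + 1)" for \<rho>
    using that M(2) by auto
  have "zeros_le {} (M A \<beta>) (J - {0}) (2 * (l + 1))"
    unfolding J_split(1) mult_2 using M_zeros_side[OF M(1)] by (intro zeros_le_union) auto
  from attained[OF this pts_symmetric(1) pts_symmetric(3)[OF assms(1)] pts_symmetric(2) zero]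
  show ?thesis by blast
qed

text \<open>With A = 0 the function is \<rho>^q times the even function \<open>Phi\<close>, so l
  prescribed positive zeros are mirrored.\<close>

lemma attained_odd_even_gt:
  assumes "odd p"
  shows "\<exists>A \<beta>. card (simple_zeros (M A \<beta>) (J - {0})) = 2 * l"
proof -
  obtain \<beta> where \<beta>: "nontriv \<beta>" "\<And>\<rho>. \<rho> \<in> pts l \<Longrightarrow> Phi \<beta> \<kappa> \<rho> = 0"
    using Phi_interpolation_pts[OF order_refl, of l] S(3) lessI by metis
  have zero: "M 0 \<beta> \<rho> = 0" if "\<rho> \<in> pts l \<union> uminus ` pts l" for \<rho>
    using that \<beta>(2) assms by (auto simp: M_def Phi_even)
  from attained[OF M0_zeros[OF \<beta>(1)] pts_symmetric(1) pts_symmetric(3)[OF assms] pts_symmetric(2) zero]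
  show ?thesis by blast
qed

lemma attained_even_odd:
  assumes "even p" "odd q" "p < q"
  shows "\<exists>A \<beta>. card (simple_zeros (M A \<beta>) (J - {0})) = l + 1"
proof -
  obtain A \<beta> where M: "nontriv \<beta> \<or> A \<noteq> 0" "\<And>\<rho>. \<rho> \<in> pts (l + 1) \<Longrightarrow> M A \<beta> \<rho> = 0"
    by (rule M_interpolation_pts) blast
  from attained[OF M_zeros_even_odd[OF M(1) assms] pts(1,3,2) M(2)] show ?thesis by blast
qed

text \<open>The prescribed zeros exhaust the bound l for \<open>Psi\<close>, hence they are simple
  and there is no other. In the last variant \<beta> 0 = 0 makes 0 one of them, so one point fewer
  is prescribed.\<close>

lemma Psi_simple_zeros:
  assumes "nontriv \<beta>" "finite X" "X \<subseteq> {0<..}" "\<And>\<rho>. \<rho> \<in> X \<Longrightarrow> Phi \<beta> \<kappa> \<rho> = 0"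
  shows "card X = l \<Longrightarrow> Phi \<beta> \<kappa> 0 \<noteq> 0"
    "card X = l \<Longrightarrow> \<rho> \<in> X \<Longrightarrow> deriv (Psi (h \<beta>) \<kappa>) (\<rho> ^ (p - 1)) \<noteq> 0"
    "Suc (card X) = l \<Longrightarrow> \<beta> 0 = 0 \<Longrightarrow> \<rho> \<in> X \<union> {0} \<Longrightarrow> deriv (Psi (h \<beta>) \<kappa>) (\<rho> ^ (p - 1)) \<noteq> 0"
proof -
  define Z where "Z = (\<lambda>x. x ^ (p - 1)) ` X"
  have p1: "p - 1 > 0" using p by simp
  have "inj_on (\<lambda>x. x ^ (p - 1)) X"
  proof (rule inj_onI)
    fix x y assume "x \<in> X" "y \<in> X" "x ^ (p - 1) = y ^ (p - 1)"
    then show "x = y" using power_eq_iff_eq_base[OF p1, of x y] assms(3) by (auto simp: subset_iff less_imp_le)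
  qed
  then have Z: "finite Z" "card Z = card X" "Z \<subseteq> D" "0 \<notin> Z"
    using assms(2,3) by (auto simp: Z_def card_image subset_iff intro!: zero_D less_imp_le)
  have Z0: "Psi (h \<beta>) \<kappa> s = 0" if "s \<in> Z" for s
    using that assms(4) by (auto simp: Z_def Phi_def)
  note bound = Psi_h_zeros_le[OF assms(1) kappa_not_nat(1)]
  have p0: "(0::real) ^ (p - 1) = 0" using p by simp
  show "Phi \<beta> \<kappa> 0 \<noteq> 0" if "card X = l"
  proof
    assume "Phi \<beta> \<kappa> 0 = 0"
    then have "Psi (h \<beta>) \<kappa> 0 = 0" unfolding Phi_def p0 .
    then have "insert 0 Z \<subseteq> {s\<in>D. Psi (h \<beta>) \<kappa> s = 0}"
      using Z Z0 zero_D[of 0] by auto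
    from card_mono[OF zeros_le_finite(1)[OF bound] this] zeros_le_finite(2)[OF bound]
    show False using Z that by simp
  qed
  show "deriv (Psi (h \<beta>) \<kappa>) (\<rho> ^ (p - 1)) \<noteq> 0" if "card X = l" "\<rho> \<in> X"
    using simple_zeros_eq(2)[of "Psi (h \<beta>) \<kappa>" D Z] bound Z Z0 that by (auto simp: Z_def)
  show "deriv (Psi (h \<beta>) \<kappa>) (\<rho> ^ (p - 1)) \<noteq> 0" if "Suc (card X) = l" "\<beta> 0 = 0" "\<rho> \<in> X \<union> {0}"
  proof (rule simple_zeros_eq(2)[of "Psi (h \<beta>) \<kappa>" D "insert 0 Z"])
    show "zeros_le {} (Psi (h \<beta>) \<kappa>) D (card (insert 0 Z))" using bound Z that(1) by simp
    show "insert 0 Z \<subseteq> D" using Z zero_D[of 0] by auto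
    show "\<rho> ^ (p - 1) \<in> insert 0 Z" using that(3) p0 by (auto simp: Z_def)
    show "Psi (h \<beta>) \<kappa> x = 0" if "x \<in> insert 0 Z" for x
      using that Z0 Psi_h_zero[of \<beta> \<kappa>] \<open>\<beta> 0 = 0\<close> by auto
  qed (use Z in simp)
qed

lemma Phi_deriv_nonzero:
  assumes "\<rho> \<in> J - {0}" "deriv (Psi (h \<beta>) \<kappa>) (\<rho> ^ (p - 1)) \<noteq> 0"
  shows "\<exists>c. c \<noteq> 0 \<and> (Phi \<beta> \<kappa> has_real_derivative c) (at \<rho>)"
proof -
  have "\<rho> ^ (p - 1) \<in> D" using assms(1) by (simp add: J_def)
  from DERIV_imp_deriv[OF Psi_deriv[OF h_cont this]] assms
  show ?thesis using Phi_deriv[of \<rho> \<beta> \<kappa>] p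
    by (intro exI[of _ "\<kappa> * Psi (\<lambda>t. h \<beta> t * G t) (\<kappa> - 1) (\<rho> ^ (p - 1)) * (real (p - 1) * \<rho> ^ (p - 2))"]) auto
qed

lemma Phi_continuous: "continuous_on J (Phi \<beta> a)"
  by (rule Ck_continuous[OF Phi_Ck])

text \<open>For p < q one has M = \<rho>^p (A + \<rho>^(q-p) Phi). A small A of suitable sign
  preserves the sign changes of \<open>Phi\<close> and creates one zero near 0, or two if q - p is
  even.\<close>

lemma perturbed_zeros:
  assumes "p < q" "nontriv \<beta>" "Phi \<beta> \<kappa> 0 \<noteq> 0" "finite X" "X \<subseteq> J - {0}"
    and X: "\<And>\<rho>. \<rho> \<in> X \<Longrightarrow> Phi \<beta> \<kappa> \<rho> = 0"
      "\<And>\<rho>. \<rho> \<in> X \<Longrightarrow> deriv (Psi (h \<beta>) \<kappa>) (\<rho> ^ (p - 1)) \<noteq> 0"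
  obtains A X' where "finite X'" "X' \<subseteq> J - {0}" "card X' = card X + (if even (q - p) then 2 else 1)"
    "\<And>\<rho>. \<rho> \<in> X' \<Longrightarrow> M A \<beta> \<rho> = 0"
proof -
  have oJ: "open (J - {0})" using open_J by (simp add: open_Diff)
  obtain C where C: "sign_pairs (Phi \<beta> \<kappa>) (J - {0}) C" "card C = card X"
  proof (rule sign_pairs_simple_zeros[OF assms(4) oJ assms(5) X(1)])
    fix x assume "x \<in> X"
    then show "\<exists>c. c \<noteq> 0 \<and> (Phi \<beta> \<kappa> has_real_derivative c) (at x)"
      using Phi_deriv_nonzero X(2) assms(5) by blast
  qed blast+
  have "q - p \<ge> 1" using assms(1) by simp
  from sign_pairs_perturb[OF open_J pos_J[OF order_refl] Phi_continuous continuous_on_const[of J 1] assms(3) one_neq_zero this C(1)]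
  obtain A C' where C': "sign_pairs (\<lambda>x. A * 1 + x ^ (q - p) * Phi \<beta> \<kappa> x) (J - {0}) C'"
    "card C' = card C + (if even (q - p) then 2 else 1)" by blast
  have "continuous_on (J - {0}) (\<lambda>x. A * 1 + x ^ (q - p) * Phi \<beta> \<kappa> x)"
    by (intro continuous_intros continuous_on_subset[OF Phi_continuous]) auto
  from sign_pairs_zeros[OF C'(1) this] obtain X' where X': "finite X'" "card X' = card C'" "X' \<subseteq> J - {0}"
    "\<And>x. x \<in> X' \<Longrightarrow> A * 1 + x ^ (q - p) * Phi \<beta> \<kappa> x = 0" by blast
  have "M A \<beta> \<rho> = \<rho> ^ p * (A * 1 + \<rho> ^ (q - p) * Phi \<beta> \<kappa> \<rho>)" for \<rho>
  proof -
    have "\<rho> ^ p * \<rho> ^ (q - p) = \<rho> ^ q" using assms(1) by (simp flip: power_add)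
    then show ?thesis by (simp add: M_def algebra_simps flip: mult.assoc)
  qed
  then have "M A \<beta> \<rho> = 0" if "\<rho> \<in> X'" for \<rho> using X'(4)[OF that] by simp
  then show ?thesis using that[of X' A] X' C' C(2) by simp
qed

text \<open>\<open>Phi\<close> is even and provides 2 l symmetric zeros; since q - p is odd, turning
  on A adds one more.\<close>

lemma attained_odd_even_lt:
  assumes "odd p" "even q" "p < q"
  shows "\<exists>A \<beta>. card (simple_zeros (M A \<beta>) (J - {0})) = 2 * l + 1"
proof -
  obtain \<beta> where \<beta>: "nontriv \<beta>" "\<And>\<rho>. \<rho> \<in> pts l \<Longrightarrow> Phi \<beta> \<kappa> \<rho> = 0"
    using Phi_interpolation_pts[OF order_refl, of l] S(3) lessI by metis
  note simple = Psi_simple_zeros[OF \<beta>(1) pts(1,5) \<beta>(2)]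
  have ev: "even (p - 1)" using assms(1) by simp
  have "Phi \<beta> \<kappa> \<rho> = 0 \<and> deriv (Psi (h \<beta>) \<kappa>) (\<rho> ^ (p - 1)) \<noteq> 0" if "\<rho> \<in> pts l \<union> uminus ` pts l" for \<rho>
    using that \<beta>(2) simple(2)[OF _ pts(2)] Phi_even[OF assms(1)] ev by auto
  then obtain A X' where X': "finite X'" "X' \<subseteq> J - {0}"
    "card X' = card (pts l \<union> uminus ` pts l) + (if even (q - p) then 2 else 1)"
    "\<And>\<rho>. \<rho> \<in> X' \<Longrightarrow> M A \<beta> \<rho> = 0"
    using perturbed_zeros[OF assms(3) \<beta>(1) simple(1)[OF _ pts(2)] pts_symmetric(1) pts_symmetric(3)[OF assms(1)]]
    by (metis (no_types, lifting))
  have "card X' = 2 * l + 1" using X'(3) pts_symmetric(2) assms by simp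
  from attained[OF M_zeros_odd_even[OF disjI1[OF \<beta>(1)] assms(1,2)] X'(1,2) this X'(4)] show ?thesis by blast
qed

text \<open>Here q - p is even, so turning on A adds a zero on each side of 0 to the l zeros of
  \<open>Phi\<close>.\<close>

lemma attained_even_lt:
  assumes "even p" "even q" "p < q"
  shows "\<exists>A \<beta>. card (simple_zeros (M A \<beta>) (J - {0})) = l + 2"
proof -
  obtain \<beta> where \<beta>: "nontriv \<beta>" "\<And>\<rho>. \<rho> \<in> pts l \<Longrightarrow> Phi \<beta> \<kappa> \<rho> = 0"
    using Phi_interpolation_pts[OF order_refl, of l] S(3) lessI by metis
  note simple = Psi_simple_zeros[OF \<beta>(1) pts(1,5) \<beta>(2)]
  obtain A X' where X': "finite X'" "X' \<subseteq> J - {0}"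
    "card X' = card (pts l) + (if even (q - p) then 2 else 1)"
    "\<And>\<rho>. \<rho> \<in> X' \<Longrightarrow> M A \<beta> \<rho> = 0"
    using perturbed_zeros[OF assms(3) \<beta>(1) simple(1)[OF _ pts(2)] pts(1,3) \<beta>(2) simple(2)[OF _ pts(2)]]
    by metis
  have "card X' = l + 2" using X'(3) pts(2) assms by simp
  from attained[OF M_zeros_even_total[OF disjI1[OF \<beta>(1)] assms(1)] X'(1,2) this X'(4)] show ?thesis by blast
qed

text \<open>For \<open>p > q\<close> start from \<open>\<beta> 0 = 0\<close>, so that \<open>Phi\<close> vanishes at \<open>0\<close> like \<open>\<rho> ^ (p - 1)\<close>; turning on first \<open>A\<close> and
  then \<open>\<beta> 0\<close> creates three zeros near \<open>0\<close>, since exactly one of \<open>q - 1\<close> and \<open>p - q\<close> is even.\<close>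

lemma attained_even_gt:
  assumes "even p" "q < p"
  shows "\<exists>A \<beta>. card (simple_zeros (M A \<beta>) (J - {0})) = l + 2"
proof -
  \<comment> \<open>Without index 0 there are l unknowns, so l - 1 points can be prescribed;
    together with the automatic zero at 0 they exhaust the bound l.\<close>
  have "l - 1 < card (S - {0})" using S l by simp
  then obtain \<beta> where \<beta>: "nontriv \<beta>" "\<And>i. i \<notin> S - {0} \<Longrightarrow> \<beta> i = 0"
    "\<And>\<rho>. \<rho> \<in> pts (l - 1) \<Longrightarrow> Phi \<beta> \<kappa> \<rho> = 0"
    using Phi_interpolation_pts[OF Diff_subset] by metis
  have \<beta>0: "\<beta> 0 = 0" using \<beta>(2) by simp
  have card: "Suc (card (pts (l - 1))) = l" using pts(2) l by simp
  note simple = Psi_simple_zeros(3)[OF \<beta>(1) pts(1,5) \<beta>(3) card \<beta>0]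
  have oJ: "open (J - {0})" using open_J by (simp add: open_Diff)
  obtain C where C: "sign_pairs (Phi \<beta> \<kappa>) (J - {0}) C" "card C = card (pts (l - 1))"
  proof (rule sign_pairs_simple_zeros[OF pts(1) oJ pts(3) \<beta>(3)])
    fix x assume x: "x \<in> pts (l - 1)"
    show "\<exists>c. c \<noteq> 0 \<and> (Phi \<beta> \<kappa> has_real_derivative c) (at x)"
      by (rule Phi_deriv_nonzero[OF _ simple]) (use x pts(3) in auto)
  qed blast+
  define P where "P = Psi (h \<beta>) \<kappa>"
  \<comment> \<open>The quotient P s / s, continued at 0 by the derivative, which is nonzero because
    the zero at 0 is simple. Thus Phi = \<rho>^(p-1) u with u 0 \<noteq> 0.\<close>
  define R where "R = (\<lambda>s. if s = 0 then deriv P 0 else P s / s)"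
  have P0: "P 0 = 0" using Psi_h_zero[of \<beta> \<kappa>] \<beta>0 by (simp add: P_def)
  have p0: "(0::real) ^ (p - 1) = 0" using p by simp
  have R0: "R 0 \<noteq> 0" using simple[of 0, unfolded p0] by (simp add: R_def P_def)
  have R_cont: "continuous_on D R"
  proof (rule continuous_at_imp_continuous_on, rule ballI)
    fix s assume s: "s \<in> D"
    show "isCont R s"
    proof (cases "s = 0")
      case True
      have "(P has_real_derivative deriv P 0) (at 0)"
        using Psi_deriv[OF h_cont zero_D[OF order_refl], of \<beta> \<kappa>] DERIV_imp_deriv unfolding P_def by fastforce
      then have "((\<lambda>s. (P s - P 0) / (s - 0)) \<longlongrightarrow> deriv P 0) (at 0)"
        by (simp add: has_field_derivative_iff)
      then have "(R \<longlongrightarrow> deriv P 0) (at 0)"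
        by (rule Lim_transform_eventually) (auto simp: eventually_at_filter R_def P0)
      then show ?thesis unfolding True isCont_def by (simp add: R_def)
    next
      case False
      have "isCont P s" unfolding P_def by (rule DERIV_isCont[OF Psi_deriv[OF h_cont s]])
      then have "isCont (\<lambda>s. P s / s) s" using False by (intro continuous_intros) auto
      moreover have "\<forall>\<^sub>F y in nhds s. R y = P y / y"
        using t1_space_nhds[OF False] by eventually_elim (simp add: R_def)
      ultimately show ?thesis using isCont_cong[of R "\<lambda>s. P s / s" s] by simp
    qed
  qed
  define u where "u = (\<lambda>\<rho>. R (\<rho> ^ (p - 1)))"
  have u_cont: "continuous_on J u"
    unfolding u_def by (rule continuous_on_compose2[OF R_cont]) (auto intro!: continuous_intros simp: J_def)
  have u0: "u 0 \<noteq> 0" using R0 unfolding u_def p0 .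
  have Phi_u: "Phi \<beta> \<kappa> \<rho> = \<rho> ^ (p - 1) * u \<rho>" for \<rho>
  proof (cases "\<rho> = 0")
    case True
    have "Phi \<beta> \<kappa> 0 = 0" using P0 unfolding Phi_def p0 P_def .
    then show ?thesis unfolding True p0 by simp
  next
    case False
    then show ?thesis by (simp add: Phi_def u_def R_def P_def)
  qed
  have Cu: "sign_pairs u (J - {0}) C"
  proof (rule sign_pairs_transfer[OF C(1)])
    fix a b assume ab: "0 < a * b" "Phi \<beta> \<kappa> a * Phi \<beta> \<kappa> b < 0"
    have "Phi \<beta> \<kappa> a * Phi \<beta> \<kappa> b = (a * b) ^ (p - 1) * (u a * u b)"
      unfolding Phi_u power_mult_distrib by (simp only: mult_ac)
    then have "(a * b) ^ (p - 1) * (u a * u b) < 0" using ab(2) by simp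
    then show "u a * u b < 0"
      using mult_less_cancel_left_pos[OF zero_less_power[OF ab(1)], of "p - 1" "u a * u b" 0]
      by simp
  qed
  \<comment> \<open>After \<beta> 0 is replaced by B, M = \<rho>^q (B w + \<rho>^(p-q) (A +
    \<rho>^(q-1) u)). The brackets are perturbed from the inside outwards, and A \<noteq> 0 makes
    the inner one nonzero at 0, as the second perturbation requires.\<close>
  have "q - 1 \<ge> 1" using q by simp
  from sign_pairs_perturb[OF open_J pos_J[OF order_refl] u_cont continuous_on_const[of J 1] u0 one_neq_zero this Cu]
  obtain A C1 where A: "A \<noteq> 0" and C1: "sign_pairs (\<lambda>x. A * 1 + x ^ (q - 1) * u x) (J - {0}) C1"
    "card C1 = card C + (if even (q - 1) then 2 else 1)" by blast
  define v where "v = (\<lambda>x. A * 1 + x ^ (q - 1) * u x)"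
  have v: "continuous_on J v" "v 0 \<noteq> 0"
    unfolding v_def using A q by (auto intro!: continuous_intros u_cont simp: zero_power)
  define w where "w = (\<lambda>\<rho>. Psi (e 0) \<kappa> (\<rho> ^ (p - 1)))"
  have w_cont: "continuous_on J w"
    unfolding w_def by (rule Ck_continuous[OF Psi_pow_Ck[OF e_cont]])
  have "integral {0..T} (e 0) \<noteq> 0"
    using integral_eq_0_iff[OF e_cont T_pos, of 0] e_pos T_pos by (force simp: less_imp_le)
  then have w0: "w 0 \<noteq> 0" unfolding w_def p0 Psi_zero .
  have "p - q \<ge> 1" using assms(2) by simp
  from sign_pairs_perturb[OF open_J pos_J[OF order_refl] v(1) w_cont v(2) w0 this C1(1)[folded v_def]]
  obtain B C2 where C2: "sign_pairs (\<lambda>x. B * w x + x ^ (p - q) * v x) (J - {0}) C2"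
    "card C2 = card C1 + (if even (p - q) then 2 else 1)" by blast
  have "continuous_on (J - {0}) (\<lambda>x. B * w x + x ^ (p - q) * v x)"
    by (intro continuous_intros continuous_on_subset[OF w_cont] continuous_on_subset[OF v(1)]) auto
  from sign_pairs_zeros[OF C2(1) this] obtain X where X: "finite X" "card X = card C2" "X \<subseteq> J - {0}"
    "\<And>x. x \<in> X \<Longrightarrow> B * w x + x ^ (p - q) * v x = 0" by blast
  define \<gamma> where "\<gamma> = \<beta>(0 := B)"
  obtain i where "i \<in> S" "\<beta> i \<noteq> 0" using \<beta>(1) by (auto simp: nontriv_def)
  then have \<gamma>: "nontriv \<gamma>" using \<beta>0 by (auto simp: nontriv_def \<gamma>_def intro!: bexI[of _ i])
  have "M A \<gamma> \<rho> = 0" if \<rho>: "\<rho> \<in> X" for \<rho>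
  proof -
    have "\<rho> ^ (p - 1) \<in> D" using \<rho> X(3) by (auto simp: J_def)
    then have "Phi \<gamma> \<kappa> \<rho> = B * w \<rho> + Phi \<beta> \<kappa> \<rho>"
      unfolding Phi_def w_def Psi_h[OF \<open>\<rho> ^ (p - 1) \<in> D\<close>] sum.remove[OF S(1,2)]
      using \<beta>0 by (simp add: \<gamma>_def)
    moreover have pw: "\<rho> ^ q * \<rho> ^ (p - q) = \<rho> ^ p" "\<rho> ^ (p - q) * \<rho> ^ (q - 1) = \<rho> ^ (p - 1)"
      using assms(2) q by (simp_all flip: power_add)
    moreover have "\<rho> ^ q * (B * w \<rho> + \<rho> ^ (p - q) * v \<rho>)
        = A * (\<rho> ^ q * \<rho> ^ (p - q)) + \<rho> ^ q * (B * w \<rho> + \<rho> ^ (p - q) * \<rho> ^ (q - 1) * u \<rho>)"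
      unfolding v_def by algebra
    ultimately have "M A \<gamma> \<rho> = \<rho> ^ q * (B * w \<rho> + \<rho> ^ (p - q) * v \<rho>)"
      unfolding M_def Phi_u by (simp only:)
    then show ?thesis using X(4)[OF \<rho>] by simp
  qed
  moreover have "card X = l + 2"
  proof -
    \<comment> \<open>The exponents add up to the odd number p - 1, so the two perturbations create
      1 + 2 zeros, in one order or the other, besides the l - 1 old ones.\<close>
    have "even (q - 1) \<noteq> even (p - q)" using assms q by auto
    then show ?thesis using X(2) C2(2) C1(2) C(2) card by auto
  qed
  ultimately show ?thesis
    using attained[OF M_zeros_even_total[OF disjI1[OF \<gamma>] assms(1)] X(1,3)] by blast
qed

end

section \<open>The Abel equation\<close>

lemma real_analytic_on_continuous:
  assumes "real_analytic_on g U" "I \<subseteq> U"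
  shows "continuous_on I g"
proof (rule continuous_at_imp_continuous_on, rule ballI)
  fix x assume "x \<in> I"
  then obtain r c where r: "r > 0" and c: "\<forall>y. \<bar>y - x\<bar> < r \<longrightarrow> (\<lambda>k. c k * (y - x) ^ k) sums g y"
    using assms unfolding real_analytic_on_def by blast
  have s: "(\<lambda>k. c k * d ^ k) sums g (x + d)" if "norm d < r" for d
    using c[rule_format, of "x + d"] that by simp
  have "(\<lambda>k. c k * 0 ^ k) sums g (x + 0)" by (rule s) (use r in simp)
  then have "g x = c 0" using sums_unique2[OF _ powser_sums_zero] by (metis add_0_right)
  then show "isCont g x"
    using powser_limit_0[OF r s] by (simp add: isCont_iff)
qed

lemma integral_symmetric:
  fixes g :: "real \<Rightarrow> real"
  assumes "T > 0" "continuous_on {-T..T} g"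
  shows "integral {-T..T} g = integral {0..T} (\<lambda>t. g t + g (- t))"
proof -
  have i1: "g integrable_on {-T..T}" by (rule integrable_continuous_interval[OF assms(2)])
  have i2: "g integrable_on {0..T}" "g integrable_on {-T..0}"
    by (rule integrable_continuous_interval, rule continuous_on_subset[OF assms(2)], use assms(1) in auto)+
  have i3: "(\<lambda>t. g (- t)) integrable_on {0..T}"
    using i2(2) Henstock_Kurzweil_Integration.integrable_reflect_real[where f = "\<lambda>t. g (- t)" and a = 0 and b = T] by simp
  have "integral {-T..T} g = integral {-T..0} g + integral {0..T} g"
    using Henstock_Kurzweil_Integration.integral_combine[OF _ _ i1, of 0] assms(1) by simp
  also have "integral {-T..0} g = integral {0..T} (\<lambda>t. g (- t))"
    using Henstock_Kurzweil_Integration.integral_reflect_real[where f = "\<lambda>t. g (- t)" and a = 0 and b = T] by simp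
  finally show ?thesis using integral_add[OF i2(1) i3] by simp
qed

locale abel_equation =
  fixes T :: real and f :: "nat \<Rightarrow> real \<Rightarrow> real" and p q m :: nat
  assumes T: "T > 0"
    and pq: "p \<ge> 2" "q \<ge> 2" "p \<noteq> q"
    and m: "m \<ge> 1"
    and m1: "non_odd_number T f m \<ge> 1"
    and family: "admissible_family T f"
    and f1_odd: "\<forall>t\<in>{-T..T}. f 1 (- t) = - f 1 t"
    and f1_nonneg: "\<forall>t\<in>{0..T}. f 1 t \<ge> 0"
    and f1_nonzero: "\<exists>t\<in>{0..T}. f 1 t \<noteq> 0"
    and CT: "\<forall>r\<ge>1. CT_system
      (map (\<lambda>i. even_part (f i)) (sorted_list_of_set (non_odd_indices T f r))) {0<..<T}"
begin

definition F :: "real \<Rightarrow> real" where "F t = integral {-T..t} (f 1)"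
definition G :: "real \<Rightarrow> real" where "G t = - (real p - 1) * F t"

lemma f_cont: "continuous_on {-T..T} (f i)"
proof -
  obtain U where "{-T..T} \<subseteq> U" "real_analytic_on (f i) U"
    using family unfolding admissible_family_def by blast
  then show ?thesis using real_analytic_on_continuous by blast
qed

lemma f_cont0: "continuous_on {0..T} (f i)"
  by (rule continuous_on_subset[OF f_cont]) (use T in auto)

lemma f_reflect_cont: "continuous_on {0..T} (\<lambda>t. f i (- t))"
  by (rule continuous_on_compose2[OF f_cont]) (use T in \<open>auto intro!: continuous_intros\<close>)

lemma f_int: "i \<ge> 1 \<Longrightarrow> integral {-T..T} (f i) = 0"
  using family unfolding admissible_family_def by blast

lemma f0_pos: "t \<in> {-T..T} \<Longrightarrow> f 0 t > 0"
  using family unfolding admissible_family_def by blast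

lemma F_deriv: "t \<in> {-T..T} \<Longrightarrow> (F has_real_derivative f 1 t) (at t within {-T..T})"
  unfolding F_def[abs_def] by (rule integral_has_real_derivative[OF f_cont])

lemma f_integrable: "{a..b} \<subseteq> {-T..T} \<Longrightarrow> f i integrable_on {a..b}"
  by (rule integrable_continuous_interval, rule continuous_on_subset[OF f_cont])

lemma F_diff:
  assumes "-T \<le> s" "s \<le> t" "t \<le> T"
  shows "F t - F s = integral {s..t} (f 1)"
  using Henstock_Kurzweil_Integration.integral_combine[OF assms(1,2) f_integrable[of "-T" t 1]] assms(3)
  by (simp add: F_def)

lemma F_T: "F T = 0"
  using f_int[of 1] by (simp add: F_def)

lemma F_even:
  assumes "t \<in> {-T..T}"
  shows "F (- t) = F t"
proof -
  have "F (- t) = integral {-T..- t} (f 1)" by (simp add: F_def)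
  also have "\<dots> = integral {t..T} (\<lambda>s. f 1 (- s))"
    using Henstock_Kurzweil_Integration.integral_reflect_real[where f = "\<lambda>s. f 1 (- s)" and a = t and b = T] by simp
  also have "\<dots> = integral {t..T} (\<lambda>s. - f 1 s)"
    by (rule integral_cong) (use f1_odd assms in auto)
  also have "\<dots> = - (F T - F t)" using F_diff[of t T] assms by simp
  finally show ?thesis by (simp add: F_T)
qed

lemma F_mono:
  assumes "0 \<le> s" "s \<le> t" "t \<le> T"
  shows "F s \<le> F t"
proof -
  have "0 \<le> integral {s..t} (f 1)"
    by (rule integral_nonneg[OF f_integrable]) (use assms f1_nonneg in auto)
  then show ?thesis using F_diff[of s t] assms T by simp
qed

lemma F_0: "F 0 < 0"
proof -
  have "integral {0..T} (f 1) \<noteq> 0"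
    using integral_eq_0_iff[OF f_cont0 T, of 1] f1_nonneg f1_nonzero by auto
  moreover have "F 0 \<le> F T" using F_mono[of 0 T] T by simp
  ultimately show ?thesis using F_diff[of 0 T] T F_T by simp
qed

definition "S = non_odd_indices T f m"

lemma S: "finite S" "0 \<in> S" "card S = Suc (non_odd_number T f m)"
proof -
  have "S \<subseteq> {..m}" by (auto simp: S_def non_odd_indices_def)
  then show fin: "finite S" using finite_subset by blast
  have "even_part (f 0) 0 \<noteq> 0" using f0_pos[of 0] T by (simp add: even_part_def)
  then show "0 \<in> S" using T unfolding S_def non_odd_indices_def by (auto intro!: bexI[of _ 0])
  then have "card S > 0" using fin card_gt_0_iff by blast
  then show "card S = Suc (non_odd_number T f m)" by (simp add: non_odd_number_def S_def)
qed

text \<open>The CT condition for r = m at its last level, carried over from positions in the sorted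
  list to the index set S.\<close>

lemma CT_S:
  assumes "\<exists>i\<in>S. \<beta> i \<noteq> 0"
  shows "finite {t\<in>{0<..<T}. (\<Sum>i\<in>S. \<beta> i * even_part (f i) t) = 0} \<and>
    card {t\<in>{0<..<T}. (\<Sum>i\<in>S. \<beta> i * even_part (f i) t) = 0} \<le> non_odd_number T f m"
proof -
  define xs where "xs = sorted_list_of_set S"
  define gs where "gs = map (\<lambda>i. even_part (f i)) xs"
  define l where "l = non_odd_number T f m"
  have xs: "set xs = S" "distinct xs" "length xs = Suc l"
    using S by (simp_all add: xs_def l_def)
  have "CT_system gs {0<..<T}" using CT m by (simp add: gs_def xs_def S_def)
  moreover have "l < length gs" using xs(3) by (simp add: gs_def)
  ultimately have ct: "(\<exists>i\<le>l. \<alpha> i \<noteq> 0) \<longrightarrow> finite {t\<in>{0<..<T}. (\<Sum>i\<le>l. \<alpha> i * (gs ! i) t) = 0} \<and>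
      card {t\<in>{0<..<T}. (\<Sum>i\<le>l. \<alpha> i * (gs ! i) t) = 0} \<le> l" for \<alpha>
    unfolding CT_system_def by blast
  have bij: "bij_betw ((!) xs) {..l} S"
    by (rule bij_betw_nth) (use xs in auto)
  have "(\<Sum>i\<le>l. \<beta> (xs ! i) * (gs ! i) t) = (\<Sum>i\<in>S. \<beta> i * even_part (f i) t)" for t
  proof -
    have "(\<Sum>i\<le>l. \<beta> (xs ! i) * (gs ! i) t) = (\<Sum>i\<le>l. \<beta> (xs ! i) * even_part (f (xs ! i)) t)"
      by (rule sum.cong) (use xs(3) in \<open>auto simp: gs_def\<close>)
    also have "\<dots> = (\<Sum>i\<in>S. \<beta> i * even_part (f i) t)"
      using sum.reindex_bij_betw[OF bij, of "\<lambda>i. \<beta> i * even_part (f i) t"] by simp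
    finally show ?thesis .
  qed
  moreover have "\<exists>i\<le>l. \<beta> (xs ! i) \<noteq> 0"
    using assms bij unfolding bij_betw_def by (metis (no_types, lifting) atMost_iff imageE)
  ultimately show ?thesis using ct[of "\<lambda>i. \<beta> (xs ! i)"] by (simp add: l_def)
qed

sublocale cw: chebyshev_weight T G p q S "\<lambda>i. even_part (f i)" "non_odd_number T f m"
proof
  have p1: "real p - 1 > 0" using pq by simp
  show "continuous_on {0..T} G"
    unfolding G_def[abs_def]
    by (intro continuous_intros continuous_on_subset[OF DERIV_continuous_on[OF F_deriv]]) (use T in auto)
  have G_neg: "G t = (real p - 1) * (- F t)" for t by (simp add: G_def algebra_simps)
  show "0 \<le> G t" if "t \<in> {0..T}" for t
    unfolding G_neg by (rule mult_nonneg_nonneg) (use p1 F_mono[of t T] F_T that in auto)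
  show "G t \<le> G s" if "0 \<le> s" "s \<le> t" "t \<le> T" for s t
    using F_mono[OF that] p1 by (simp add: G_def)
  have "0 < G 0" unfolding G_neg by (rule mult_pos_pos) (use p1 F_0 in auto)
  then show "G T < G 0" by (simp add: G_def F_T)
  show "continuous_on {0..T} (even_part (f i))" for i
    unfolding even_part_def[abs_def] by (intro continuous_intros f_cont0 f_reflect_cont) simp
  show "0 < even_part (f 0) t" if "t \<in> {0..T}" for t
    using f0_pos[of t] f0_pos[of "-t"] that T by (simp add: even_part_def)
  show "integral {0..T} (even_part (f i)) = 0" if "i \<noteq> 0" for i
  proof -
    have "integral {0..T} (even_part (f i)) = integral {0..T} (\<lambda>t. f i t + f i (- t)) / 2"
      unfolding even_part_def[abs_def] by simp
    also have "\<dots> = 0" using integral_symmetric[OF T f_cont, of i] f_int[of i] that by simp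
    finally show ?thesis .
  qed
qed (use T pq S m1 CT_S in auto)

lemma G_even: "t \<in> {-T..T} \<Longrightarrow> G (- t) = G t"
  by (simp add: G_def F_even)

lemma weight_pos:
  assumes "\<rho> \<in> cw.J" "t \<in> {-T..T}"
  shows "1 + \<rho> ^ (p - 1) * G t > 0"
proof (cases "t \<ge> 0")
  case True
  then show ?thesis using cw.D_pos[of "\<rho> ^ (p - 1)" t] assms by (simp add: cw.J_def)
next
  case False
  then show ?thesis using cw.D_pos[of "\<rho> ^ (p - 1)" "- t"] assms G_even[of t] by (simp add: cw.J_def)
qed

text \<open>Evenness of G reduces [-T, T] to [0, T], and monotonicity reduces that to t = 0, which
  is the test defining D.\<close>

lemma unperturbed_domain_eq: "unperturbed_domain T f p = cw.J"
proof -
  have eq: "1 + (1 - real p) * \<rho> ^ (p - 1) * integral {-T..t} (f 1) = 1 + \<rho> ^ (p - 1) * G t" for \<rho> t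
    by (simp add: G_def F_def)
  have "\<rho> \<in> cw.J" if "\<forall>t\<in>{-T..T}. 1 + \<rho> ^ (p - 1) * G t > 0" for \<rho>
    using that T by (auto simp: cw.J_def cw.D_def)
  then show ?thesis unfolding unperturbed_domain_def eq using weight_pos by blast
qed

section \<open>The first-order Melnikov function in explicit form\<close>

definition "c0 = integral {-T..T} (f 0)"

lemma c0: "c0 \<noteq> 0"
  using integral_eq_0_iff[OF f_cont, of 0] T f0_pos unfolding c0_def by (force simp: less_imp_le)

text \<open>All f_k with k \<ge> 1 have mean zero, so P_1 contributes only through its coefficient
  of f_0.\<close>

lemma integral_lin_comb: "integral {-T..T} (lin_comb f k a) = a 0 * c0"
proof -
  have "integral {-T..T} (lin_comb f k a) = (\<Sum>j\<le>k. a j * integral {-T..T} (f j))"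
    unfolding lin_comb_def[abs_def]
    by (subst integral_sum) (auto intro!: integrable_on_mult_right f_integrable)
  also have "\<dots> = (\<Sum>j\<in>{0}. a j * integral {-T..T} (f j))"
    by (rule sum.mono_neutral_right) (auto simp: f_int)
  finally show ?thesis by (simp add: c0_def)
qed

text \<open>The weight is even in t, so folding the integral onto [0, T] leaves the even parts, each
  with the factor 2; indices outside S have zero even part.\<close>

lemma integral_lin_comb_weight:
  assumes "\<rho> \<in> cw.J"
  shows "integral {-T..T} (\<lambda>t. lin_comb f m b t * (1 + \<rho> ^ (p - 1) * G t) powr a) = cw.Phi (\<lambda>i. 2 * b i) a \<rho>"
proof -
  have Gc: "continuous_on {-T..T} G"
    unfolding G_def[abs_def] by (intro continuous_intros DERIV_continuous_on[OF F_deriv])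
  have nz: "\<forall>t\<in>{-T..T}. 1 + \<rho> ^ (p - 1) * G t \<noteq> 0"
    using weight_pos[OF assms] less_numeral_extra(3) by metis
  have "continuous_on {-T..T} (\<lambda>t. lin_comb f m b t * (1 + \<rho> ^ (p - 1) * G t) powr a)"
    unfolding lin_comb_def using nz by (intro continuous_intros f_cont Gc) auto
  from integral_symmetric[OF T this]
  have "integral {-T..T} (\<lambda>t. lin_comb f m b t * (1 + \<rho> ^ (p - 1) * G t) powr a)
    = integral {0..T} (\<lambda>t. lin_comb f m b t * (1 + \<rho> ^ (p - 1) * G t) powr a
        + lin_comb f m b (- t) * (1 + \<rho> ^ (p - 1) * G (- t)) powr a)" .
  also have "\<dots> = integral {0..T} (\<lambda>t. cw.h (\<lambda>i. 2 * b i) t * (1 + \<rho> ^ (p - 1) * G t) powr a)"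
  proof (rule integral_cong)
    fix t assume t: "t \<in> {0..T}"
    have "lin_comb f m b t + lin_comb f m b (- t) = (\<Sum>j\<le>m. 2 * b j * even_part (f j) t)"
      unfolding lin_comb_def even_part_def sum.distrib[symmetric] by (rule sum.cong) (simp_all add: field_simps)
    also have "\<dots> = cw.h (\<lambda>i. 2 * b i) t"
      unfolding cw.h_def
    proof (rule sum.mono_neutral_right)
      show "\<forall>i\<in>{..m} - S. 2 * b i * even_part (f i) t = 0"
        using t T by (auto simp: S_def non_odd_indices_def)
    qed (auto simp: S_def non_odd_indices_def)
    finally show "lin_comb f m b t * (1 + \<rho> ^ (p - 1) * G t) powr a
        + lin_comb f m b (- t) * (1 + \<rho> ^ (p - 1) * G (- t)) powr a
      = cw.h (\<lambda>i. 2 * b i) t * (1 + \<rho> ^ (p - 1) * G t) powr a"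
      using G_even[of t] t T by (simp flip: distrib_right)
  qed
  finally show ?thesis by (simp add: cw.Phi_def cw.Psi_def)
qed

lemma melnikov_eq:
  assumes \<rho>: "\<rho> \<in> cw.J"
  shows "melnikov T f p q n m 1 \<mu> \<rho> = cw.M (fst \<mu> 1 0 * c0) (\<lambda>i. 2 * snd \<mu> 1 i) \<rho>"
proof -
  define P where "P = real p - 1"
  have P: "P > 0" "real (p - 1) = P" using pq by (auto simp: P_def of_nat_diff)
  define w where "w = (\<lambda>t. 1 + \<rho> ^ (p - 1) * G t)"
  have w: "w t > 0" if "t \<in> {-T..T}" for t using weight_pos[OF \<rho> that] by (simp add: w_def)
  have w': "(w has_real_derivative - P * \<rho> ^ (p - 1) * f 1 t) (at t within {-T..T})" if "t \<in> {-T..T}" for t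
    unfolding w_def G_def[abs_def] P_def
    by (rule derivative_eq_intros F_deriv that refl)+ (simp add: algebra_simps)
  have wT: "w T = 1" "w (- T) = 1" using F_T F_even[of T] T by (simp_all add: w_def G_def)
  have wpow: "((\<lambda>t. w t powr a) has_real_derivative - a * P * \<rho> ^ (p - 1) * f 1 t * w t powr (a - 1)) (at t within {-T..T})"
    if "t \<in> {-T..T}" for t a
    using DERIV_chain'[OF w'[OF that] has_real_derivative_powr[OF w[OF that], of a]] by (simp add: mult_ac)
  define x0 where "x0 = (\<lambda>t. \<rho> * w t powr (- 1 / P))"
  \<comment> \<open>This is the derivative of x0 with respect to \<rho>: differentiation gives
    w^(-1/P-1) (w - \<rho>^(p-1) G), and the last bracket is 1.\<close>
  define v where "v = (\<lambda>t. w t powr (- real p / P))"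
  have x0_pow: "x0 t ^ k = \<rho> ^ k * w t powr (- real k / P)" if "t \<in> {-T..T}" for t k
    using w[OF that] by (simp add: x0_def power_mult_distrib powr_power)
  have pP: "- 1 / P - 1 = - real p / P" using P(1) by (simp add: P_def field_simps)
  have "melnikov T f p q n m 1 \<mu> \<rho> = integral {-T..T}
    (\<lambda>t. (lin_comb f n (fst \<mu> 1) t * x0 t ^ p + lin_comb f m (snd \<mu> 1) t * x0 t ^ q) / v t)"
  proof (rule melnikov_first[OF T f_cont])
    fix t assume t: "t \<in> {-T..T}"
    have "(x0 has_real_derivative \<rho> * (1 / P * P * \<rho> ^ (p - 1) * f 1 t * w t powr (- 1 / P - 1))) (at t within {-T..T})"
      unfolding x0_def using DERIV_cmult[OF wpow[OF t, of "- 1 / P"], of \<rho>] by simp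
    moreover have "\<rho> * \<rho> ^ (p - 1) = \<rho> ^ p" using pq by (metis Suc_1 Suc_leD Suc_le_D diff_Suc_1 power_Suc)
    then have "\<rho> * (1 / P * P * \<rho> ^ (p - 1) * f 1 t * w t powr (- 1 / P - 1)) = f 1 t * x0 t ^ p"
      unfolding x0_pow[OF t] pP using P(1) by (simp flip: mult.assoc)
    ultimately show "(x0 has_real_derivative f 1 t * x0 t ^ p) (at t within {-T..T})"
      by (simp only:)
    have "w t powr (- real p / P - 1) = w t powr (- real p / P) * w t powr (- real (p - 1) / P)"
      unfolding powr_add[symmetric] P(2) using P(1) by simp
    then show "(v has_real_derivative real p * f 1 t * x0 t ^ (p - 1) * v t) (at t within {-T..T})"
      unfolding x0_pow[OF t] v_def using wpow[OF t, of "- real p / P"] P(1) by (simp add: mult_ac)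
    show "0 < v t" using w[OF t] by (simp add: v_def)
  qed (simp_all add: x0_def v_def wT)
  also have "\<dots> = integral {-T..T} (\<lambda>t. \<rho> ^ p * lin_comb f n (fst \<mu> 1) t
      + \<rho> ^ q * (lin_comb f m (snd \<mu> 1) t * (1 + \<rho> ^ (p - 1) * G t) powr cw.\<kappa>))"
  proof (rule integral_cong)
    fix t assume t: "t \<in> {-T..T}"
    \<comment> \<open>The exponents satisfy -q/P = \<kappa> - p/P, so dividing by v leaves the
      weight with exponent \<kappa>.\<close>
    have "w t powr (- real q / P) = w t powr cw.\<kappa> * v t"
      unfolding v_def powr_add[symmetric] using P(1) by (simp add: cw.\<kappa>_def P_def[symmetric] field_simps)
    then have pow: "x0 t ^ p = \<rho> ^ p * v t" "x0 t ^ q = \<rho> ^ q * (w t powr cw.\<kappa> * v t)"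
      unfolding x0_pow[OF t] v_def by simp_all
    have "(a * (b * V) + c * (d * (k * V))) / V = b * a + d * (c * k)" if "V \<noteq> 0" for a b c d k V :: real
      using that by (simp add: field_simps)
    moreover have "v t \<noteq> 0" using w[OF t] by (simp add: v_def)
    ultimately show "(lin_comb f n (fst \<mu> 1) t * x0 t ^ p + lin_comb f m (snd \<mu> 1) t * x0 t ^ q) / v t
      = \<rho> ^ p * lin_comb f n (fst \<mu> 1) t + \<rho> ^ q * (lin_comb f m (snd \<mu> 1) t * (1 + \<rho> ^ (p - 1) * G t) powr cw.\<kappa>)"
      unfolding pow w_def by blast
  qed
  also have "\<dots> = \<rho> ^ p * (fst \<mu> 1 0 * c0) + \<rho> ^ q * cw.Phi (\<lambda>i. 2 * snd \<mu> 1 i) cw.\<kappa> \<rho>"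
  proof -
    have lc: "continuous_on {-T..T} (lin_comb f k a)" for k a
      unfolding lin_comb_def[abs_def] by (intro continuous_intros f_cont)
    have wc: "continuous_on {-T..T} w" by (rule DERIV_continuous_on[OF w'])
    have "\<forall>t\<in>{-T..T}. w t \<noteq> 0" using w less_numeral_extra(3) by metis
    then have "continuous_on {-T..T} (\<lambda>t. lin_comb f m (snd \<mu> 1) t * w t powr cw.\<kappa>)"
      by (intro continuous_intros lc wc) auto
    then have "integral {-T..T} (\<lambda>t. \<rho> ^ p * lin_comb f n (fst \<mu> 1) t
      + \<rho> ^ q * (lin_comb f m (snd \<mu> 1) t * w t powr cw.\<kappa>)) = \<rho> ^ p * integral {-T..T} (lin_comb f n (fst \<mu> 1))
      + \<rho> ^ q * integral {-T..T} (\<lambda>t. lin_comb f m (snd \<mu> 1) t * w t powr cw.\<kappa>)"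
      using lc by (subst integral_add) (auto intro!: integrable_continuous_interval continuous_on_mult)
    then show ?thesis
      using integral_lin_comb integral_lin_comb_weight[OF \<rho>] by (simp add: w_def)
  qed
  finally show ?thesis by (simp add: cw.M_def mult.commute)
qed

lemma melnikov_nontrivial:
  assumes "\<exists>\<rho>\<in>cw.J. melnikov T f p q n m 1 \<mu> \<rho> \<noteq> 0"
  shows "cw.nontriv (\<lambda>i. 2 * snd \<mu> 1 i) \<or> fst \<mu> 1 0 * c0 \<noteq> 0"
proof (rule ccontr)
  assume c: "\<not> ?thesis"
  then have "cw.h (\<lambda>i. 2 * snd \<mu> 1 i) = (\<lambda>t. 0)" by (auto simp: cw.h_def cw.nontriv_def)
  then have "cw.M (fst \<mu> 1 0 * c0) (\<lambda>i. 2 * snd \<mu> 1 i) \<rho> = 0" for \<rho>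
    using c by (simp add: cw.M_def cw.Phi_def cw.Psi_def)
  then show False using assms melnikov_eq by metis
qed

lemma melnikov_zeros_le:
  assumes "zeros_le {} (cw.M (fst \<mu> 1 0 * c0) (\<lambda>i. 2 * snd \<mu> 1 i)) I k" "I \<subseteq> cw.J"
  shows "zeros_le {} (melnikov T f p q n m 1 \<mu>) I k"
  using zeros_le_cong[OF cw.open_J assms(2) _ assms(1)] melnikov_eq by metis

lemma melnikov_attains:
  assumes "\<exists>A \<beta>. card (simple_zeros (cw.M A \<beta>) (cw.J - {0})) = N"
  shows "\<exists>\<mu>\<^sub>0. card (simple_zeros (melnikov T f p q n m 1 \<mu>\<^sub>0) (cw.J - {0})) = N"
proof -
  obtain A \<beta> where AB: "card (simple_zeros (cw.M A \<beta>) (cw.J - {0})) = N" using assms by blast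
  \<comment> \<open>Division by c0 and by 2 undoes the normalization in \<open>melnikov_eq\<close>,
    so every pair (A, \<beta>) is realized by some parameter.\<close>
  define \<mu> :: params where "\<mu> = (\<lambda>i j. A / c0, \<lambda>i j. \<beta> j / 2)"
  have eq: "melnikov T f p q n m 1 \<mu> \<rho> = cw.M A \<beta> \<rho>" if "\<rho> \<in> cw.J" for \<rho>
    using melnikov_eq[OF that, of n \<mu>] c0 by (simp add: \<mu>_def)
  have "deriv (melnikov T f p q n m 1 \<mu>) \<rho> = deriv (cw.M A \<beta>) \<rho>" if "\<rho> \<in> cw.J" for \<rho>
    using funpow_deriv_cong[OF cw.open_J eq that, where k = 1] by simp
  then have "simple_zeros (melnikov T f p q n m 1 \<mu>) (cw.J - {0}) = simple_zeros (cw.M A \<beta>) (cw.J - {0})"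
    using eq by (auto simp: simple_zeros_def)
  then show ?thesis using AB by metis
qed

end

theorem theorem2p1:
  fixes T :: real and f :: "nat \<Rightarrow> real \<Rightarrow> real" and p q n m :: nat
  assumes T: "T > 0"
    and pq: "p \<ge> 2" "q \<ge> 2" "p \<noteq> q"
    and nm: "n \<ge> 1" "m \<ge> 1"
    and m1: "non_odd_number T f m \<ge> 1"
    and n1: "non_odd_number T f n \<ge> 1"
    and family: "admissible_family T f"
    and f1_odd: "\<forall>t\<in>{-T..T}. f 1 (- t) = - f 1 t"
    and f1_nonneg: "\<forall>t\<in>{0..T}. f 1 t \<ge> 0"
    and f1_nonzero: "\<exists>t\<in>{0..T}. f 1 t \<noteq> 0"
    and CT: "\<forall>r\<ge>1. CT_system
      (map (\<lambda>i. even_part (f i)) (sorted_list_of_set (non_odd_indices T f r))) {0<..<T}"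
  shows
    "let M1 = melnikov T f p q n m 1;
         J = unperturbed_domain T f p;
         m1 = non_odd_number T f m;
         Zpos = (\<lambda>\<mu>. zero_count (M1 \<mu>) (J \<inter> {0<..}));
         Zneg = (\<lambda>\<mu>. zero_count (M1 \<mu>) (J \<inter> {..<0}));
         nonzero = (\<lambda>\<mu>. \<exists>\<rho>\<in>J. M1 \<mu> \<rho> \<noteq> 0);
         attains = (\<lambda>N. \<exists>\<mu>\<^sub>0. card (simple_zeros (M1 \<mu>\<^sub>0) (J - {0})) = N)
     in
      (odd p \<and> odd q \<longrightarrow>
        (\<forall>\<mu>. nonzero \<mu> \<longrightarrow> Zpos \<mu> \<le> enat (m1 + 1) \<and> Zneg \<mu> \<le> enat (m1 + 1)) \<and>
        attains (2 * (m1 + 1))) \<and>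
      (odd p \<and> even q \<longrightarrow>
        (\<forall>\<mu>. nonzero \<mu> \<longrightarrow> Zpos \<mu> \<le> enat (m1 + 1) \<and> Zneg \<mu> \<le> enat (m1 + 1) \<and>
          \<not> (Zpos \<mu> = enat (m1 + 1) \<and> Zneg \<mu> = enat (m1 + 1))) \<and>
        (p < q \<longrightarrow> attains (2 * m1 + 1)) \<and>
        (p > q \<longrightarrow> attains (2 * m1))) \<and>
      (even p \<and> odd q \<and> p < q \<longrightarrow>
        (\<forall>\<mu>. nonzero \<mu> \<longrightarrow> Zpos \<mu> + Zneg \<mu> \<le> enat (m1 + 1)) \<and>
        attains (m1 + 1)) \<and>
      (even p \<and> (even q \<or> p > q) \<longrightarrow>
        (\<forall>\<mu>. nonzero \<mu> \<longrightarrow> Zpos \<mu> + Zneg \<mu> \<le> enat (m1 + 2)) \<and>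
        attains (m1 + 2))"
proof -
  interpret abel_equation T f p q m
    by unfold_locales (fact T pq nm m1 family f1_odd f1_nonneg f1_nonzero CT)+
  define l where "l = non_odd_number T f m"
  define M1 where "M1 = melnikov T f p q n m 1"
  define Zpos where "Zpos = (\<lambda>\<mu>. zero_count (M1 \<mu>) (cw.J \<inter> {0<..}))"
  define Zneg where "Zneg = (\<lambda>\<mu>. zero_count (M1 \<mu>) (cw.J \<inter> {..<0}))"
  define nonzero where "nonzero = (\<lambda>\<mu>. \<exists>\<rho>\<in>cw.J. M1 \<mu> \<rho> \<noteq> 0)"
  define attains where "attains = (\<lambda>N. \<exists>\<mu>\<^sub>0. card (simple_zeros (M1 \<mu>\<^sub>0) (cw.J - {0})) = N)"
  have side: "Zpos \<mu> \<le> enat (l + 1)" "Zneg \<mu> \<le> enat (l + 1)" if "nonzero \<mu>" for \<mu>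
  proof -
    note nt = melnikov_nontrivial[OF that[unfolded nonzero_def M1_def]]
    show "Zpos \<mu> \<le> enat (l + 1)" unfolding Zpos_def M1_def l_def
      by (intro zero_count_le melnikov_zeros_le cw.M_zeros_side[OF nt]) auto
    show "Zneg \<mu> \<le> enat (l + 1)" unfolding Zneg_def M1_def l_def
      by (intro zero_count_le melnikov_zeros_le cw.M_zeros_side[OF nt]) auto
  qed
  have total: "Zpos \<mu> + Zneg \<mu> \<le> enat k"
    if "zeros_le {} (cw.M (fst \<mu> 1 0 * c0) (\<lambda>i. 2 * snd \<mu> 1 i)) (cw.J - {0}) k" for \<mu> k
    unfolding Zpos_def Zneg_def M1_def
    by (rule zero_count_add_le[OF melnikov_zeros_le cw.J_split(2)])
      (use that in \<open>auto simp: cw.J_split(1)[symmetric]\<close>)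
  have nontriv: "cw.nontriv (\<lambda>i. 2 * snd \<mu> 1 i) \<or> fst \<mu> 1 0 * c0 \<noteq> 0" if "nonzero \<mu>" for \<mu>
    using melnikov_nontrivial that unfolding nonzero_def M1_def by blast
  have att: "attains N" if "\<exists>A \<beta>. card (simple_zeros (cw.M A \<beta>) (cw.J - {0})) = N" for N
    unfolding attains_def M1_def by (rule melnikov_attains[OF that])
  \<comment> \<open>Both equalities together would give 2 l + 2 zeros, one more than the joint bound
    2 l + 1.\<close>
  have "\<not> (Zpos \<mu> = enat (l + 1) \<and> Zneg \<mu> = enat (l + 1))" if "odd p" "even q" "nonzero \<mu>" for \<mu>
    using total[OF cw.M_zeros_odd_even[OF nontriv[OF that(3)] that(1,2)]] by (auto simp: l_def)
  moreover have "attains (2 * (l + 1))" if "odd p" "odd q"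
    unfolding l_def by (rule att[OF cw.attained_odd_odd[OF that]])
  moreover have "attains (2 * l + 1)" if "odd p" "even q" "p < q"
    unfolding l_def by (rule att[OF cw.attained_odd_even_lt[OF that]])
  moreover have "attains (2 * l)" if "odd p"
    unfolding l_def by (rule att[OF cw.attained_odd_even_gt[OF that]])
  moreover have "Zpos \<mu> + Zneg \<mu> \<le> enat (l + 1)" if "even p" "odd q" "p < q" "nonzero \<mu>" for \<mu>
    unfolding l_def by (rule total[OF cw.M_zeros_even_odd[OF nontriv[OF that(4)] that(1-3)]])
  moreover have "attains (l + 1)" if "even p" "odd q" "p < q"
    unfolding l_def by (rule att[OF cw.attained_even_odd[OF that]])
  moreover have "Zpos \<mu> + Zneg \<mu> \<le> enat (l + 2)" if "even p" "nonzero \<mu>" for \<mu>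
    unfolding l_def by (rule total[OF cw.M_zeros_even_total[OF nontriv[OF that(2)] that(1)]])
  moreover have "attains (l + 2)" if "even p" "even q \<or> p > q"
  proof (cases "p < q")
    case True
    then show ?thesis using that att[OF cw.attained_even_lt] by (simp add: l_def)
  next
    case False
    then have "q < p" using pq(3) by simp
    then show ?thesis using that att[OF cw.attained_even_gt] by (simp add: l_def)
  qed
  ultimately have "(odd p \<and> odd q \<longrightarrow>
      (\<forall>\<mu>. nonzero \<mu> \<longrightarrow> Zpos \<mu> \<le> enat (l + 1) \<and> Zneg \<mu> \<le> enat (l + 1)) \<and> attains (2 * (l + 1))) \<and>
    (odd p \<and> even q \<longrightarrow>
      (\<forall>\<mu>. nonzero \<mu> \<longrightarrow> Zpos \<mu> \<le> enat (l + 1) \<and> Zneg \<mu> \<le> enat (l + 1) \<and>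
        \<not> (Zpos \<mu> = enat (l + 1) \<and> Zneg \<mu> = enat (l + 1))) \<and>
      (p < q \<longrightarrow> attains (2 * l + 1)) \<and> (p > q \<longrightarrow> attains (2 * l))) \<and>
    (even p \<and> odd q \<and> p < q \<longrightarrow>
      (\<forall>\<mu>. nonzero \<mu> \<longrightarrow> Zpos \<mu> + Zneg \<mu> \<le> enat (l + 1)) \<and> attains (l + 1)) \<and>
    (even p \<and> (even q \<or> p > q) \<longrightarrow>
      (\<forall>\<mu>. nonzero \<mu> \<longrightarrow> Zpos \<mu> + Zneg \<mu> \<le> enat (l + 2)) \<and> attains (l + 2))"
    using side by blast
  then show ?thesis
    unfolding Let_def unperturbed_domain_eq Zpos_def Zneg_def nonzero_def attains_def l_def M1_def .
qed

end
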